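(* Let $\mathcal{K}$ be a bipartite-regular hypermap on the sphere. Then, up to duality (i.e. for $\mathcal{K}$ or for $\mathcal{D}_{(1\,2)}(\mathcal{K})$), $\mathcal{K}$ is isomorphic to one of the hypermaps in the following list, for some integer $n\ge 1$ in the case of the families depending on $n$. Each listed hypermap is a bipartite-regular hypermap on the sphere with the indicated bipartite-type $(l_1,l_2;m;n')$ (the valencies $l_1,l_2$ being an unordered pair), with $V_1,V_2$ hypervertices in the two $\Delta^{\hat 0}$-orbits (of valency $l_1$, $l_2$ respectively), $E$ hyperedges, $F$ hyperfaces and $|\Omega|$ flags, and it is, up to isomorphism, the unique bipartite-regular hypermap on the sphere with that bipartite-type. $$\begin{array}{l|l|l|l} & (l_1,l_2;m;n') & (V_1,V_2,E,F,|\Omega|) & \text{hypermap}\\ \hline 1 & (1,1;2n;2n) & (n,n,1,1,4n) & \mathrm{Pin}(\mathcal{D}_{(0\,2)}(\mathcal{D}_n))\\ 2 & (1,2;4;2n) & (2n,n,n,2,8n) & \mathrm{Pin}(\mathcal{P}_n)\\ 3 & (1,2;6;6) & (12,6,4,4,48) & \mathrm{Pin}(\mathcal{D}_{(0\,1)}(\mathcal{T}))\\ 4 & (1,2;6;8) & (24,12,8,6,96) & \mathrm{Pin}(\mathcal{D}_{(0\,1)}(\mathcal{C}))\\ 5 & (1,2;6;10) & (60,30,20,12,240) & \mathrm{Pin}(\mathcal{D}_{(0\,1)}(\mathcal{D}))\\ 6 & (1,3;4;6) & (12,4,6,4,48) & \mathrm{Pin}(\mathcal{T})\\ 7 & (1,3;4;8)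 & (24,8,12,6,96) & \mathrm{Pin}(\mathcal{C})\\ 8 & (1,3;4;10) & (60,20,30,12,240) & \mathrm{Pin}(\mathcal{D})\\ 9 & (1,4;4;6) & (24,6,12,8,96) & \mathrm{Pin}(\mathcal{D}_{(0\,2)}(\mathcal{C}))\\ 10 & (1,5;4;6) & (60,12,30,20,240) & \mathrm{Pin}(\mathcal{D}_{(0\,2)}(\mathcal{D}))\\ 11 & (1,n;2;2n) & (n,1,n,1,4n) & \mathrm{Pin}(\mathcal{D}_{(1\,2)}(\mathcal{D}_n))\\ 12 & (1,n;4;4) & (2n,2,n,n,8n) & \mathrm{Pin}(\mathcal{D}_{(0\,2)}(\mathcal{P}_n))\\ 13 & (2,2;2;2n) & (n,n,2n,2,8n) & \mathrm{Wal}(\mathcal{P}_n)\\ 14 & (2,3;2;6) & (6,4,12,4,48) & \mathrm{Wal}(\mathcal{T})\\ 15 & (2,3;2;8) & (12,8,24,6,96) & \mathrm{Wal}(\mathcal{C})\\ 16 & (2,3;2;10) & (30,20,60,12,240) & \mathrm{Wal}(\mathcal{D})\\ 17 & (2,4;2;6) & (12,6,24,8,96) & \mathrm{Wal}(\mathcal{D}_{(0\,2)}(\mathcal{C}))\\ 18 & (2,5;2;6) & (30,12,60,20,240) & \mathrm{Wal}(\mathcal{D}_{(0\,2)}(\mathcal{D}))\\ 19 & (2,n;2;4) & (n,2,2n,n,8n) & \mathrm{Wal}(\mathcal{D}_{(0\,2)}(\mathcal{P}_n))\\ 20 & (3,3;2;4) & (4,4,12,6,48) & \mathrm{Wal}(\mathcal{D}_{(1\,2)}(\mathcal{T}))\\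 21 & (3,4;2;4) & (8,6,24,12,96) & \mathrm{Wal}(\mathcal{D}_{(1\,2)}(\mathcal{C}))\\ 22 & (3,5;2;4) & (20,12,60,30,240) & \mathrm{Wal}(\mathcal{D}_{(1\,2)}(\mathcal{D}))\\ 23 & (n,n;2;2) & (1,1,n,n,4n) & \mathrm{Wal}(\mathcal{D}_n) \end{array}$$
   Context: A hypermap is a tuple $\mathcal{H}=(\Omega;h_0,h_1,h_2)$, where $\Omega$ is a non-empty finite set (of flags) and $h_0,h_1,h_2$ are fixed-point-free involutory permutations of $\Omega$ (acting on the right) generating a group transitive on $\Omega$. For $\{i,j,k\}=\{0,1,2\}$ the $k$-faces are the $\langle h_i,h_j\rangle$-orbits; $0$-, $1$-, $2$-faces are called hypervertices, hyperedges, hyperfaces. The valency of a $k$-face is half its cardinality. $\mathcal{H}$ is uniform of type $(l;m;n)$ if all hypervertices have valency $l$, all hyperedges $m$, all hyperfaces $n$. An isomorphism is a bijection of flags commuting with the respective $h_0,h_1,h_2$. With $V,E,F$ the numbers of hypervertices, hyperedges, hyperfaces, $\mathcal{H}$ is spherical (on the sphere) if $V+E+F-|\Omega|/2=2$. Let $\Delta=\langle R_0,R_1,R_2\mid R_0^2=R_1^2=R_2^2=1\rangle$. It acts on $\Omega$ by $R_i\mapsto h_i$; the stabiliser $H$ in $\Delta$ of a flag is a hypermap subgroup of $\mathcal{H}$ (unique up to conjugation), and $\mathcal{H}$ is isomorphic to the set of right cosets $\Delta/_r H$ with $R_0,R_1,R_2$ acting by right multiplication. Write $x^g=g^{-1}xg$.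 $\Delta^{\hat 0}$ is the normal closure of $\{R_1,R_2\}$ in $\Delta$; it has index $2$ and is the free product of the order-two groups generated by $R_1,R_2,R_1^{R_0},R_2^{R_0}$. $\mathcal{H}$ is bipartite if $H\le\Delta^{\hat 0}$; then $\Omega$ splits into two $\Delta^{\hat 0}$-orbits and each hypervertex lies in one of them. A bipartite hypermap is bipartite-regular if $H\lhd\Delta^{\hat 0}$. It has bipartite-type $(l_1,l_2;m;n')$ if all hypervertices in one $\Delta^{\hat 0}$-orbit have valency $l_1$, all those in the other have valency $l_2$, all hyperedges have valency $m$ and all hyperfaces valency $n'$. $\mathrm{Wal}(\mathcal{H})$ and $\mathrm{Pin}(\mathcal{H})$ are the hypermaps with hypermap subgroups $H\varphi_W^{-1}$ and $H\varphi_P^{-1}$ (full preimages), where $\varphi_W,\varphi_P:\Delta^{\hat 0}\to\Delta$ are the epimorphisms given by $R_1\varphi_W=R_1$, $R_2\varphi_W=R_2$, $R_1^{R_0}\varphi_W=R_0$, $R_2^{R_0}\varphi_W=R_2$; $R_1\varphi_P=R_1$, $R_2\varphi_P=R_2$, $R_1^{R_0}\varphi_P=R_0$, $R_2^{R_0}\varphi_P=R_0$. For a permutation $\sigma$ of $\{0,1,2\}$, $\mathcal{D}_\sigma(\mathcal{H})$ is the hypermap with hypermap subgroup $H\sigma^{\circ}$, where $\sigma^\circ\in\mathrm{Aut}(\Delta)$, $R_i\mapsto R_{i\sigma}$; the $k$-faces of $\mathcal{H}$ are the $k\sigma$-faces of $\mathcal{D}_\sigma(\mathcal{H})$. $\mathcal{T},\mathcal{C},\mathcal{D}$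 (tetrahedron, cube, dodecahedron) denote the unique (up to isomorphism) uniform spherical hypermaps of types $(3;2;3)$, $(3;2;4)$, $(3;2;5)$. For $n\ge1$, $\mathcal{D}_n$ and $\mathcal{P}_n$ denote the unique (up to isomorphism) uniform spherical hypermaps of types $(n;n;1)$ and $(2;2;n)$, with $2n$ and $4n$ flags respectively. *)

theory Defs
  imports Complex_Main "HOL-Algebra.Coset" "HOL-Algebra.Generated_Groups" "HOL-Combinatorics.Transposition"
begin

section \<open>The group \<open>\<Delta> = \<langle>R\<^sub>0, R\<^sub>1, R\<^sub>2 | R\<^sub>0\<^sup>2 = R\<^sub>1\<^sup>2 = R\<^sub>2\<^sup>2 = 1\<rangle>\<close>\<close>

datatype idx = I0 | I1 | I2

text \<open>The relators make each generator its own inverse, so words in the generators alone,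
  modulo the congruence generated by \<open>R\<^sub>i R\<^sub>i = 1\<close>, present \<open>\<Delta>\<close>.\<close>

inductive cancel :: "idx list \<Rightarrow> idx list \<Rightarrow> bool" where
  "cancel (u @ [i, i] @ v) (u @ v)"

quotient_type delta = "idx list" / "equivclp cancel"
  by (rule equivp_evquivclp)

lemma equivclp_cancel_map:
  assumes "\<And>u v. cancel u v \<Longrightarrow> equivclp cancel (f u) (f v)" and "equivclp cancel u v"
  shows "equivclp cancel (f u) (f v)"
  using assms(2)
proof (induction rule: equivclp_induct)
  case (step y z)
  have "equivclp cancel (f y) (f z)"
    using step.hyps(2) by (elim disjE) (erule assms(1), rule equivclp_sym, erule assms(1))
  with step.IH show ?case
    by (rule equivclp_trans)
qed (rule equivclp_refl)

lemma equivclp_cancel_app_left: "equivclp cancel u v \<Longrightarrow> equivclp cancel (w @ u) (w @ v)"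
proof (rule equivclp_cancel_map[where f = "\<lambda>u. w @ u"])
  show "equivclp cancel (w @ a) (w @ b)" if "cancel a b" for a b
    using that
  proof cases
    case (1 u i v)
    then show ?thesis
      using cancel.intros[of "w @ u" i v] by (simp add: r_into_equivclp)
  qed
qed

lemma equivclp_cancel_app_right: "equivclp cancel u v \<Longrightarrow> equivclp cancel (u @ w) (v @ w)"
proof (rule equivclp_cancel_map[where f = "\<lambda>u. u @ w"])
  show "equivclp cancel (a @ w) (b @ w)" if "cancel a b" for a b
    using that
  proof cases
    case (1 u i v)
    then show ?thesis
      using cancel.intros[of u i "v @ w"] by (simp add: r_into_equivclp)
  qed
qed

lift_definition delta_mult :: "delta \<Rightarrow> delta \<Rightarrow> delta" is "(@)"
  using equivclp_cancel_app_left equivclp_cancel_app_right equivclp_trans by meson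

lift_definition delta_one :: delta is "[]" .

lift_definition gen :: "idx \<Rightarrow> delta" is "\<lambda>i. [i]" .

definition Delta :: "delta monoid" where
  "Delta = \<lparr>carrier = UNIV, mult = delta_mult, one = delta_one\<rparr>"

lemma cancel_rev: "equivclp cancel (rev w @ w) []"
proof (induction w)
  case (Cons i w)
  have "cancel (rev w @ [i, i] @ w) (rev w @ w)"
    by (rule cancel.intros)
  then have "equivclp cancel (rev (i # w) @ i # w) (rev w @ w)"
    by (simp add: r_into_equivclp)
  then show ?case
    using Cons.IH by (rule equivclp_trans)
qed simp

lemma group_Delta: "group Delta"
proof (rule groupI)
  fix x assume "x \<in> carrier Delta"
  show "\<exists>y\<in>carrier Delta. y \<otimes>\<^bsub>Delta\<^esub> x = \<one>\<^bsub>Delta\<^esub>"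
    unfolding Delta_def by simp (transfer, use cancel_rev in blast)
qed (auto simp: Delta_def; transfer; simp)+

definition conj_by :: "delta \<Rightarrow> delta \<Rightarrow> delta" where
  "conj_by x g = inv\<^bsub>Delta\<^esub> g \<otimes>\<^bsub>Delta\<^esub> x \<otimes>\<^bsub>Delta\<^esub> g"

definition Delta0 :: "delta set" where
  "Delta0 = \<Inter>{N. N \<lhd> Delta \<and> {gen I1, gen I2} \<subseteq> N}"

abbreviation Delta0_group :: "delta monoid" where
  "Delta0_group \<equiv> Delta\<lparr>carrier := Delta0\<rparr>"


section \<open>Hypermaps\<close>

record 'a hypermap =
  flags :: "'a set"
  hperm :: "idx \<Rightarrow> 'a \<Rightarrow> 'a"

text \<open>The values of \<open>hperm K i\<close> off the flag set are irrelevant.  As the \<open>h\<^sub>i\<close> are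
  involutions, the elements of the group they generate are the products of words in them.\<close>

definition is_hypermap :: "'a hypermap \<Rightarrow> bool" where
  "is_hypermap K \<longleftrightarrow>
     finite (flags K) \<and> flags K \<noteq> {} \<and>
     (\<forall>i. bij_betw (hperm K i) (flags K) (flags K)) \<and>
     (\<forall>i. \<forall>x\<in>flags K. hperm K i x \<noteq> x \<and> hperm K i (hperm K i x) = x) \<and>
     (\<forall>x\<in>flags K. \<forall>y\<in>flags K. \<exists>w. fold (hperm K) w x = y)"

text \<open>The right action of \<open>\<Delta>\<close> by \<open>R\<^sub>i \<mapsto> h\<^sub>i\<close>; on a hypermap the result does not depend on the
  representing word (lemma \<open>act_abs\<close>).\<close>

definition act :: "'a hypermap \<Rightarrow> delta \<Rightarrow> 'a \<Rightarrow> 'a" where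
  "act K g x = fold (hperm K) (rep_delta g) x"

lemma fold_hperm_in_flags:
  assumes "is_hypermap K" "x \<in> flags K" shows "fold (hperm K) w x \<in> flags K"
  using assms(2)
proof (induction w arbitrary: x)
  case (Cons i w)
  then show ?case
    using assms(1) unfolding is_hypermap_def by (metis bij_betw_apply fold_simps(2))
qed simp

lemma act_abs:
  assumes K: "is_hypermap K" and x: "x \<in> flags K"
  shows "act K (abs_delta w) x = fold (hperm K) w x"
proof -
  have "fold (hperm K) u x = fold (hperm K) v x" if "equivclp cancel u v" for u v
    using that
  proof (induction rule: equivclp_induct)
    case (step y z)
    have "fold (hperm K) a x = fold (hperm K) b x" if "cancel a b" for a b
      using that K fold_hperm_in_flags[OF K x] by cases (simp add: is_hypermap_def)
    then show ?case
      using step by metis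
  qed simp
  moreover have "equivclp cancel (rep_delta (abs_delta w)) w"
    by (meson Quotient3_delta equivp_reflp[OF equivp_evquivclp] rep_abs_rsp_left)
  ultimately show ?thesis
    unfolding act_def by blast
qed

lemma act_mult:
  assumes "is_hypermap K" "x \<in> flags K"
  shows "act K (g \<otimes>\<^bsub>Delta\<^esub> k) x = act K k (act K g x)"
proof -
  obtain u v where "g = abs_delta u" "k = abs_delta v"
    by (metis Quotient3_abs_rep Quotient3_delta)
  moreover have "delta_mult (abs_delta u) (abs_delta v) = abs_delta (u @ v)"
    by (simp add: delta_mult.abs_eq)
  ultimately show ?thesis
    using assms by (simp add: Delta_def act_abs fold_hperm_in_flags)
qed

lemma act_gen:
  assumes "is_hypermap K" "x \<in> flags K" shows "act K (gen i) x = hperm K i x"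
  using act_abs[OF assms, of "[i]"] by (simp add: gen.abs_eq)

definition orbits :: "'a hypermap \<Rightarrow> delta set \<Rightarrow> 'a set set" where
  "orbits K S = (\<lambda>x. (\<lambda>g. act K g x) ` S) ` flags K"

definition faces :: "'a hypermap \<Rightarrow> idx \<Rightarrow> 'a set set" where
  "faces K k = orbits K (generate Delta (gen ` {i. i \<noteq> k}))"

abbreviation hypervertices where "hypervertices K \<equiv> faces K I0"
abbreviation hyperedges where "hyperedges K \<equiv> faces K I1"
abbreviation hyperfaces where "hyperfaces K \<equiv> faces K I2"

definition valency :: "'a set \<Rightarrow> nat" where
  "valency f = card f div 2"

definition uniform :: "'a hypermap \<Rightarrow> nat \<Rightarrow> nat \<Rightarrow> nat \<Rightarrow> bool" where
  "uniform K l m n \<longleftrightarrow>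
     (\<forall>f\<in>hypervertices K. valency f = l) \<and>
     (\<forall>f\<in>hyperedges K. valency f = m) \<and>
     (\<forall>f\<in>hyperfaces K. valency f = n)"

definition spherical :: "'a hypermap \<Rightarrow> bool" where
  "spherical K \<longleftrightarrow>
     real (card (hypervertices K)) + real (card (hyperedges K)) + real (card (hyperfaces K))
       - real (card (flags K)) / 2 = 2"

definition hypermap_iso :: "'a hypermap \<Rightarrow> 'b hypermap \<Rightarrow> bool"  (infix "\<cong>\<^sub>h" 50) where
  "K \<cong>\<^sub>h L \<longleftrightarrow>
     (\<exists>f. bij_betw f (flags K) (flags L) \<and>
          (\<forall>i. \<forall>x\<in>flags K. f (hperm K i x) = hperm L i (f x)))"


section \<open>Hypermap subgroups\<close>

definition stab :: "'a hypermap \<Rightarrow> 'a \<Rightarrow> delta set" where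
  "stab K x = {g \<in> carrier Delta. act K g x = x}"

text \<open>The hypermap subgroup is unique up to conjugation; we fix the one of an arbitrarily
  chosen flag.  Everything below depends on this choice only up to isomorphism.\<close>

definition hsub :: "'a hypermap \<Rightarrow> delta set" where
  "hsub K = stab K (SOME x. x \<in> flags K)"

definition coset_hypermap :: "delta set \<Rightarrow> delta set hypermap" where
  "coset_hypermap H =
     \<lparr>flags = rcosets\<^bsub>Delta\<^esub> H, hperm = (\<lambda>i X. X #>\<^bsub>Delta\<^esub> gen i)\<rparr>"

definition bipartite :: "'a hypermap \<Rightarrow> bool" where
  "bipartite K \<longleftrightarrow> hsub K \<subseteq> Delta0"

definition bipartite_regular :: "'a hypermap \<Rightarrow> bool" where
  "bipartite_regular K \<longleftrightarrow> bipartite K \<and> hsub K \<lhd> Delta0_group"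

text \<open>\<open>O1\<close> and \<open>O2\<close> are the two \<open>\<Delta>\<^sup>0\<close>-orbits (for the index-two subgroup above) in either order,
  so \<open>l1\<close>, \<open>l2\<close> form an unordered pair in \<open>has_bipartite_type\<close>.\<close>

definition bipartite_type_via ::
  "'a hypermap \<Rightarrow> 'a set \<Rightarrow> 'a set \<Rightarrow> nat \<times> nat \<times> nat \<times> nat \<Rightarrow> bool" where
  "bipartite_type_via K O1 O2 = (\<lambda>(l1, l2, m, n).
     orbits K Delta0 = {O1, O2} \<and> O1 \<noteq> O2 \<and>
     (\<forall>v\<in>hypervertices K. v \<subseteq> O1 \<longrightarrow> valency v = l1) \<and>
     (\<forall>v\<in>hypervertices K. v \<subseteq> O2 \<longrightarrow> valency v = l2) \<and>
     (\<forall>e\<in>hyperedges K. valency e = m) \<and>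
     (\<forall>f\<in>hyperfaces K. valency f = n))"

definition has_bipartite_type :: "'a hypermap \<Rightarrow> nat \<times> nat \<times> nat \<times> nat \<Rightarrow> bool" where
  "has_bipartite_type K t \<longleftrightarrow> bipartite K \<and> (\<exists>O1 O2. bipartite_type_via K O1 O2 t)"

definition has_bipartite_type_and_numbers ::
  "'a hypermap \<Rightarrow> nat \<times> nat \<times> nat \<times> nat \<Rightarrow> nat \<times> nat \<times> nat \<times> nat \<times> nat \<Rightarrow> bool" where
  "has_bipartite_type_and_numbers K t = (\<lambda>(V1, V2, E, F, N).
     bipartite K \<and>
     (\<exists>O1 O2. bipartite_type_via K O1 O2 t \<and>
        card {v \<in> hypervertices K. v \<subseteq> O1} = V1 \<and>
        card {v \<in> hypervertices K. v \<subseteq> O2} = V2 \<and>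
        card (hyperedges K) = E \<and>
        card (hyperfaces K) = F \<and>
        card (flags K) = N))"


section \<open>The Walsh, Pin and duality constructions\<close>

definition is_phi :: "idx \<Rightarrow> idx \<Rightarrow> idx \<Rightarrow> idx \<Rightarrow> (delta \<Rightarrow> delta) \<Rightarrow> bool" where
  "is_phi a b c d f \<longleftrightarrow>
     f \<in> epi Delta0_group Delta \<and>
     f (gen I1) = gen a \<and> f (gen I2) = gen b \<and>
     f (conj_by (gen I1) (gen I0)) = gen c \<and> f (conj_by (gen I2) (gen I0)) = gen d"

text \<open>Unique on \<open>Delta0\<close>, the only place where the values are used;
  see the lemmas \<open>phi_W\<close> and \<open>phi_P\<close> below for existence.\<close>

definition phi_W :: "delta \<Rightarrow> delta" where
  "phi_W = (SOME f. is_phi I1 I2 I0 I2 f)"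

definition phi_P :: "delta \<Rightarrow> delta" where
  "phi_P = (SOME f. is_phi I1 I2 I0 I0 f)"

definition Wal :: "'a hypermap \<Rightarrow> delta set hypermap" where
  "Wal K = coset_hypermap {g \<in> Delta0. phi_W g \<in> hsub K}"

definition Pin :: "'a hypermap \<Rightarrow> delta set hypermap" where
  "Pin K = coset_hypermap {g \<in> Delta0. phi_P g \<in> hsub K}"

lift_definition sigma_circ :: "(idx \<Rightarrow> idx) \<Rightarrow> delta \<Rightarrow> delta" is map
proof -
  fix \<sigma> :: "idx \<Rightarrow> idx" and u v :: "idx list"
  assume "equivclp cancel u v"
  then show "equivclp cancel (map \<sigma> u) (map \<sigma> v)"
  proof (rule equivclp_cancel_map[rotated])
    show "equivclp cancel (map \<sigma> a) (map \<sigma> b)" if "cancel a b" for a b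
      using that
    proof cases
      case (1 x i y)
      then show ?thesis
        using cancel.intros[of "map \<sigma> x" "\<sigma> i" "map \<sigma> y"] by (simp add: r_into_equivclp)
    qed
  qed
qed

definition dual :: "(idx \<Rightarrow> idx) \<Rightarrow> 'a hypermap \<Rightarrow> delta set hypermap" where
  "dual \<sigma> K = coset_hypermap (sigma_circ \<sigma> ` hsub K)"

abbreviation dual01 where "dual01 \<equiv> dual (Transposition.transpose I0 I1)"
abbreviation dual02 where "dual02 \<equiv> dual (Transposition.transpose I0 I2)"
abbreviation dual12 where "dual12 \<equiv> dual (Transposition.transpose I1 I2)"


section \<open>Existence of the epimorphisms\<close>

text \<open>Reidemeister--Schreier rewriting of a word, \<open>p\<close> being the parity of the number of
  letters \<open>R\<^sub>0\<close> read so far.\<close>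

fun parity_from :: "bool \<Rightarrow> idx list \<Rightarrow> bool" where
  "parity_from p [] = p"
| "parity_from p (i # w) = parity_from (if i = I0 then \<not> p else p) w"

fun rewr :: "(bool \<Rightarrow> idx \<Rightarrow> idx) \<Rightarrow> bool \<Rightarrow> idx list \<Rightarrow> idx list" where
  "rewr t p [] = []"
| "rewr t p (i # w) = (if i = I0 then rewr t (\<not> p) w else t p i # rewr t p w)"

lemma parity_from_append: "parity_from p (u @ v) = parity_from (parity_from p u) v"
  by (induction u arbitrary: p) auto

lemma rewr_append: "rewr t p (u @ v) = rewr t p u @ rewr t (parity_from p u) v"
  by (induction u arbitrary: p) auto

lemma parity_from_xor: "parity_from p u = (p \<noteq> parity_from False u)"
proof (induction u arbitrary: p)
  case (Cons i u)
  show ?case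
    by (cases "i = I0") (simp_all add: Cons.IH[of "\<not> p"] Cons.IH[of True] Cons.IH[of p])
qed simp

lift_definition delta_parity :: "delta \<Rightarrow> bool" is "parity_from False"
proof -
  fix u v :: "idx list" assume "equivclp cancel u v"
  then show "parity_from False u = parity_from False v"
  proof (induction rule: equivclp_induct)
    case (step y z)
    have "parity_from False a = parity_from False b" if "cancel a b" for a b
      using that by cases (simp add: parity_from_append)
    then show ?case using step by metis
  qed simp
qed

lift_definition rewr_delta :: "(bool \<Rightarrow> idx \<Rightarrow> idx) \<Rightarrow> delta \<Rightarrow> delta" is "\<lambda>t. rewr t False"
proof -
  fix t :: "bool \<Rightarrow> idx \<Rightarrow> idx" and u v :: "idx list"
  assume "equivclp cancel u v"
  then show "equivclp cancel (rewr t False u) (rewr t False v)"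
  proof (rule equivclp_cancel_map[rotated])
    fix a b assume "cancel a b"
    then show "equivclp cancel (rewr t False a) (rewr t False b)"
    proof cases
      case (1 x i y)
      show ?thesis
      proof (cases "i = I0")
        case False
        let ?p = "parity_from False x"
        have "cancel (rewr t False x @ [t ?p i, t ?p i] @ rewr t ?p y)
                (rewr t False x @ rewr t ?p y)"
          by (rule cancel.intros)
        then show ?thesis
          using 1 False by (simp add: rewr_append r_into_equivclp)
      qed (use 1 in \<open>simp add: rewr_append\<close>)
    qed
  qed
qed

lemma delta_parity_mult: "delta_parity (delta_mult g k) = (delta_parity g \<noteq> delta_parity k)"
  by transfer (metis parity_from_append parity_from_xor)

lemma delta_parity_one: "\<not> delta_parity delta_one"
  by transfer simp

lemma rewr_delta_mult:
  "\<not> delta_parity g \<Longrightarrow> rewr_delta t (delta_mult g k) = delta_mult (rewr_delta t g) (rewr_delta t k)"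
  by transfer (simp add: rewr_append)

lemma Delta_simps [simp]:
  "carrier Delta = UNIV" "mult Delta = delta_mult" "one Delta = delta_one"
  by (simp_all add: Delta_def)

lemma inv_gen: "inv\<^bsub>Delta\<^esub> (gen i) = gen i"
proof (rule group.inv_equality[OF group_Delta])
  show "gen i \<otimes>\<^bsub>Delta\<^esub> gen i = \<one>\<^bsub>Delta\<^esub>"
    using cancel.intros[of "[]" i "[]"] by simp (transfer, auto intro: r_into_equivclp)
qed simp_all

lemma delta_parity_inv: "delta_parity (inv\<^bsub>Delta\<^esub> g) = delta_parity g"
proof -
  have "delta_mult (inv\<^bsub>Delta\<^esub> g) g = delta_one"
    using group.l_inv[OF group_Delta, of g] by simp
  then show ?thesis
    using delta_parity_mult[of "inv\<^bsub>Delta\<^esub> g" g] delta_parity_one by metis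
qed

lemma even_normal: "{g. \<not> delta_parity g} \<lhd> Delta"
  unfolding group.normal_inv_iff[OF group_Delta]
proof (intro conjI ballI)
  show "subgroup {g. \<not> delta_parity g} Delta"
    by (rule group.subgroupI[OF group_Delta])
      (use delta_parity_one in \<open>auto simp: delta_parity_mult delta_parity_inv\<close>)
qed (simp add: delta_parity_mult delta_parity_inv)

lemma Delta0_even: "g \<in> Delta0 \<Longrightarrow> \<not> delta_parity g"
proof -
  have "\<not> delta_parity (gen I1)" "\<not> delta_parity (gen I2)"
    by (transfer, simp)+
  then show "g \<in> Delta0 \<Longrightarrow> \<not> delta_parity g"
    using even_normal unfolding Delta0_def by blast
qed

lemma Delta0_normal: "Delta0 \<lhd> Delta"
proof -
  let ?C = "{N. N \<lhd> Delta \<and> {gen I1, gen I2} \<subseteq> N}"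
  have "subgroup UNIV Delta"
    using group.subgroup_self[OF group_Delta] by simp
  then have "UNIV \<lhd> Delta"
    by (simp add: group.normal_inv_iff[OF group_Delta])
  then have ne: "?C \<noteq> {}" by blast
  have "subgroup (\<Inter>?C) Delta"
    by (rule group.subgroups_Inter[OF group_Delta _ ne]) (auto simp: normal_imp_subgroup)
  then show ?thesis
    unfolding Delta0_def by (auto simp: group.normal_inv_iff[OF group_Delta])
qed

lemma gen_in_Delta0: "gen I1 \<in> Delta0" "gen I2 \<in> Delta0"
  by (auto simp: Delta0_def)

lemma conj_in_Delta0: "x \<in> Delta0 \<Longrightarrow> conj_by x g \<in> Delta0"
  using normal.inv_op_closed1[OF Delta0_normal] by (simp add: conj_by_def)

lemma ex_is_phi:
  assumes surj: "{a, b, c, d} = (UNIV :: idx set)"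
  shows "\<exists>f. is_phi a b c d f"
proof -
  define t where "t = (\<lambda>p i. if p then (if i = I1 then c else d) else (if i = I1 then a else b))"
  let ?f = "rewr_delta t"
  have hom: "?f \<in> hom Delta0_group Delta"
    by (auto simp: hom_def rewr_delta_mult Delta0_even)
  have vals: "?f (gen I1) = gen a" "?f (gen I2) = gen b"
    "?f (conj_by (gen I1) (gen I0)) = gen c" "?f (conj_by (gen I2) (gen I0)) = gen d"
    unfolding conj_by_def inv_gen Delta_simps
    by (simp_all add: gen.abs_eq delta_mult.abs_eq rewr_delta.abs_eq t_def)
  have gens: "gen i \<in> ?f ` Delta0" for i
  proof -
    have "i = a \<or> i = b \<or> i = c \<or> i = d"
      using surj by auto
    then show ?thesis
      using vals gen_in_Delta0 conj_in_Delta0 image_eqI[of _ ?f] by metis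
  qed
  have sub0: "subgroup Delta0 Delta"
    using Delta0_normal by (rule normal_imp_subgroup)
  have one: "delta_one \<in> ?f ` Delta0"
  proof
    show "delta_one = ?f delta_one" by transfer simp
    show "delta_one \<in> Delta0" using subgroup.one_closed[OF sub0] by simp
  qed
  have step: "delta_mult x y \<in> ?f ` Delta0" if "x \<in> ?f ` Delta0" "y \<in> ?f ` Delta0" for x y
    using that subgroup.m_closed[OF sub0] by (force simp: rewr_delta_mult[symmetric] Delta0_even)
  have "abs_delta w \<in> ?f ` Delta0" for w
  proof (induction w)
    case Nil
    then show ?case using one by (simp add: delta_one.abs_eq)
  next
    case (Cons i w)
    have "abs_delta (i # w) = delta_mult (gen i) (abs_delta w)"
      by (simp add: gen.abs_eq delta_mult.abs_eq)
    then show ?case using step[OF gens Cons.IH] by simp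
  qed
  then have "?f ` Delta0 = UNIV"
    by (metis Quotient3_abs_rep Quotient3_delta UNIV_eq_I)
  then have "is_phi a b c d ?f"
    using hom vals by (simp add: is_phi_def epi_def)
  then show ?thesis by blast
qed

lemma UNIV_idx: "UNIV = {I0, I1, I2}"
  using idx.exhaust by auto

lemma phi_W: "is_phi I1 I2 I0 I2 phi_W"
  unfolding phi_W_def by (rule someI_ex[OF ex_is_phi]) (auto simp: UNIV_idx)

lemma phi_P: "is_phi I1 I2 I0 I0 phi_P"
  unfolding phi_P_def by (rule someI_ex[OF ex_is_phi]) (auto simp: UNIV_idx)


section \<open>The list of hypermaps\<close>

text \<open>Representatives of the isomorphism classes; \<open>nat\<close> is large enough to carry every finite
  hypermap.\<close>

definition uniform_sphere :: "nat \<Rightarrow> nat \<Rightarrow> nat \<Rightarrow> nat hypermap" where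
  "uniform_sphere l m n = (SOME K. is_hypermap K \<and> spherical K \<and> uniform K l m n)"

abbreviation tetrahedron where "tetrahedron \<equiv> uniform_sphere 3 2 3"
abbreviation cube where "cube \<equiv> uniform_sphere 3 2 4"
abbreviation dodecahedron where "dodecahedron \<equiv> uniform_sphere 3 2 5"
abbreviation dihedral_D where "dihedral_D n \<equiv> uniform_sphere n n 1"
abbreviation prism_P where "prism_P n \<equiv> uniform_sphere 2 2 n"

text \<open>Rows \<open>((l1, l2, m, n'), (V1, V2, E, F, |\<Omega>|), hypermap)\<close>.\<close>

definition classification ::
  "nat \<Rightarrow> ((nat \<times> nat \<times> nat \<times> nat) \<times> (nat \<times> nat \<times> nat \<times> nat \<times> nat) \<times> delta set hypermap) list"
where
  "classification n =
   [((1, 1, 2*n, 2*n), (n, n, 1, 1, 4*n),      Pin (dual02 (dihedral_D n))),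
    ((1, 2, 4, 2*n),   (2*n, n, n, 2, 8*n),    Pin (prism_P n)),
    ((1, 2, 6, 6),     (12, 6, 4, 4, 48),      Pin (dual01 tetrahedron)),
    ((1, 2, 6, 8),     (24, 12, 8, 6, 96),     Pin (dual01 cube)),
    ((1, 2, 6, 10),    (60, 30, 20, 12, 240),  Pin (dual01 dodecahedron)),
    ((1, 3, 4, 6),     (12, 4, 6, 4, 48),      Pin tetrahedron),
    ((1, 3, 4, 8),     (24, 8, 12, 6, 96),     Pin cube),
    ((1, 3, 4, 10),    (60, 20, 30, 12, 240),  Pin dodecahedron),
    ((1, 4, 4, 6),     (24, 6, 12, 8, 96),     Pin (dual02 cube)),
    ((1, 5, 4, 6),     (60, 12, 30, 20, 240),  Pin (dual02 dodecahedron)),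
    ((1, n, 2, 2*n),   (n, 1, n, 1, 4*n),      Pin (dual12 (dihedral_D n))),
    ((1, n, 4, 4),     (2*n, 2, n, n, 8*n),    Pin (dual02 (prism_P n))),
    ((2, 2, 2, 2*n),   (n, n, 2*n, 2, 8*n),    Wal (prism_P n)),
    ((2, 3, 2, 6),     (6, 4, 12, 4, 48),      Wal tetrahedron),
    ((2, 3, 2, 8),     (12, 8, 24, 6, 96),     Wal cube),
    ((2, 3, 2, 10),    (30, 20, 60, 12, 240),  Wal dodecahedron),
    ((2, 4, 2, 6),     (12, 6, 24, 8, 96),     Wal (dual02 cube)),
    ((2, 5, 2, 6),     (30, 12, 60, 20, 240),  Wal (dual02 dodecahedron)),
    ((2, n, 2, 4),     (n, 2, 2*n, n, 8*n),    Wal (dual02 (prism_P n))),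
    ((3, 3, 2, 4),     (4, 4, 12, 6, 48),      Wal (dual12 tetrahedron)),
    ((3, 4, 2, 4),     (8, 6, 24, 12, 96),     Wal (dual12 cube)),
    ((3, 5, 2, 4),     (20, 12, 60, 30, 240),  Wal (dual12 dodecahedron)),
    ((n, n, 2, 2),     (1, 1, n, n, 4*n),      Wal (dihedral_D n))]"

end

theory Submission
  imports Defs
begin

text \<open>The quotient of \<open>\<Delta>\<^sup>0\<close> by the hypermap subgroup of a bipartite-regular hypermap is generated by
  four involutions, the images \<open>A\<close>, \<open>B\<close>, \<open>C\<close>, \<open>D\<close> of \<open>R\<^sub>1\<close>, \<open>R\<^sub>2\<close> and their conjugates by
  \<open>R\<^sub>0\<close>.  In the type \<open>(l\<^sub>1, l\<^sub>2; m; n')\<close> the numbers \<open>l\<^sub>1\<close>, \<open>l\<^sub>2\<close>, \<open>m/2\<close>, \<open>n'/2\<close> are the orders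
  of \<open>AB\<close>, \<open>CD\<close>, \<open>BD\<close>, \<open>AC\<close>.  On the sphere Euler's formula reads
  \<open>|\<Omega>| (1/l\<^sub>1 + 1/l\<^sub>2 + 2/m + 2/n' - 2) = 8\<close> (\<open>euler_bip\<close>), so one of these four numbers is 1.
  If it is the only one, then the other three are the periods of a spherical
  triangle.  If there is another one, then so many of the generators are identified that
  the remaining two numbers coincide (\<open>vertices_1_1\<close>, \<open>edges_2_faces_2\<close>, \<open>vertex_1_commute\<close>).
  Up to exchanging the colours and dualising, the types that survive are the ones in the
  list (\<open>bip_data_listed\<close>).

  A spherical hypermap is determined by the valencies of its faces, in the sense of
  \<open>spherical_iso\<close>.  The reason is Euler's inequality \<open>V + E + F - |\<Omega>|/2 \<le> 2\<close> for all
  hypermaps (\<open>euler_le_2\<close>).  Two spherical hypermaps with matching valencies have a common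
  covering, a connected component of their product, which again has the same valencies.  A
  covering with \<open>d\<close> sheets that preserves the valencies multiplies the Euler characteristic by \<open>d\<close>;
  the inequality \<open>2 d \<le> 2\<close> makes both projections isomorphisms.  Applied to two
  bipartite-regular hypermaps of the same type this is the uniqueness statement.  Applied to a
  single uniform spherical hypermap it yields regularity, and this is what makes the
  listed hypermaps bipartite-regular.

  The listed hypermaps are analysed on explicit flags.  \<open>Wal\<close> and \<open>Pin\<close> become
  a two-sheeted construction \<open>cover\<close>, duality becomes a relabelling of the involutions, and
  the valencies of the results are periods of products of two involutions.  What remains is to
  exhibit one uniform spherical hypermap of each type; the three sporadic ones come from \<open>A\<^sub>4\<close>, \<open>S\<^sub>4\<close>
  and \<open>A\<^sub>5\<close> permuting the places of tuples.\<close>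

section \<open>Words acting on flags\<close>

abbreviation walk :: "'a hypermap \<Rightarrow> idx list \<Rightarrow> 'a \<Rightarrow> 'a" where
  "walk K \<equiv> fold (hperm K)"

lemma hperm_closed: "is_hypermap K \<Longrightarrow> x \<in> flags K \<Longrightarrow> hperm K i x \<in> flags K"
  using fold_hperm_in_flags[of K x "[i]"] by simp

lemma hperm_hperm: "is_hypermap K \<Longrightarrow> x \<in> flags K \<Longrightarrow> hperm K i (hperm K i x) = x"
  by (simp add: is_hypermap_def)

lemma hperm_neq: "is_hypermap K \<Longrightarrow> x \<in> flags K \<Longrightarrow> hperm K i x \<noteq> x"
  by (simp add: is_hypermap_def)

lemma hperm_inj:
  "is_hypermap K \<Longrightarrow> x \<in> flags K \<Longrightarrow> y \<in> flags K \<Longrightarrow> hperm K i x = hperm K i y \<longleftrightarrow> x = y"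
  using hperm_hperm by metis

lemma hypermap_connected: "is_hypermap K \<Longrightarrow> x \<in> flags K \<Longrightarrow> y \<in> flags K \<Longrightarrow> \<exists>w. walk K w x = y"
  unfolding is_hypermap_def by blast

lemma hypermap_finite: "is_hypermap K \<Longrightarrow> finite (flags K)"
  by (simp add: is_hypermap_def)

lemma is_hypermapI:
  assumes "finite (flags K)" "flags K \<noteq> {}"
    and "\<And>i x. x \<in> flags K \<Longrightarrow> hperm K i x \<in> flags K"
    and "\<And>i x. x \<in> flags K \<Longrightarrow> hperm K i x \<noteq> x"
    and "\<And>i x. x \<in> flags K \<Longrightarrow> hperm K i (hperm K i x) = x"
    and "\<And>x y. x \<in> flags K \<Longrightarrow> y \<in> flags K \<Longrightarrow> \<exists>w. walk K w x = y"
  shows "is_hypermap K"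
proof -
  have "bij_betw (hperm K i) (flags K) (flags K)" for i
    by (rule bij_betwI[where g = "hperm K i"]) (use assms in auto)
  then show ?thesis
    using assms by (simp add: is_hypermap_def)
qed

lemma walk_rev_walk:
  "is_hypermap K \<Longrightarrow> x \<in> flags K \<Longrightarrow> walk K (rev w) (walk K w x) = x"
proof (induction w arbitrary: x)
  case (Cons i w)
  then show ?case by (simp add: hperm_closed hperm_hperm)
qed simp

lemma walk_walk_rev:
  "is_hypermap K \<Longrightarrow> x \<in> flags K \<Longrightarrow> walk K w (walk K (rev w) x) = x"
  using walk_rev_walk[of K x "rev w"] by simp

lemma closed_flags_eq:
  assumes K: "is_hypermap K" and S: "S \<subseteq> flags K" "S \<noteq> {}"
    and closed: "\<And>x i. x \<in> S \<Longrightarrow> hperm K i x \<in> S"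
  shows "S = flags K"
proof -
  obtain x where x: "x \<in> S" using S by blast
  have "walk K w x \<in> S" for w
    using x by (induction w arbitrary: x) (auto intro: closed)
  then show ?thesis
    using hypermap_connected[OF K] x S(1) by blast
qed

section \<open>Faces and their degrees\<close>

definition face :: "'a hypermap \<Rightarrow> idx \<Rightarrow> 'a \<Rightarrow> 'a set" where
  "face K k x = {walk K w x | w. k \<notin> set w}"

definition deg :: "'a hypermap \<Rightarrow> idx \<Rightarrow> 'a \<Rightarrow> nat" where
  "deg K k x = valency (face K k x)"

lemma abs_delta_surj: "\<exists>w. g = abs_delta w"
  by (metis Quotient3_abs_rep Quotient3_delta)

lemma generate_gens: "generate Delta (gen ` J) = abs_delta ` {w. set w \<subseteq> J}"
proof (intro equalityI subsetI)
  fix g assume "g \<in> generate Delta (gen ` J)"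
  then show "g \<in> abs_delta ` {w. set w \<subseteq> J}"
  proof (induction rule: generate.induct)
    case one
    have "delta_one = abs_delta []" by (simp add: delta_one.abs_eq)
    then show ?case by auto
  next
    case (incl h)
    then obtain i where "i \<in> J" "h = abs_delta [i]" by (auto simp: gen.abs_eq)
    then show ?case by auto
  next
    case (inv h)
    then obtain i where "i \<in> J" "inv\<^bsub>Delta\<^esub> h = abs_delta [i]"
      by (metis gen.abs_eq imageE inv_gen)
    then show ?case by auto
  next
    case (eng h1 h2)
    then obtain u v where "set u \<subseteq> J" "set v \<subseteq> J" "h1 = abs_delta u" "h2 = abs_delta v"
      by auto
    then have "h1 \<otimes>\<^bsub>Delta\<^esub> h2 = abs_delta (u @ v)" "set (u @ v) \<subseteq> J"
      by (auto simp: delta_mult.abs_eq)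
    then show ?case by blast
  qed
next
  fix g assume "g \<in> abs_delta ` {w. set w \<subseteq> J}"
  then obtain w where "set w \<subseteq> J" "g = abs_delta w" by auto
  then show "g \<in> generate Delta (gen ` J)"
  proof (induction w arbitrary: g)
    case Nil
    then show ?case
      using generate.one[of Delta] by (simp add: delta_one.abs_eq)
  next
    case (Cons i w)
    have "gen i \<otimes>\<^bsub>Delta\<^esub> abs_delta w \<in> generate Delta (gen ` J)"
      using Cons by (intro generate.eng) (auto intro: generate.incl)
    then show ?case
      using Cons.prems by (simp add: gen.abs_eq delta_mult.abs_eq)
  qed
qed

lemma orbits_words:
  assumes "is_hypermap K"
  shows "orbits K (abs_delta ` W) = (\<lambda>x. {walk K w x | w. w \<in> W}) ` flags K"
  unfolding orbits_def image_image
  by (intro image_cong refl) (simp add: act_abs[OF assms] setcompr_eq_image)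

lemma faces_eq:
  assumes "is_hypermap K" shows "faces K k = face K k ` flags K"
proof -
  have "{w. set w \<subseteq> {i. i \<noteq> k}} = {w. k \<notin> set w}" by auto
  then show ?thesis
    unfolding faces_def generate_gens by (simp add: orbits_words[OF assms] face_def)
qed

lemma faceI: "k \<notin> set w \<Longrightarrow> walk K w x \<in> face K k x"
  unfolding face_def by blast

lemma face_self: "x \<in> face K k x"
  using faceI[of k "[]" K x] by simp

lemma face_subset: "is_hypermap K \<Longrightarrow> x \<in> flags K \<Longrightarrow> face K k x \<subseteq> flags K"
  unfolding face_def by (auto simp: fold_hperm_in_flags)

lemma face_eq:
  assumes K: "is_hypermap K" and x: "x \<in> flags K" and y: "y \<in> face K k x"
  shows "face K k y = face K k x"
proof -
  obtain u where u: "k \<notin> set u" "y = walk K u x" using y by (auto simp: face_def)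
  then have x': "x = walk K (rev u) y" using walk_rev_walk[OF K x] by simp
  show ?thesis
  proof (intro equalityI subsetI)
    fix z assume "z \<in> face K k y"
    then obtain w where "k \<notin> set w" "z = walk K w y" by (auto simp: face_def)
    then show "z \<in> face K k x" using u faceI[of k "u @ w" K x] by simp
  next
    fix z assume "z \<in> face K k x"
    then obtain w where "k \<notin> set w" "z = walk K w x" by (auto simp: face_def)
    then show "z \<in> face K k y" using u(1) x' faceI[of k "rev u @ w" K y] by simp
  qed
qed

lemma face_hperm:
  assumes "is_hypermap K" "x \<in> flags K" "i \<noteq> k"
  shows "face K k (hperm K i x) = face K k x"
proof (rule face_eq)
  show "hperm K i x \<in> face K k x" using faceI[of k "[i]" K x] assms by simp
qed (use assms in auto)

lemma deg_hperm:
  "is_hypermap K \<Longrightarrow> x \<in> flags K \<Longrightarrow> i \<noteq> k \<Longrightarrow> deg K k (hperm K i x) = deg K k x"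
  by (simp add: deg_def face_hperm)

subsection \<open>The degree as a period\<close>

definition has_period :: "('a \<Rightarrow> 'a) \<Rightarrow> 'a \<Rightarrow> nat \<Rightarrow> bool" where
  "has_period f x p \<longleftrightarrow> 0 < p \<and> (\<forall>n. (f ^^ n) x = x \<longleftrightarrow> p dvd n)"

lemma has_period_unique: "has_period f x p \<Longrightarrow> has_period f x q \<Longrightarrow> p = q"
  by (meson dvd_antisym dvd_refl has_period_def)

lemma has_periodI:
  assumes "0 < p" "(f ^^ p) x = x" "\<And>q. 0 < q \<Longrightarrow> q < p \<Longrightarrow> (f ^^ q) x \<noteq> x"
  shows "has_period f x p"
proof -
  have "(f ^^ n) x = x \<longleftrightarrow> p dvd n" for n
  proof -
    have "(f ^^ n) x = (f ^^ (n mod p)) x"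
      using funpow_mod_eq[OF assms(2)] by metis
    moreover have "(f ^^ (n mod p)) x = x \<longleftrightarrow> n mod p = 0"
      using assms(3)[of "n mod p"] assms(1) by auto
    ultimately show ?thesis by (simp add: dvd_eq_mod_eq_0)
  qed
  then show ?thesis using assms(1) by (simp add: has_period_def)
qed

lemma has_period_exists:
  assumes fin: "finite S" and x: "x \<in> S" and f: "bij_betw f S S"
  shows "\<exists>p. has_period f x p"
proof -
  have S: "(f ^^ n) y \<in> S" if "y \<in> S" for n y
    using that by (induction n) (use f in \<open>auto simp: bij_betw_apply\<close>)
  have inj: "y = z" if "(f ^^ n) y = (f ^^ n) z" "y \<in> S" "z \<in> S" for n y z
    using that
  proof (induction n)
    case (Suc n)
    then show ?case
      using f S[of y n] S[of z n] by (auto simp: bij_betw_def inj_on_def)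
  qed simp
  have "finite (range (\<lambda>n. (f ^^ n) x))"
    by (rule finite_subset[OF _ fin]) (use S[OF x] in auto)
  then have "\<not> inj (\<lambda>n. (f ^^ n) x)"
    using finite_imageD infinite_UNIV_nat by blast
  then obtain a b where ab: "a < b" "(f ^^ a) x = (f ^^ b) x"
    unfolding inj_def by (metis linorder_neqE_nat)
  then have "(f ^^ a) x = (f ^^ a) ((f ^^ (b - a)) x)"
    using funpow_add[of a "b - a" f] by simp
  then have "(f ^^ (b - a)) x = x"
    using inj[OF _ x S[OF x]] by metis
  then have ex: "0 < b - a \<and> (f ^^ (b - a)) x = x" using ab by simp
  define p where "p = (LEAST n. 0 < n \<and> (f ^^ n) x = x)"
  have "0 < p \<and> (f ^^ p) x = x"
    unfolding p_def by (rule LeastI[of "\<lambda>n. 0 < n \<and> (f ^^ n) x = x", OF ex])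
  moreover have "(f ^^ q) x \<noteq> x" if "0 < q" "q < p" for q
    using not_less_Least[of q "\<lambda>n. 0 < n \<and> (f ^^ n) x = x"] that unfolding p_def by blast
  ultimately show ?thesis using has_periodI by metis
qed

abbreviation rot :: "'a hypermap \<Rightarrow> idx \<Rightarrow> idx \<Rightarrow> 'a \<Rightarrow> 'a" where
  "rot K i j \<equiv> \<lambda>x. hperm K j (hperm K i x)"

lemma rot_closed: "is_hypermap K \<Longrightarrow> x \<in> flags K \<Longrightarrow> (rot K i j ^^ n) x \<in> flags K"
  by (induction n) (auto simp: hperm_closed)

lemma rot_words: "(rot K i j ^^ n) x = walk K (concat (replicate n [i, j])) x"
  by (induction n arbitrary: x) (auto simp del: funpow.simps simp: funpow_Suc_right)

text \<open>A word of odd length in two involutions is conjugate to one of them, and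
  so fixes no flag either.\<close>

lemma odd_dihedral_word_no_fix:
  assumes K: "is_hypermap K"
  shows "z \<in> flags K \<Longrightarrow> hperm K i ((rot K i j ^^ c) z) \<noteq> z"
proof (induction c arbitrary: z rule: nat_induct2)
  case 0
  then show ?case by (simp add: hperm_neq[OF K])
next
  case 1
  then show ?case
    using hperm_neq[OF K] hperm_hperm[OF K] hperm_closed[OF K] by (auto dest: sym) metis
next
  case (step c)
  let ?y = "rot K i j z"
  have y: "?y \<in> flags K" using step.prems by (simp add: hperm_closed K)
  have z: "hperm K i (hperm K j ?y) = z"
    using step.prems by (simp add: hperm_closed hperm_hperm K)
  have e: "(rot K i j ^^ (c + 2)) z = rot K i j ((rot K i j ^^ c) ?y)"
    using funpow_swap1[of "rot K i j" c z] by simp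
  show ?case
  proof
    assume "hperm K i ((rot K i j ^^ (c + 2)) z) = z"
    then have "hperm K i (hperm K j (hperm K i ((rot K i j ^^ c) ?y))) = hperm K i (hperm K j ?y)"
      unfolding e z .
    then have "hperm K i ((rot K i j ^^ c) ?y) = ?y"
      using y rot_closed[OF K y] by (simp add: hperm_inj[OF K] hperm_closed[OF K])
    then show False using step.IH[OF y] by blast
  qed
qed

text \<open>This is why \<open>deg\<close> is the order in which \<open>R\<^sub>i R\<^sub>j\<close> acts: the \<open>k\<close>-face of \<open>x\<close> is the
  disjoint union of the orbit of \<open>x\<close> under \<open>R\<^sub>i R\<^sub>j\<close> and the image of that orbit under \<open>R\<^sub>i\<close>.\<close>

lemma card_face_period:
  assumes K: "is_hypermap K" and x: "x \<in> flags K" and ijk: "i \<noteq> j" "k \<noteq> i" "k \<noteq> j"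
    and p: "has_period (rot K i j) x p"
  shows "card (face K k x) = 2 * p"
proof -
  let ?r = "rot K i j"
  define A where "A = (\<lambda>n. (?r ^^ n) x) ` {..<p}"
  define B where "B = hperm K i ` A"
  have p0: "0 < p" and per: "(?r ^^ n) x = x \<longleftrightarrow> p dvd n" for n
    using p by (auto simp: has_period_def)
  have modp: "(?r ^^ n) x = (?r ^^ (n mod p)) x" for n
    using funpow_mod_eq[of p ?r x n] per by simp
  have inA: "(?r ^^ n) x \<in> A" for n
    using modp[of n] p0 unfolding A_def by auto
  have AF: "A \<subseteq> flags K" using rot_closed[OF K x] unfolding A_def by auto
  have BF: "B \<subseteq> flags K" using AF hperm_closed[OF K] unfolding B_def by auto
  have ret: "\<exists>c. (?r ^^ c) ((?r ^^ a) x) = x" for a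
  proof
    show "(?r ^^ (p * a - a)) ((?r ^^ a) x) = x"
    proof -
      have "(?r ^^ (p * a - a)) ((?r ^^ a) x) = (?r ^^ (p * a - a + a)) x"
        by (simp add: funpow_add)
      also have "p * a - a + a = p * a" using p0 by simp
      finally show ?thesis using per by simp
    qed
  qed
  have inj: "inj_on (\<lambda>n. (?r ^^ n) x) {..<p}"
  proof (rule linorder_inj_onI)
    fix a b assume ab: "a < b" "a \<in> {..<p}" "b \<in> {..<p}"
    show "(?r ^^ a) x \<noteq> (?r ^^ b) x"
    proof
      assume eq: "(?r ^^ a) x = (?r ^^ b) x"
      have "(?r ^^ (p - b + a)) x = (?r ^^ (p - b)) ((?r ^^ b) x)"
        using eq by (simp add: funpow_add)
      also have "\<dots> = (?r ^^ (p - b + b)) x" by (simp add: funpow_add)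
      also have "\<dots> = x" using per ab by simp
      finally have "p dvd p - b + a" using per by blast
      then show False using ab nat_dvd_not_less[of "p - b + a" p] by auto
    qed
  qed auto
  have cA: "card A = p" unfolding A_def by (simp add: card_image[OF inj])
  have cB: "card B = p"
    unfolding B_def by (subst card_image)
      (use AF cA in \<open>auto simp: inj_on_def hperm_inj[OF K] subset_iff\<close>)
  have disj: "A \<inter> B = {}"
  proof (rule ccontr)
    assume "A \<inter> B \<noteq> {}"
    then obtain a b where ab: "(?r ^^ a) x = hperm K i ((?r ^^ b) x)"
      unfolding A_def B_def by auto
    obtain c where c: "(?r ^^ c) ((?r ^^ a) x) = x" using ret by blast
    have "hperm K i ((?r ^^ (b + c)) ((?r ^^ a) x)) = (?r ^^ a) x"
      using c ab by (simp add: funpow_add)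
    then show False using odd_dihedral_word_no_fix[OF K rot_closed[OF K x]] by blast
  qed
  have hi: "hperm K i y \<in> A \<union> B" if "y \<in> A \<union> B" for y
    using that AF by (auto simp: B_def hperm_hperm[OF K] subset_iff)
  have hj: "hperm K j y \<in> A \<union> B" if y: "y \<in> A \<union> B" for y
  proof (cases "y \<in> A")
    case True
    then obtain n where n: "y = (?r ^^ n) x" unfolding A_def by auto
    have "y = (?r ^^ Suc (n + (p - 1))) x"
      using modp[of "n + p"] modp[of n] p0 n by simp
    then have "hperm K j y = hperm K i ((?r ^^ (n + (p - 1))) x)"
      using rot_closed[OF K x] by (simp add: hperm_hperm[OF K] hperm_closed[OF K])
    then show ?thesis using inA unfolding B_def by blast
  next
    case False
    then obtain n where "y = hperm K i ((?r ^^ n) x)" using y False unfolding A_def B_def by auto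
    then have "hperm K j y = (?r ^^ Suc n) x" by simp
    then show ?thesis using inA by (metis UnI1)
  qed
  have "face K k x = A \<union> B"
  proof (intro equalityI subsetI)
    fix y assume "y \<in> face K k x"
    then obtain w where w: "k \<notin> set w" "y = walk K w x" by (auto simp: face_def)
    have "walk K w z \<in> A \<union> B" if "z \<in> A \<union> B" "k \<notin> set w" for z w
      using that
    proof (induction w arbitrary: z)
      case (Cons l w)
      have "l = i \<or> l = j"
        using ijk Cons.prems(2) by (cases i; cases j; cases k; cases l) auto
      then have "hperm K l z \<in> A \<union> B" using hi hj Cons.prems(1) by blast
      then show ?case using Cons by simp
    qed simp
    moreover have "x \<in> A" using inA[of 0] by simp
    ultimately show "y \<in> A \<union> B" using w by blast
  next
    fix y assume "y \<in> A \<union> B"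
    then obtain n where "y = (?r ^^ n) x \<or> y = hperm K i ((?r ^^ n) x)"
      unfolding A_def B_def by blast
    moreover have "(?r ^^ n) x \<in> face K k x"
      using faceI[of k "concat (replicate n [i, j])" K x] ijk by (simp add: rot_words)
    moreover have "hperm K i ((?r ^^ n) x) \<in> face K k x"
      using faceI[of k "concat (replicate n [i, j]) @ [i]" K x] ijk by (simp add: rot_words)
    ultimately show "y \<in> face K k x" by blast
  qed
  then show ?thesis
    using cA cB disj AF BF hypermap_finite[OF K]
    by (simp add: card_Un_disjoint finite_subset)
qed

lemma deg_period:
  assumes K: "is_hypermap K" and x: "x \<in> flags K" and ijk: "i \<noteq> j" "k \<noteq> i" "k \<noteq> j"
  shows "has_period (rot K i j) x (deg K k x)"
proof -
  have b: "bij_betw (hperm K i) (flags K) (flags K)" for i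
    using K by (simp add: is_hypermap_def)
  have "bij_betw (rot K i j) (flags K) (flags K)"
    using bij_betw_trans[OF b[of i] b[of j]] by (simp add: o_def)
  then obtain p where p: "has_period (rot K i j) x p"
    using has_period_exists[OF hypermap_finite[OF K] x] by blast
  then show ?thesis
    using card_face_period[OF K x ijk p] by (simp add: deg_def valency_def)
qed

lemma deg_eqI:
  assumes "is_hypermap K" "x \<in> flags K" "i \<noteq> j" "k \<noteq> i" "k \<noteq> j" "has_period (rot K i j) x p"
  shows "deg K k x = p"
  using has_period_unique[OF deg_period[OF assms(1-5)] assms(6)] .

lemma exists_other_idx: "\<exists>i j. i \<noteq> j \<and> k \<noteq> i \<and> k \<noteq> (j :: idx)"
  by (cases k) (meson idx.distinct)+

lemma card_face: "is_hypermap K \<Longrightarrow> x \<in> flags K \<Longrightarrow> card (face K k x) = 2 * deg K k x"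
  using exists_other_idx[of k] deg_period card_face_period by metis

lemma deg_pos: "is_hypermap K \<Longrightarrow> x \<in> flags K \<Longrightarrow> 0 < deg K k x"
  using exists_other_idx[of k] deg_period has_period_def by metis

section \<open>Euler's inequality\<close>

lemma faces_disjoint:
  assumes K: "is_hypermap K" and "f \<in> faces K k" "g \<in> faces K k" "f \<noteq> g"
  shows "f \<inter> g = {}"
proof -
  obtain x y where xy: "x \<in> flags K" "f = face K k x" "y \<in> flags K" "g = face K k y"
    using assms by (auto simp: faces_eq)
  have False if "z \<in> f" "z \<in> g" for z
    using face_eq[OF K xy(1), of z k] face_eq[OF K xy(3), of z k] that xy assms(4) by simp
  then show ?thesis by blast
qed

lemma Union_faces: "is_hypermap K \<Longrightarrow> \<Union>(faces K k) = flags K"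
  unfolding faces_eq using face_subset[of K _ k] face_self[of _ K k] by blast

lemma finite_faces: "is_hypermap K \<Longrightarrow> finite (faces K k)"
  by (simp add: faces_eq hypermap_finite)

lemma card_faces_sum:
  assumes K: "is_hypermap K"
  shows "real (card (faces K k)) = (\<Sum>x\<in>flags K. 1 / (2 * real (deg K k x)))"
proof -
  have "(\<Sum>x\<in>flags K. 1 / (2 * real (deg K k x)))
      = (\<Sum>f\<in>faces K k. \<Sum>x\<in>f. 1 / (2 * real (deg K k x)))"
    unfolding Union_faces[OF K, of k, symmetric]
    by (rule sum.Union_disjoint[unfolded o_def])
      (use faces_disjoint[OF K] finite_subset[OF face_subset[OF K] hypermap_finite[OF K]] in
        \<open>auto simp: faces_eq[OF K]\<close>)
  also have "\<dots> = (\<Sum>f\<in>faces K k. 1)"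
  proof (rule sum.cong[OF refl])
    fix f assume "f \<in> faces K k"
    then obtain x where x: "x \<in> flags K" "f = face K k x" by (auto simp: faces_eq[OF K])
    have "deg K k y = deg K k x" if "y \<in> f" for y
      using face_eq[OF K x(1)] that x(2) by (simp add: deg_def)
    then have "(\<Sum>y\<in>f. 1 / (2 * real (deg K k y))) = card f * (1 / (2 * real (deg K k x)))"
      by simp
    also have "\<dots> = 1"
      using card_face[OF K x(1), of k] deg_pos[OF K x(1), of k] x(2) by simp
    finally show "(\<Sum>y\<in>f. 1 / (2 * real (deg K k y))) = 1" .
  qed
  finally show ?thesis by simp
qed

definition euler :: "'a hypermap \<Rightarrow> real" where
  "euler K = real (card (hypervertices K)) + real (card (hyperedges K))
     + real (card (hyperfaces K)) - real (card (flags K)) / 2"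

text \<open>Concentrated at the flags, the Euler characteristic is visibly multiplicative in coverings
  that preserve the degrees.\<close>

definition curvature :: "'a hypermap \<Rightarrow> 'a \<Rightarrow> real" where
  "curvature K x = (1 / real (deg K I0 x) + 1 / real (deg K I1 x) + 1 / real (deg K I2 x) - 1) / 2"

lemma curvature_eq:
  "curvature K x = 1 / (2 * real (deg K I0 x)) + 1 / (2 * real (deg K I1 x))
      + 1 / (2 * real (deg K I2 x)) - 1 / 2"
proof -
  have "(a + b + c - 1) / 2 = a / 2 + b / 2 + c / 2 - 1 / 2" for a b c :: real
    by (simp add: field_simps)
  then show ?thesis unfolding curvature_def by simp
qed

lemma euler_sum:
  assumes K: "is_hypermap K"
  shows "euler K = (\<Sum>x\<in>flags K. curvature K x)"
  unfolding curvature_eq sum_subtractf sum.distrib card_faces_sum[OF K, symmetric]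
  by (simp add: euler_def)

lemma spherical_iff: "spherical K \<longleftrightarrow> euler K = 2"
  by (simp add: spherical_def euler_def)

text \<open>A graph with \<open>v\<close> vertices and \<open>e\<close> edges has at least \<open>v - e\<close> components: each edge merges at
  most two values of a function that separates the components.\<close>

lemma components_ge:
  fixes a b :: "'e \<Rightarrow> 'v"
  assumes "finite E" "finite V"
  shows "\<exists>g :: 'v \<Rightarrow> 'v. (\<forall>e\<in>E. g (a e) = g (b e)) \<and> card V \<le> card (g ` V) + card E"
  using assms(1)
proof (induction E rule: finite_induct)
  case empty
  then show ?case by (auto intro!: exI[of _ id])
next
  case (insert e E)
  then obtain g :: "'v \<Rightarrow> 'v" where
    g: "\<forall>e\<in>E. g (a e) = g (b e)" "card V \<le> card (g ` V) + card E" by blast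
  \<comment> \<open>merge the values at the two ends of the new edge\<close>
  define h where "h = (\<lambda>v. if g v = g (b e) then g (a e) else g v)"
  have "g ` V \<subseteq> insert (g (b e)) (h ` V)" unfolding h_def by auto
  then have "card (g ` V) \<le> Suc (card (h ` V))"
    using card_mono[of "insert (g (b e)) (h ` V)" "g ` V"] assms(2)
    by (simp add: card_insert_if split: if_splits)
  moreover have "\<forall>e'\<in>insert e E. h (a e') = h (b e')"
    using g(1) unfolding h_def by auto
  ultimately show ?case
    using g(2) insert.hyps by (intro exI[of _ h]) auto
qed

definition side :: "'a hypermap \<Rightarrow> idx \<Rightarrow> 'a \<Rightarrow> idx \<times> 'a set" where
  "side K i x = (i, {x, hperm K i x})"

text \<open>Corners are encoded as pairs of a label \<open>k\<close> and a \<open>k\<close>-face.  The side \<open>i\<close> of \<open>x\<close> is an edge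
  between the two corners whose labels differ from \<open>i\<close>, and a function on corners is constant along
  it if it agrees at these two.\<close>

definition along :: "'a hypermap \<Rightarrow> (idx \<times> 'a set \<Rightarrow> 'v) \<Rightarrow> idx \<times> 'a \<Rightarrow> bool" where
  "along K g = (\<lambda>(i, x). \<forall>j k. j \<noteq> i \<and> k \<noteq> i \<longrightarrow> g (j, face K j x) = g (k, face K k x))"

text \<open>View each flag \<open>x\<close> as a triangle whose corners are its three faces; its side \<open>i\<close> joins the
  corners other than the \<open>i\<close>-face and is shared with the flag \<open>h\<^sub>i x\<close>.  Glue the triangles one
  at a time along a spanning tree \<open>T\<close> of sides.  The sides outside \<open>T\<close> always connect all the
  corners: when \<open>y = h\<^sub>i x\<close> is added, the lost side \<open>i\<close> of \<open>x\<close> is replaced by the path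
  through the other two sides of \<open>y\<close>.  Connectedness of that graph is expressed by
  the functions constant along its edges being constant.\<close>

lemma tree_cotree:
  assumes K: "is_hypermap K" and n: "1 \<le> n" "n \<le> card (flags K)"
  shows "\<exists>S T. S \<subseteq> flags K \<and> card S = n \<and> finite T \<and> Suc (card T) = n \<and>
    T \<subseteq> {side K i x | i x. x \<in> S \<and> hperm K i x \<in> S} \<and>
    (\<forall>g :: idx \<times> 'a set \<Rightarrow> idx \<times> 'a set.
       (\<forall>x\<in>S. \<forall>i. side K i x \<notin> T \<longrightarrow> along K g (i, x)) \<longrightarrow>
       (\<exists>c. \<forall>x\<in>S. \<forall>k. g (k, face K k x) = c))"
  using n
proof (induction n rule: nat_induct_at_least)
  case base
  obtain x where x: "x \<in> flags K" using K by (auto simp: is_hypermap_def)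
  have "\<exists>c. \<forall>k. g (k, face K k x) = c"
    if "\<forall>i. along K g (i, x)" for g :: "idx \<times> 'a set \<Rightarrow> idx \<times> 'a set"
  proof -
    have "g (j, face K j x) = g (k, face K k x)" for j k
      using that exists_other_idx[of j] unfolding along_def
      by simp (metis idx.exhaust)
    then show ?thesis by metis
  qed
  then show ?case
    by (intro exI[of _ "{x}"] exI[of _ "{}"]) (use x in simp)
next
  case (Suc n)
  then obtain S T where S: "S \<subseteq> flags K" "card S = n" and T: "finite T" "Suc (card T) = n"
      "T \<subseteq> {side K i x | i x. x \<in> S \<and> hperm K i x \<in> S}"
    and conn: "\<And>g :: idx \<times> 'a set \<Rightarrow> idx \<times> 'a set.
       (\<forall>x\<in>S. \<forall>i. side K i x \<notin> T \<longrightarrow> along K g (i, x)) \<Longrightarrow>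
       \<exists>c. \<forall>x\<in>S. \<forall>k. g (k, face K k x) = c"
    by (auto dest: Suc_leD)
  have finS: "finite S" using S(1) hypermap_finite[OF K] finite_subset by blast
  have "S \<noteq> flags K" "S \<noteq> {}" using S(2) Suc by auto
  then obtain x i where x: "x \<in> S" and y: "hperm K i x \<notin> S"
    using closed_flags_eq[OF K S(1)] by blast
  define y where "y = hperm K i x"
  have xF: "x \<in> flags K" using x S(1) by auto
  have yF: "y \<in> flags K" unfolding y_def using xF hperm_closed[OF K] by auto
  have yS: "y \<notin> S" using y y_def by simp
  have xy: "hperm K i y = x" unfolding y_def using xF hperm_hperm[OF K] by auto
  have T_in_S: "z \<in> S" if "side K j z \<in> T" for j z
  proof -
    from that T(3) obtain j' z' where "z' \<in> S" "hperm K j' z' \<in> S" "side K j z = side K j' z'"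
      by auto
    then show ?thesis by (auto simp: side_def doubleton_eq_iff)
  qed
  let ?S = "insert y S" and ?T = "insert (side K i x) T"
  have new: "side K i x \<notin> T"
  proof
    assume "side K i x \<in> T"
    then have "side K i y \<in> T" by (simp add: side_def xy y_def[symmetric] insert_commute)
    then show False using T_in_S yS by blast
  qed
  have conn': "\<exists>c. \<forall>z\<in>?S. \<forall>k. g (k, face K k z) = c"
    if g: "\<forall>z\<in>?S. \<forall>i. side K i z \<notin> ?T \<longrightarrow> along K g (i, z)"
    for g :: "idx \<times> 'a set \<Rightarrow> idx \<times> 'a set"
  proof -
    have ysides: "along K g (j, y)" if "j \<noteq> i" for j
    proof -
      have "side K j y \<notin> ?T" using T_in_S yS that by (auto simp: side_def)
      then show ?thesis using g by blast
    qed
    have yc: "g (k, face K k y) = g (i, face K i y)" for k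
    proof (cases "k = i")
      case False
      then obtain j where "j \<noteq> i" "j \<noteq> k" by (metis exists_other_idx)
      then show ?thesis using ysides[of j] unfolding along_def by (auto simp: False)
    qed simp
    have fxy: "face K k x = face K k y" if "k \<noteq> i" for k
      using face_hperm[OF K xF] that unfolding y_def by metis
    have "along K g (j, z)" if z: "z \<in> S" "side K j z \<notin> T" for j z
    proof (cases "side K j z = side K i x")
      case True
      then have "j = i" "z = x" using z(1) yS by (auto simp: side_def doubleton_eq_iff y_def)
      moreover have "g (j', face K j' x) = g (k', face K k' x)" if "j' \<noteq> i" "k' \<noteq> i" for j' k'
        using fxy that yc[of j'] yc[of k'] by simp
      ultimately show ?thesis unfolding along_def by blast
    next
      case False
      then show ?thesis using g z by blast
    qed
    then obtain c where c: "\<forall>z\<in>S. \<forall>k. g (k, face K k z) = c"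
      using conn[of g] by blast
    obtain j where "j \<noteq> i" by (metis exists_other_idx)
    then have "g (i, face K i y) = c" using c x yc[of j] fxy[of j] by metis
    then show ?thesis using c yc by auto
  qed
  have sub: "?T \<subseteq> {side K i x | i x. x \<in> ?S \<and> hperm K i x \<in> ?S}"
    using T(3) x y_def by blast
  have "card ?S = Suc n" "Suc (card ?T) = Suc n"
    using finS yS S(2) T(1,2) new by auto
  moreover have "?S \<subseteq> flags K" "finite ?T" using S(1) yF T(1) by auto
  ultimately show ?case
    by (intro exI[of _ ?S] exI[of _ ?T] conjI allI impI conn' sub)
qed

lemma card_sides:
  assumes K: "is_hypermap K"
  shows "2 * card {side K i x | i x. x \<in> flags K} = 3 * card (flags K)"
proof -
  let ?P = "\<lambda>i. (\<lambda>x. {x, hperm K i x}) ` flags K"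
  have P: "2 * card (?P i) = card (flags K)" for i
  proof -
    have "\<Union>(?P i) = flags K" using hperm_closed[OF K] by auto
    moreover have "2 * card (?P i) = card (\<Union>(?P i))"
    proof (rule card_partition)
      show "finite (?P i)" "finite (\<Union>(?P i))" using hypermap_finite[OF K] by auto
      show "card c = 2" if "c \<in> ?P i" for c
        using that hperm_neq[OF K] by (force simp: card_insert_if)
      show "c1 \<inter> c2 = {}" if c: "c1 \<in> ?P i" "c2 \<in> ?P i" "c1 \<noteq> c2" for c1 c2
      proof -
        obtain x y where "x \<in> flags K" "c1 = {x, hperm K i x}" "y \<in> flags K" "c2 = {y, hperm K i y}"
          using c by blast
        then show ?thesis using c(3) hperm_hperm[OF K, of _ i] hperm_inj[OF K, of x y i] by auto
      qed
    qed
    ultimately show ?thesis by simp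
  qed
  have "{side K i x | i x. x \<in> flags K} = Sigma UNIV ?P"
    unfolding side_def by auto
  then have "card {side K i x | i x. x \<in> flags K} = (\<Sum>i\<in>UNIV. card (?P i))"
    using hypermap_finite[OF K] by (simp add: card_SigmaI UNIV_idx)
  then show ?thesis
    using P[of I0] P[of I1] P[of I2] by (simp add: UNIV_idx)
qed

text \<open>The spanning tree uses \<open>N - 1\<close> of the \<open>3 N / 2\<close> sides.  The remaining \<open>N / 2 + 1\<close> sides
  connect all corners, so there are at most \<open>N / 2 + 2\<close> corners.\<close>

theorem euler_le_2:
  assumes K: "is_hypermap K"
  shows "euler K \<le> 2"
proof -
  let ?N = "card (flags K)" and ?E = "{side K i x | i x. x \<in> flags K}"
  let ?V = "Sigma UNIV (faces K)"
  have finV: "finite ?V" by (simp add: UNIV_idx finite_faces[OF K])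
  have finE: "finite ?E"
    by (rule finite_subset[of _ "UNIV \<times> Pow (flags K)"])
      (use hypermap_finite[OF K] hperm_closed[OF K] in \<open>auto simp: UNIV_idx side_def intro: idx.exhaust\<close>)
  have N: "1 \<le> ?N"
    using hypermap_finite[OF K] K by (simp add: Suc_leI card_gt_0_iff is_hypermap_def)
  obtain S T where S: "S \<subseteq> flags K" "card S = ?N" and T: "finite T" "Suc (card T) = ?N"
      "T \<subseteq> {side K i x | i x. x \<in> S \<and> hperm K i x \<in> S}"
    and conn: "\<And>g :: idx \<times> 'a set \<Rightarrow> idx \<times> 'a set.
       (\<forall>x\<in>S. \<forall>i. side K i x \<notin> T \<longrightarrow> along K g (i, x)) \<Longrightarrow>
       \<exists>c. \<forall>x\<in>S. \<forall>k. g (k, face K k x) = c"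
    using tree_cotree[OF K N order.refl] by blast
  have SF: "S = flags K" using S card_subset_eq[OF hypermap_finite[OF K]] by blast
  have TE: "T \<subseteq> ?E" using T(3) SF by blast
  define flag_of where "flag_of = (\<lambda>e :: idx \<times> 'a set. SOME x. x \<in> flags K \<and> side K (fst e) x = e)"
  define fst_idx where "fst_idx = (\<lambda>i. case i of I0 \<Rightarrow> I1 | I1 \<Rightarrow> I0 | I2 \<Rightarrow> I0)"
  define snd_idx where "snd_idx = (\<lambda>i. case i of I0 \<Rightarrow> I2 | I1 \<Rightarrow> I2 | I2 \<Rightarrow> I1)"
  define a where "a = (\<lambda>e. (fst_idx (fst e), face K (fst_idx (fst e)) (flag_of e)))"
  define b where "b = (\<lambda>e. (snd_idx (fst e), face K (snd_idx (fst e)) (flag_of e)))"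
  obtain g :: "idx \<times> 'a set \<Rightarrow> idx \<times> 'a set" where g: "\<forall>e\<in>?E - T. g (a e) = g (b e)"
    and le: "card ?V \<le> card (g ` ?V) + card (?E - T)"
    using components_ge[OF finite_Diff[OF finE] finV, of T a b] by blast
  have "along K g (i, x)" if x: "x \<in> flags K" "side K i x \<notin> T" for i x
  proof -
    let ?e = "side K i x"
    let ?x = "flag_of ?e"
    have "?x \<in> flags K \<and> side K (fst ?e) ?x = ?e"
      unfolding flag_of_def by (rule someI[of _ x]) (use x in \<open>auto simp: side_def\<close>)
    then have "?x = x \<or> ?x = hperm K i x"
      by (auto simp: side_def doubleton_eq_iff)
    then have f: "face K j ?x = face K j x" if "j \<noteq> i" for j
      using face_hperm[OF K x(1)] that by metis
    have "g (a ?e) = g (b ?e)" using g x by blast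
    moreover have "fst ?e = i" "fst_idx i \<noteq> i" "snd_idx i \<noteq> i"
      unfolding side_def fst_idx_def snd_idx_def by (simp_all split: idx.split)
    ultimately have eq: "g (fst_idx i, face K (fst_idx i) x) = g (snd_idx i, face K (snd_idx i) x)"
      unfolding a_def b_def using f by simp
    have two: "j = fst_idx i \<or> j = snd_idx i" if "j \<noteq> i" for j
      using that by (cases i; cases j) (simp_all add: fst_idx_def snd_idx_def)
    have "g (j, face K j x) = g (k, face K k x)" if "j \<noteq> i" "k \<noteq> i" for j k
      using two[OF that(1)] two[OF that(2)] eq by (elim disjE) simp_all
    then show ?thesis unfolding along_def by blast
  qed
  then obtain c where c: "\<forall>x\<in>flags K. \<forall>k. g (k, face K k x) = c"
    using conn[of g] SF by blast
  have "g ` ?V \<subseteq> {c}" using c by (auto simp: faces_eq[OF K])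
  then have one: "card (g ` ?V) \<le> 1" using card_mono[of "{c}" "g ` ?V"] by simp
  have cot: "card (?E - T) + card T = card ?E"
    using TE finE T(1) by (simp add: card_Diff_subset card_mono)
  have V: "card ?V = card (hypervertices K) + card (hyperedges K) + card (hyperfaces K)"
    using finite_faces[OF K] by (simp add: card_SigmaI UNIV_idx)
  have "2 * v \<le> 4 + m" if "r \<le> 1" "d + t = e" "v \<le> r + d" "Suc t = m" "2 * e = 3 * m"
    for v m r d t e :: nat
    using that by linarith
  from this[OF one cot le T(2) card_sides[OF K]]
  have "2 * (card (hypervertices K) + card (hyperedges K) + card (hyperfaces K)) \<le> 4 + ?N"
    unfolding V .
  then have "real (2 * (card (hypervertices K) + card (hyperedges K) + card (hyperfaces K)))
      \<le> real (4 + ?N)"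
    by (rule of_nat_mono)
  then show ?thesis unfolding euler_def by simp
qed

section \<open>Rigidity of spherical hypermaps\<close>

definition fibre_product :: "'a hypermap \<Rightarrow> 'b hypermap \<Rightarrow> 'a \<Rightarrow> 'b \<Rightarrow> ('a \<times> 'b) hypermap" where
  "fibre_product K L x y =
     \<lparr>flags = range (\<lambda>w. (walk K w x, walk L w y)),
      hperm = (\<lambda>i. map_prod (hperm K i) (hperm L i))\<rparr>"

lemma walk_fibre_product:
  "walk (fibre_product K L x0 y0) w (x, y) = (walk K w x, walk L w y)"
  by (induction w arbitrary: x y) (auto simp: fibre_product_def)

lemma is_hypermap_fibre_product:
  assumes K: "is_hypermap K" and L: "is_hypermap L" and x: "x \<in> flags K" and y: "y \<in> flags L"
  shows "is_hypermap (fibre_product K L x y)"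
proof (rule is_hypermapI)
  let ?M = "fibre_product K L x y"
  have sub: "flags ?M \<subseteq> flags K \<times> flags L"
    using fold_hperm_in_flags[OF K x] fold_hperm_in_flags[OF L y] by (auto simp: fibre_product_def)
  show "finite (flags ?M)"
    using sub hypermap_finite[OF K] hypermap_finite[OF L] finite_subset by blast
  show "flags ?M \<noteq> {}" by (simp add: fibre_product_def)
  fix i z assume z: "z \<in> flags ?M"
  then obtain w where w: "z = (walk K w x, walk L w y)" by (auto simp: fibre_product_def)
  have "hperm ?M i z = (walk K (w @ [i]) x, walk L (w @ [i]) y)"
    using w by (simp add: fibre_product_def)
  then show "hperm ?M i z \<in> flags ?M" unfolding fibre_product_def by (simp del: fold_append)
  have f: "fst z \<in> flags K" "snd z \<in> flags L" using sub z by auto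
  show "hperm ?M i z \<noteq> z"
    using hperm_neq[OF K f(1)] by (cases z) (simp add: fibre_product_def)
  show "hperm ?M i (hperm ?M i z) = z"
    using hperm_hperm[OF K f(1)] hperm_hperm[OF L f(2)] by (cases z) (simp add: fibre_product_def)
  fix z' assume "z' \<in> flags ?M"
  then obtain w' where w': "z' = (walk K w' x, walk L w' y)" by (auto simp: fibre_product_def)
  have "walk ?M (rev w @ w') z = z'"
    unfolding w w' walk_fibre_product
    by (simp add: walk_rev_walk[OF K x] walk_rev_walk[OF L y])
  then show "\<exists>w. walk ?M w z = z'" by blast
qed

text \<open>In general the degree in the product is the least common multiple of the two degrees.\<close>

lemma deg_fibre_product:
  assumes K: "is_hypermap K" and L: "is_hypermap L" and x0: "x0 \<in> flags K" and y0: "y0 \<in> flags L"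
    and z: "(x, y) \<in> flags (fibre_product K L x0 y0)" and d: "deg K k x = deg L k y"
  shows "deg (fibre_product K L x0 y0) k (x, y) = deg K k x"
proof -
  obtain i j where ij: "i \<noteq> j" "k \<noteq> i" "k \<noteq> j" using exists_other_idx by blast
  have xy: "x \<in> flags K" "y \<in> flags L"
    using z x0 y0 K L fold_hperm_in_flags by (auto simp: fibre_product_def)
  have p: "has_period (rot K i j) x (deg K k x)" "has_period (rot L i j) y (deg K k x)"
    using deg_period[OF K xy(1) ij] deg_period[OF L xy(2) ij] d by auto
  have "has_period (rot (fibre_product K L x0 y0) i j) (x, y) (deg K k x)"
    using p unfolding has_period_def rot_words walk_fibre_product by auto
  then show ?thesis
    by (rule deg_eqI[OF is_hypermap_fibre_product[OF K L x0 y0] z ij])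
qed

text \<open>The orbit of \<open>(x\<^sub>0, y\<^sub>0)\<close> in \<open>K \<times> L\<close> is a hypermap covering \<open>K\<close>, with \<open>d\<close>
  sheets say.  As the degrees agree, its Euler characteristic is \<open>d\<close> times that of \<open>K\<close>, which is
  \<open>2 d\<close>; Euler's inequality forces \<open>d = 1\<close>.\<close>

theorem spherical_rigid:
  assumes K: "is_hypermap K" and L: "is_hypermap L" and sph: "spherical K"
    and x: "x \<in> flags K" and y: "y \<in> flags L"
    and d: "\<And>w k. deg K k (walk K w x) = deg L k (walk L w y)"
    and w: "walk K w x = x"
  shows "walk L w y = y"
proof -
  let ?M = "fibre_product K L x y"
  note M = is_hypermap_fibre_product[OF K L x y]
  define fibre where "fibre = (\<lambda>u. {z \<in> flags ?M. fst z = u})"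
  have fin: "finite (fibre u)" for u using hypermap_finite[OF M] by (simp add: fibre_def)
  have step: "card (fibre u) \<le> card (fibre (hperm K i u))" for u i
  proof (rule card_inj_on_le[OF _ _ fin])
    show "inj_on (hperm ?M i) (fibre u)"
      using hperm_inj[OF M] by (auto simp: inj_on_def fibre_def)
    show "hperm ?M i ` fibre u \<subseteq> fibre (hperm K i u)"
      using hperm_closed[OF M] by (auto simp: fibre_def) (simp add: fibre_product_def)
  qed
  have le: "card (fibre u) \<le> card (fibre (walk K v u))" for u v
  proof (induction v arbitrary: u)
    case (Cons i v)
    show ?case using step[of u i] Cons[of "hperm K i u"] by simp
  qed simp
  have const: "card (fibre u) = card (fibre x)" if u: "u \<in> flags K" for u
    using le[of u] le[of x] hypermap_connected[OF K x u] hypermap_connected[OF K u x] by (metis le_antisym)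
  have curv: "curvature ?M z = curvature K (fst z)" if z: "z \<in> flags ?M" for z
  proof -
    obtain v where v: "z = (walk K v x, walk L v y)" using z by (auto simp: fibre_product_def)
    have "deg ?M k z = deg K k (fst z)" for k
      using deg_fibre_product[OF K L x y, of "fst z" "snd z" k] z d v by simp
    then show ?thesis by (simp add: curvature_def)
  qed
  have img: "fst ` flags ?M \<subseteq> flags K"
    using fold_hperm_in_flags[OF K x] by (auto simp: fibre_product_def)
  have "euler ?M = (\<Sum>z\<in>flags ?M. curvature K (fst z))"
    using curv by (simp add: euler_sum[OF M])
  also have "\<dots> = (\<Sum>u\<in>flags K. \<Sum>z\<in>fibre u. curvature K (fst z))"
    unfolding fibre_def by (rule sum.group[symmetric, OF hypermap_finite[OF M] hypermap_finite[OF K] img])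
  also have "\<dots> = (\<Sum>u\<in>flags K. card (fibre x) * curvature K u)"
    by (rule sum.cong[OF refl]) (simp add: const[symmetric], simp add: fibre_def)
  also have "\<dots> = card (fibre x) * euler K"
    by (simp add: sum_distrib_left euler_sum[OF K])
  finally have "card (fibre x) * 2 \<le> (2 :: real)"
    using sph euler_le_2[OF M] by (simp add: spherical_iff)
  then have one: "card (fibre x) \<le> 1" by linarith
  have "(walk K [] x, walk L [] y) \<in> flags ?M" "(walk K w x, walk L w y) \<in> flags ?M"
    unfolding fibre_product_def hypermap.simps by (rule rangeI)+
  then have "(x, y) \<in> fibre x" "(x, walk L w y) \<in> fibre x"
    by (auto simp: fibre_def w)
  then show ?thesis
    using one fin[of x] by (metis card_le_Suc0_iff_eq One_nat_def prod.inject)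
qed

section \<open>Isomorphisms\<close>

lemma iso_of_stabilisers:
  assumes K: "is_hypermap K" and L: "is_hypermap L" and x: "x \<in> flags K" and y: "y \<in> flags L"
    and st: "\<And>w. walk K w x = x \<longleftrightarrow> walk L w y = y"
  shows "K \<cong>\<^sub>h L"
proof -
  have eq: "walk K u x = walk K v x \<longleftrightarrow> walk L u y = walk L v y" for u v
  proof -
    have "walk K u x = walk K v x \<longleftrightarrow> walk K (u @ rev v) x = x"
      using walk_rev_walk[OF K x, of v] walk_walk_rev[OF K, of "walk K u x" v]
        fold_hperm_in_flags[OF K x, of u] by (simp add: o_def) metis
    moreover have "walk L u y = walk L v y \<longleftrightarrow> walk L (u @ rev v) y = y"
      using walk_rev_walk[OF L y, of v] walk_walk_rev[OF L, of "walk L u y" v]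
        fold_hperm_in_flags[OF L y, of u] by (simp add: o_def) metis
    ultimately show ?thesis using st by blast
  qed
  define f where "f = (\<lambda>z. walk L (SOME w. walk K w x = z) y)"
  have f: "f (walk K w x) = walk L w y" for w
  proof -
    have "walk K (SOME u. walk K u x = walk K w x) x = walk K w x"
      by (rule someI) (rule refl)
    then show ?thesis unfolding f_def by (simp add: eq)
  qed
  have K': "\<exists>w. z = walk K w x" if "z \<in> flags K" for z
    using hypermap_connected[OF K x that] by metis
  have L': "\<exists>w. z = walk L w y" if "z \<in> flags L" for z
    using hypermap_connected[OF L y that] by metis
  have "bij_betw f (flags K) (flags L)"
  proof (rule bij_betw_imageI)
    show "inj_on f (flags K)"
    proof (rule inj_onI)
      fix a b assume "a \<in> flags K" "b \<in> flags K" "f a = f b"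
      then show "a = b" using K'[of a] K'[of b] f eq by metis
    qed
    show "f ` flags K = flags L"
    proof (intro equalityI subsetI)
      fix z assume "z \<in> f ` flags K"
      then show "z \<in> flags L" using K' f fold_hperm_in_flags[OF L y] by fastforce
    next
      fix z assume "z \<in> flags L"
      then obtain w where "z = f (walk K w x)" using L' f by metis
      then show "z \<in> f ` flags K" using fold_hperm_in_flags[OF K x] by blast
    qed
  qed
  moreover have "f (hperm K i z) = hperm L i (f z)" if z: "z \<in> flags K" for i z
  proof -
    obtain w where w: "z = walk K w x" using K'[OF z] by blast
    have "f (hperm K i z) = f (walk K (w @ [i]) x)" by (simp add: w)
    also have "\<dots> = hperm L i (walk L w y)" unfolding f by simp
    finally show ?thesis by (simp add: w f)
  qed
  ultimately show ?thesis unfolding hypermap_iso_def by blast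
qed

theorem spherical_iso:
  assumes K: "is_hypermap K" and L: "is_hypermap L" and sph: "spherical K" "spherical L"
    and x: "x \<in> flags K" and y: "y \<in> flags L"
    and d: "\<And>w k. deg K k (walk K w x) = deg L k (walk L w y)"
  shows "K \<cong>\<^sub>h L"
proof (rule iso_of_stabilisers[OF K L x y])
  show "walk K w x = x \<longleftrightarrow> walk L w y = y" for w
    using spherical_rigid[OF K L sph(1) x y d] spherical_rigid[OF L K sph(2) y x d[symmetric]] by blast
qed

lemma iso_walk:
  assumes K: "is_hypermap K" and f: "\<forall>i. \<forall>x\<in>flags K. f (hperm K i x) = hperm L i (f x)"
  shows "x \<in> flags K \<Longrightarrow> walk L w (f x) = f (walk K w x)"
proof (induction w arbitrary: x)
  case (Cons i w)
  then show ?case using f hperm_closed[OF K] by (metis fold_simps(2))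
qed simp

lemma is_hypermap_iso:
  assumes K: "is_hypermap K" and iso: "K \<cong>\<^sub>h L"
  shows "is_hypermap L"
proof -
  obtain f where b: "bij_betw f (flags K) (flags L)"
    and f: "\<forall>i. \<forall>x\<in>flags K. f (hperm K i x) = hperm L i (f x)"
    using iso unfolding hypermap_iso_def by blast
  have FL: "flags L = f ` flags K" using b by (simp add: bij_betw_def)
  have inj: "f x = f y \<longleftrightarrow> x = y" if "x \<in> flags K" "y \<in> flags K" for x y
    using b that by (auto simp: bij_betw_def inj_on_def)
  have h: "hperm L i (f x) = f (hperm K i x)" if "x \<in> flags K" for i x
    using f that by simp
  show ?thesis
  proof (rule is_hypermapI)
    show "finite (flags L)" "flags L \<noteq> {}" using K by (auto simp: FL is_hypermap_def)
    fix i z assume "z \<in> flags L"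
    then obtain x where x: "x \<in> flags K" "z = f x" using FL by auto
    show "hperm L i z \<in> flags L" using x FL h hperm_closed[OF K] by simp
    show "hperm L i z \<noteq> z" using x h hperm_closed[OF K] hperm_neq[OF K] inj by simp
    show "hperm L i (hperm L i z) = z" using x h hperm_closed[OF K] hperm_hperm[OF K] by simp
    fix z' assume "z' \<in> flags L"
    then obtain x' where x': "x' \<in> flags K" "z' = f x'" using FL by auto
    obtain w where "walk K w x = x'" using hypermap_connected[OF K x(1) x'(1)] by blast
    then show "\<exists>w. walk L w z = z'"
      using iso_walk[OF K f x(1), of w] x x' by auto
  qed
qed

lemma deg_iso:
  assumes K: "is_hypermap K" and b: "bij_betw f (flags K) (flags L)"
    and f: "\<forall>i. \<forall>x\<in>flags K. f (hperm K i x) = hperm L i (f x)" and x: "x \<in> flags K"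
  shows "deg L k (f x) = deg K k x"
proof -
  have "face L k (f x) = f ` face K k x"
    unfolding face_def using iso_walk[OF K f x] by auto
  moreover have "inj_on f (face K k x)"
    using inj_on_subset[OF _ face_subset[OF K x]] b unfolding bij_betw_def by blast
  ultimately show ?thesis by (simp add: deg_def valency_def card_image)
qed

subsection \<open>Hypermaps of cosets\<close>

lemma act_inv:
  assumes K: "is_hypermap K" and x: "x \<in> flags K"
  shows "act K (inv\<^bsub>Delta\<^esub> g) (act K g x) = x"
proof -
  have "act K (g \<otimes>\<^bsub>Delta\<^esub> inv\<^bsub>Delta\<^esub> g) x = act K delta_one x"
    using group.r_inv[OF group_Delta, of g] by simp
  also have "\<dots> = x" using act_abs[OF K x, of "[]"] by (simp add: delta_one.abs_eq)
  finally show ?thesis by (simp only: act_mult[OF K x])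
qed

lemma act_in_flags: "is_hypermap K \<Longrightarrow> x \<in> flags K \<Longrightarrow> act K g x \<in> flags K"
  unfolding act_def by (rule fold_hperm_in_flags)

lemma stab_coset:
  assumes K: "is_hypermap K" and x: "x \<in> flags K"
  shows "stab K x #>\<^bsub>Delta\<^esub> a = {g. act K g x = act K a x}"
proof (intro equalityI subsetI)
  fix g assume "g \<in> stab K x #>\<^bsub>Delta\<^esub> a"
  then obtain h where "act K h x = x" "g = h \<otimes>\<^bsub>Delta\<^esub> a"
    by (auto simp: r_coset_def stab_def)
  then show "g \<in> {g. act K g x = act K a x}" using act_mult[OF K x, of h a] by simp
next
  fix g assume "g \<in> {g. act K g x = act K a x}"
  then have "act K (g \<otimes>\<^bsub>Delta\<^esub> inv\<^bsub>Delta\<^esub> a) x = x"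
    by (simp only: act_mult[OF K x] mem_Collect_eq act_inv[OF K x])
  moreover have "g = (g \<otimes>\<^bsub>Delta\<^esub> inv\<^bsub>Delta\<^esub> a) \<otimes>\<^bsub>Delta\<^esub> a"
  proof -
    interpret D: group Delta by (rule group_Delta)
    show ?thesis using D.m_assoc[of g "inv\<^bsub>Delta\<^esub> a" a] D.l_inv[of a] D.r_one[of g] by simp
  qed
  ultimately show "g \<in> stab K x #>\<^bsub>Delta\<^esub> a"
    by (auto simp: r_coset_def stab_def)
qed

text \<open>The flag \<open>y\<close> corresponds to the coset of all \<open>g\<close> that carry \<open>x\<close> to \<open>y\<close>.\<close>

lemma coset_hypermap_iso:
  assumes K: "is_hypermap K" and x: "x \<in> flags K"
  shows "K \<cong>\<^sub>h coset_hypermap (stab K x)"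
proof -
  let ?f = "\<lambda>y. {g. act K g x = y}"
  have ex: "\<exists>a. y = act K a x" if "y \<in> flags K" for y
    using hypermap_connected[OF K x that] act_abs[OF K x] by metis
  have fl: "?f ` flags K = rcosets\<^bsub>Delta\<^esub> (stab K x)"
    unfolding RCOSETS_def using ex act_in_flags[OF K x] stab_coset[OF K x] by fastforce
  have inj: "inj_on ?f (flags K)"
    using ex by (auto simp: inj_on_def)
  have "?f (hperm K i y) = ?f y #>\<^bsub>Delta\<^esub> gen i" if y: "y \<in> flags K" for i y
  proof -
    obtain a where a: "y = act K a x" using ex[OF y] by blast
    have "hperm K i y = act K (a \<otimes>\<^bsub>Delta\<^esub> gen i) x"
      using a y by (simp only: act_mult[OF K x] act_gen[OF K])
    then have "?f (hperm K i y) = stab K x #>\<^bsub>Delta\<^esub> (a \<otimes>\<^bsub>Delta\<^esub> gen i)"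
      using stab_coset[OF K x] by simp
    also have "\<dots> = stab K x #>\<^bsub>Delta\<^esub> a #>\<^bsub>Delta\<^esub> gen i"
      using group.coset_mult_assoc[OF group_Delta, of "stab K x" a "gen i"] by simp
    also have "\<dots> = ?f y #>\<^bsub>Delta\<^esub> gen i"
      using stab_coset[OF K x] a by simp
    finally show ?thesis .
  qed
  then show ?thesis
    unfolding hypermap_iso_def coset_hypermap_def using fl inj
    by (intro exI[of _ ?f]) (simp add: bij_betw_def)
qed

section \<open>Bipartite hypermaps as two-coloured hypermaps\<close>

lemma abs_delta_append: "abs_delta (u @ v) = delta_mult (abs_delta u) (abs_delta v)"
  by (simp add: delta_mult.abs_eq)

lemma abs_delta_cancel: "abs_delta (u @ [i, i] @ v) = abs_delta (u @ v)"
  by (metis Quotient3_delta Quotient3_rel_abs cancel.intros r_into_equivclp)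

lemma abs_delta_rev: "abs_delta (rev w) = inv\<^bsub>Delta\<^esub> (abs_delta w)"
proof -
  have "delta_mult (abs_delta (rev w)) (abs_delta w) = delta_one"
    using cancel_rev[of w]
    by (metis abs_delta_append delta_one.abs_eq Quotient3_delta Quotient3_rel_abs)
  then show ?thesis
    using group.inv_equality[OF group_Delta, of "abs_delta (rev w)" "abs_delta w"] by simp
qed

lemma stab_words:
  "is_hypermap K \<Longrightarrow> x \<in> flags K \<Longrightarrow> abs_delta w \<in> stab K x \<longleftrightarrow> walk K w x = x"
  by (simp add: stab_def act_abs)

text \<open>The transversal \<open>{1, R\<^sub>0}\<close> of \<open>Delta0\<close>: a word of odd parity is corrected by one more
  letter \<open>R\<^sub>0\<close>.\<close>

definition even_part :: "idx list \<Rightarrow> idx list" where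
  "even_part w = (if parity_from False w then w @ [I0] else w)"

text \<open>The images of \<open>R\<^sub>1\<close>, \<open>R\<^sub>2\<close> (first argument \<open>False\<close>) and of their conjugates by \<open>R\<^sub>0\<close>
  (\<open>True\<close>), in the form that \<open>rewr\<close> expects.\<close>

abbreviation phi_table :: "idx \<Rightarrow> idx \<Rightarrow> idx \<Rightarrow> idx \<Rightarrow> bool \<Rightarrow> idx \<Rightarrow> idx" where
  "phi_table a b c d \<equiv> \<lambda>p i. if p then (if i = I1 then c else d) else (if i = I1 then a else b)"

text \<open>Reidemeister--Schreier rewriting by induction on the word.  It shows at the same time that
  \<open>Delta0\<close> contains every even word and that \<open>is_phi\<close> determines \<open>f\<close> on \<open>Delta0\<close>.\<close>

lemma phi_even_part:
  assumes phi: "is_phi a b c d f"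
  shows "abs_delta (even_part w) \<in> Delta0 \<and>
    f (abs_delta (even_part w)) = abs_delta (rewr (phi_table a b c d) False w)"
proof (induction w rule: rev_induct)
  case Nil
  interpret D: group Delta by (rule group_Delta)
  have sub: "subgroup Delta0 Delta" using Delta0_normal by (rule normal_imp_subgroup)
  interpret D0: group Delta0_group by (rule D.subgroup_imp_group[OF sub])
  have "f \<in> hom Delta0_group Delta" using phi by (simp add: is_phi_def epi_def)
  then interpret f: group_hom Delta0_group Delta f by unfold_locales
  have "f delta_one = delta_one" using f.hom_one by simp
  moreover have "delta_one \<in> Delta0" using subgroup.one_closed[OF sub] by simp
  ultimately show ?case by (simp add: even_part_def delta_one.abs_eq)
next
  case (snoc i w)
  let ?t = "phi_table a b c d" and ?p = "parity_from False w"
  have hom: "f (delta_mult g h) = delta_mult (f g) (f h)" if "g \<in> Delta0" "h \<in> Delta0" for g h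
    using phi that by (auto simp: is_phi_def epi_def hom_def)
  have closed: "delta_mult g h \<in> Delta0" if "g \<in> Delta0" "h \<in> Delta0" for g h
    using subgroup.m_closed[OF normal_imp_subgroup[OF Delta0_normal] that] by simp
  show ?case
  proof (cases "i = I0")
    case True
    then have "abs_delta (even_part (w @ [i])) = abs_delta (even_part w)"
      using abs_delta_cancel[of w I0 "[]"] by (simp add: even_part_def parity_from_append)
    then show ?thesis using snoc True by (simp add: rewr_append)
  next
    case False
    define g where "g = abs_delta (if ?p then [I0, i, I0] else [i])"
    have conj: "abs_delta [I0, i, I0] = conj_by (gen i) (gen I0)"
      unfolding conj_by_def inv_gen by (simp add: gen.abs_eq delta_mult.abs_eq)
    have g: "g \<in> Delta0 \<and> f g = abs_delta [?t ?p i]"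
    proof (cases i)
      case I0
      then show ?thesis using False by simp
    next
      case I1
      then show ?thesis
        using phi gen_in_Delta0 conj_in_Delta0 conj unfolding g_def is_phi_def
        by (auto simp flip: gen.abs_eq)
    next
      case I2
      then show ?thesis
        using phi gen_in_Delta0 conj_in_Delta0 conj unfolding g_def is_phi_def
        by (auto simp flip: gen.abs_eq)
    qed
    have "abs_delta (even_part (w @ [i])) = delta_mult (abs_delta (even_part w)) g"
      using False abs_delta_cancel[of w I0 "[i, I0]"]
      by (simp add: even_part_def parity_from_append g_def flip: abs_delta_append)
    then show ?thesis
      using snoc g hom closed by (simp add: rewr_append False abs_delta_append)
  qed
qed

lemma Delta0_words: "abs_delta w \<in> Delta0 \<longleftrightarrow> \<not> parity_from False w"
proof
  show "abs_delta w \<in> Delta0 \<Longrightarrow> \<not> parity_from False w"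
    using Delta0_even[of "abs_delta w"] by (simp add: delta_parity.abs_eq)
  show "\<not> parity_from False w \<Longrightarrow> abs_delta w \<in> Delta0"
    using phi_even_part[OF phi_W, of w] by (simp add: even_part_def)
qed

lemma Delta0_eq: "Delta0 = abs_delta ` {w. \<not> parity_from False w}"
proof (intro equalityI subsetI)
  fix g assume g: "g \<in> Delta0"
  obtain w where "g = abs_delta w" using abs_delta_surj by blast
  then show "g \<in> abs_delta ` {w. \<not> parity_from False w}" using g Delta0_words[of w] by simp
qed (auto simp: Delta0_words)

lemma phi_words:
  assumes "is_phi a b c d f" "\<not> parity_from False w"
  shows "f (abs_delta w) = abs_delta (rewr (phi_table a b c d) False w)"
  using phi_even_part[OF assms(1), of w] assms(2) by (simp add: even_part_def)

definition colouring :: "'a hypermap \<Rightarrow> ('a \<Rightarrow> bool) \<Rightarrow> bool" where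
  "colouring K c \<longleftrightarrow> (\<forall>x\<in>flags K. \<forall>i. c (hperm K i x) = (if i = I0 then \<not> c x else c x))"

lemma colouring_walk:
  assumes "is_hypermap K" "colouring K c"
  shows "x \<in> flags K \<Longrightarrow> c (walk K w x) = parity_from (c x) w"
proof (induction w arbitrary: x)
  case (Cons i w)
  then show ?case
    using assms hperm_closed[OF assms(1)] by (simp add: colouring_def)
qed simp

definition base_flag :: "'a hypermap \<Rightarrow> 'a" where
  "base_flag K = (SOME x. x \<in> flags K)"

lemma base_flag: "is_hypermap K \<Longrightarrow> base_flag K \<in> flags K"
  unfolding base_flag_def is_hypermap_def by (meson all_not_in_conv someI)

lemma hsub_eq: "hsub K = stab K (base_flag K)"
  by (simp add: hsub_def base_flag_def)

text \<open>The colour of a flag is the parity of the words that lead to it from the base flag; it is well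
  defined exactly if every word fixing the base flag is even.\<close>

lemma bipartite_iff:
  assumes K: "is_hypermap K"
  shows "bipartite K \<longleftrightarrow> (\<exists>c. colouring K c)"
proof
  let ?b = "base_flag K"
  note b = base_flag[OF K]
  assume "bipartite K"
  then have even: "\<not> parity_from False w" if "walk K w ?b = ?b" for w
    using that stab_words[OF K b, of w] by (auto simp: bipartite_def hsub_eq Delta0_words subset_iff)
  have same: "parity_from False u = parity_from False v" if "walk K u ?b = walk K v ?b" for u v
  proof -
    have "walk K (u @ rev v) ?b = ?b" using that walk_rev_walk[OF K b, of v] by simp
    moreover have "walk K (v @ rev v) ?b = ?b" using walk_rev_walk[OF K b, of v] by simp
    ultimately have "\<not> parity_from False (u @ rev v)" "\<not> parity_from False (v @ rev v)"
      using even by blast+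
    then show ?thesis
      using parity_from_xor[of "parity_from False u"] parity_from_xor[of "parity_from False v"]
      by (simp add: parity_from_append)
  qed
  define c where "c = (\<lambda>x. \<exists>w. walk K w ?b = x \<and> parity_from False w)"
  have c: "c (walk K w ?b) = parity_from False w" for w
    unfolding c_def using same by blast
  have "colouring K c"
    unfolding colouring_def
  proof (intro ballI allI)
    fix x i assume "x \<in> flags K"
    then obtain w where w: "x = walk K w ?b" using hypermap_connected[OF K b] by metis
    have "hperm K i x = walk K (w @ [i]) ?b" by (simp add: w)
    then have "c (hperm K i x) = parity_from False (w @ [i])" by (simp only: c)
    then show "c (hperm K i x) = (if i = I0 then \<not> c x else c x)"
      by (simp add: parity_from_append w c)
  qed
  then show "\<exists>c. colouring K c" by blast
next
  let ?b = "base_flag K"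
  note b = base_flag[OF K]
  assume "\<exists>c. colouring K c"
  then obtain c where c: "colouring K c" by blast
  have "g \<in> Delta0" if g: "g \<in> hsub K" for g
  proof -
    obtain w where w: "g = abs_delta w" using abs_delta_surj by blast
    then have "walk K w ?b = ?b" using g stab_words[OF K b] by (simp add: hsub_eq)
    then have "c ?b = parity_from (c ?b) w" using colouring_walk[OF K c b, of w] by simp
    then show ?thesis using parity_from_xor[of "c ?b" w] by (auto simp: w Delta0_words)
  qed
  then show "bipartite K" unfolding bipartite_def by blast
qed

lemma inv_Delta0:
  assumes "g \<in> Delta0" shows "inv\<^bsub>Delta0_group\<^esub> g = inv\<^bsub>Delta\<^esub> g"
  using group.m_inv_consistent[OF group_Delta normal_imp_subgroup[OF Delta0_normal] assms] .

lemma group_Delta0: "group Delta0_group"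
  using group.subgroup_imp_group[OF group_Delta normal_imp_subgroup[OF Delta0_normal]] .

lemma subgroup_stab:
  assumes K: "is_hypermap K" and x: "x \<in> flags K"
  shows "subgroup (stab K x) Delta"
proof (rule group.subgroupI[OF group_Delta])
  have "abs_delta [] \<in> stab K x" by (simp add: stab_words[OF K x])
  then show "stab K x \<noteq> {}" by blast
  fix g assume g: "g \<in> stab K x"
  then show "inv\<^bsub>Delta\<^esub> g \<in> stab K x"
    using act_inv[OF K x, of g] by (simp add: stab_def)
  fix h assume "h \<in> stab K x"
  then show "g \<otimes>\<^bsub>Delta\<^esub> h \<in> stab K x"
    using g act_mult[OF K x, of g h] by (simp add: stab_def)
qed (simp add: stab_def)

lemma walk_conj:
  assumes K: "is_hypermap K" and x: "x \<in> flags K"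
  shows "walk K v (walk K w x) = walk K w x \<longleftrightarrow> walk K (w @ v @ rev w) x = x"
proof
  assume "walk K v (walk K w x) = walk K w x"
  then show "walk K (w @ v @ rev w) x = x" by (simp add: walk_rev_walk[OF K x])
next
  assume "walk K (w @ v @ rev w) x = x"
  then have "walk K w (walk K (rev w) (walk K v (walk K w x))) = walk K w x" by simp
  then show "walk K v (walk K w x) = walk K w x"
    using walk_walk_rev[OF K, of "walk K v (walk K w x)" w]
      fold_hperm_in_flags[OF K] x by metis
qed

definition colour_regular :: "'a hypermap \<Rightarrow> ('a \<Rightarrow> bool) \<Rightarrow> bool" where
  "colour_regular K c \<longleftrightarrow> colouring K c \<and>
     (\<forall>x\<in>flags K. \<forall>y\<in>flags K. c x = c y \<longrightarrow> (\<forall>w. walk K w x = x \<longleftrightarrow> walk K w y = y))"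

text \<open>Normality of the stabiliser \<open>H\<close> of \<open>b\<close> in \<open>Delta0\<close> says that the flags \<open>b g\<close> with
  \<open>g \<in> Delta0\<close>, which are those of the colour of \<open>b\<close>, all have stabiliser \<open>H\<close>.
  The flags of the other colour then have stabiliser \<open>R\<^sub>0 H R\<^sub>0\<close>.\<close>

lemma bipartite_regular_iff:
  assumes K: "is_hypermap K"
  shows "bipartite_regular K \<longleftrightarrow> (\<exists>c. colour_regular K c)"
proof
  let ?b = "base_flag K"
  note b = base_flag[OF K]
  assume reg: "bipartite_regular K"
  then obtain c where c: "colouring K c"
    using bipartite_iff[OF K] by (auto simp: bipartite_regular_def)
  have n: "stab K ?b \<lhd> Delta0_group"
    using reg by (simp add: bipartite_regular_def hsub_eq)
  have conj: "walk K (w @ v @ rev w) ?b = ?b"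
    if "\<not> parity_from False w" "walk K v ?b = ?b" for v w
  proof -
    have g: "abs_delta w \<in> Delta0" using that(1) by (simp add: Delta0_words)
    have "abs_delta v \<in> stab K ?b" using that(2) by (simp add: stab_words[OF K b])
    then have "delta_mult (delta_mult (abs_delta w) (abs_delta v)) (abs_delta (rev w)) \<in> stab K ?b"
      using normal.inv_op_closed2[OF n, of "abs_delta w" "abs_delta v"] g
      by (simp add: inv_Delta0 abs_delta_rev)
    then have "abs_delta (w @ v @ rev w) \<in> stab K ?b"
      by (simp flip: abs_delta_append)
    then show ?thesis by (simp only: stab_words[OF K b])
  qed
  have same: "walk K v x = x \<longleftrightarrow> walk K v ?b = ?b" if x: "x \<in> flags K" "c x = c ?b" for v x
  proof -
    obtain w where w: "x = walk K w ?b" using hypermap_connected[OF K b x(1)] by metis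
    have "c x = parity_from (c ?b) w" using colouring_walk[OF K c b, of w] w by simp
    then have even: "\<not> parity_from False w" using x(2) parity_from_xor[of "c ?b" w] by auto
    show ?thesis
    proof
      assume v: "walk K v ?b = ?b"
      show "walk K v x = x" unfolding w walk_conj[OF K b] by (rule conj[OF even v])
    next
      assume "walk K v x = x"
      then have fix_b: "walk K (w @ v @ rev w) ?b = ?b" unfolding w walk_conj[OF K b] .
      have "\<not> parity_from False (w @ rev w)"
      proof -
        have "walk K (w @ rev w) ?b = ?b" using walk_rev_walk[OF K b] by simp
        then have "c ?b = parity_from (c ?b) (w @ rev w)" using colouring_walk[OF K c b] by metis
        then show ?thesis using parity_from_xor[of "c ?b"] by auto
      qed
      then have even': "\<not> parity_from False (rev w)"
        using even by (simp add: parity_from_append)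
      have "walk K (rev w @ (w @ v @ rev w) @ rev (rev w)) ?b = ?b"
        by (rule conj[OF even' fix_b])
      then show "walk K v ?b = ?b"
        by (simp add: walk_walk_rev[OF K b] walk_walk_rev[OF K fold_hperm_in_flags[OF K b]])
    qed
  qed
  have "walk K v x = x \<longleftrightarrow> walk K v y = y"
    if xy: "x \<in> flags K" "y \<in> flags K" "c x = c y" for v x y
  proof (cases "c x = c ?b")
    case True
    then show ?thesis using same xy by metis
  next
    case False
    have h: "walk K v z = z \<longleftrightarrow> walk K ([I0] @ v @ [I0]) ?b = ?b"
      if z: "z \<in> flags K" "c z \<noteq> c ?b" for z
    proof -
      let ?z = "hperm K I0 z"
      have z': "?z \<in> flags K" "c ?z = c ?b" "z = walk K [I0] ?z"
        using z c hperm_closed[OF K] hperm_hperm[OF K] by (auto simp: colouring_def)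
      have "walk K v z = z \<longleftrightarrow> walk K ([I0] @ v @ rev [I0]) ?z = ?z"
        using walk_conj[OF K z'(1), of v "[I0]"] z'(3) by metis
      then show ?thesis using same[OF z'(1,2), of "[I0] @ v @ [I0]"] by simp
    qed
    show ?thesis using h[of x] h[of y] xy False by simp
  qed
  then show "\<exists>c. colour_regular K c" using c unfolding colour_regular_def by blast
next
  let ?b = "base_flag K"
  note b = base_flag[OF K]
  assume "\<exists>c. colour_regular K c"
  then obtain c where c: "colouring K c"
    and eq: "\<And>x y w. x \<in> flags K \<Longrightarrow> y \<in> flags K \<Longrightarrow> c x = c y \<Longrightarrow> walk K w x = x \<longleftrightarrow> walk K w y = y"
    unfolding colour_regular_def by blast
  have bip: "bipartite K" using c bipartite_iff[OF K] by blast
  then have sub: "stab K ?b \<subseteq> Delta0" by (simp add: bipartite_def hsub_eq)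
  have "subgroup (stab K ?b) Delta0_group"
    using group.subgroup_incl[OF group_Delta subgroup_stab[OF K b]
        normal_imp_subgroup[OF Delta0_normal] sub] .
  moreover have "x \<otimes>\<^bsub>Delta0_group\<^esub> h \<otimes>\<^bsub>Delta0_group\<^esub> inv\<^bsub>Delta0_group\<^esub> x \<in> stab K ?b"
    if x: "x \<in> carrier Delta0_group" and h: "h \<in> stab K ?b" for x h
  proof -
    obtain w v where wv: "x = abs_delta w" "h = abs_delta v" using abs_delta_surj by metis
    have even: "\<not> parity_from False w" using x wv by (simp add: Delta0_words)
    have "c (walk K w ?b) = c ?b"
      using colouring_walk[OF K c b, of w] parity_from_xor[of "c ?b" w] even by auto
    moreover have "walk K v ?b = ?b" using h wv stab_words[OF K b] by simp
    ultimately have "walk K v (walk K w ?b) = walk K w ?b"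
      using eq fold_hperm_in_flags[OF K b] b by metis
    then have "abs_delta (w @ v @ rev w) \<in> stab K ?b"
      using walk_conj[OF K b] stab_words[OF K b] by blast
    then show ?thesis
      using x wv by (simp add: inv_Delta0 abs_delta_append abs_delta_rev
          monoid.m_assoc[OF group.is_monoid[OF group_Delta], simplified])
  qed
  ultimately have "stab K ?b \<lhd> Delta0_group"
    unfolding group.normal_inv_iff[OF group_Delta0] by blast
  then show "bipartite_regular K"
    using bip by (simp add: bipartite_regular_def hsub_eq)
qed

section \<open>The Walsh, Pin and duality constructions on flags\<close>

text \<open>Two copies of the flags of \<open>K\<close>, one for each \<open>Delta0\<close>-orbit.  \<open>R\<^sub>0\<close> exchanges the copies;
  on the first, \<open>R\<^sub>1\<close> and \<open>R\<^sub>2\<close> act through their images under the epimorphism, and on the second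
  through the images of their conjugates by \<open>R\<^sub>0\<close>.\<close>

definition cover :: "(bool \<Rightarrow> idx \<Rightarrow> idx) \<Rightarrow> 'a hypermap \<Rightarrow> ('a \<times> bool) hypermap" where
  "cover t K = \<lparr>flags = flags K \<times> UNIV,
     hperm = (\<lambda>i (x, p). if i = I0 then (x, \<not> p) else (hperm K (t p i) x, p))\<rparr>"

lemma walk_cover: "walk (cover t K) w (x, p) = (walk K (rewr t p w) x, parity_from p w)"
  by (induction w arbitrary: x p) (auto simp: cover_def)

lemma is_hypermap_cover:
  assumes K: "is_hypermap K" and t: "{t False I1, t False I2, t True I1, t True I2} = UNIV"
  shows "is_hypermap (cover t K)"
proof (rule is_hypermapI)
  let ?C = "cover t K"
  show "finite (flags ?C)" "flags ?C \<noteq> {}"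
    using K by (auto simp: cover_def is_hypermap_def)
  fix i z assume z: "z \<in> flags ?C"
  then show "hperm ?C i z \<in> flags ?C" by (auto simp: cover_def hperm_closed[OF K])
  show "hperm ?C i z \<noteq> z" using z by (auto simp: cover_def hperm_neq[OF K] split: if_splits)
  show "hperm ?C i (hperm ?C i z) = z" using z by (auto simp: cover_def hperm_hperm[OF K])
next
  let ?C = "cover t K"
  fix z z' assume z: "z \<in> flags ?C" "z' \<in> flags ?C"
  have step: "\<exists>u. rewr t False u = [i] \<and> \<not> parity_from False u" for i
  proof -
    have "i \<in> {t False I1, t False I2, t True I1, t True I2}" unfolding t by simp
    then obtain j where "j \<noteq> I0" "i = t False j \<or> i = t True j" by auto
    then have "rewr t False [j] = [i] \<or> rewr t False [I0, j, I0] = [i]"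
      "\<not> parity_from False [j]" "\<not> parity_from False [I0, j, I0]" by auto
    then show ?thesis by blast
  qed
  \<comment> \<open>every word of \<open>K\<close> lifts to the first copy because the table \<open>t\<close> is onto\<close>
  have lift: "\<exists>u. rewr t False u = w \<and> \<not> parity_from False u" for w
  proof (induction w)
    case Nil
    show ?case by (intro exI[of _ "[]"]) simp
  next
    case (Cons i w)
    then obtain u v where "rewr t False u = [i] \<and> \<not> parity_from False u"
      "rewr t False v = w \<and> \<not> parity_from False v" using step by blast
    then have "rewr t False (u @ v) = i # w \<and> \<not> parity_from False (u @ v)"
      by (simp add: rewr_append parity_from_append)
    then show ?case by blast
  qed
  obtain x p x' p' where xp: "z = (x, p)" "z' = (x', p')" by (cases z, cases z')
  then have "x \<in> flags K" "x' \<in> flags K" using z by (auto simp: cover_def)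
  then obtain w where w: "walk K w x = x'" using hypermap_connected[OF K] by blast
  obtain u where u: "rewr t False u = w" "\<not> parity_from False u" using lift by blast
  have "walk ?C ((if p then [I0] else []) @ u @ (if p' then [I0] else [])) z = z'"
    unfolding xp walk_cover using u w by (simp add: rewr_append parity_from_append)
  then show "\<exists>w. walk ?C w z = z'" by blast
qed

lemma stab_cover:
  assumes K: "is_hypermap K" and f: "is_phi a b c d f"
    and C: "is_hypermap (cover (phi_table a b c d) K)"
  shows "stab (cover (phi_table a b c d) K) (base_flag K, False) = {g \<in> Delta0. f g \<in> hsub K}"
proof (rule Set.set_eqI)
  let ?C = "cover (phi_table a b c d) K" and ?b = "base_flag K"
  fix g obtain w where w: "g = abs_delta w" using abs_delta_surj by blast
  have b: "?b \<in> flags K" "(?b, False) \<in> flags ?C" using base_flag[OF K] by (auto simp: cover_def)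
  show "g \<in> stab ?C (?b, False) \<longleftrightarrow> g \<in> {g \<in> Delta0. f g \<in> hsub K}"
  proof (cases "parity_from False w")
    case True
    then show ?thesis by (simp add: w stab_words[OF C b(2)] walk_cover Delta0_words)
  next
    case False
    then show ?thesis
      by (simp add: w stab_words[OF C b(2)] walk_cover Delta0_words phi_words[OF f]
          hsub_eq stab_words[OF K b(1)])
  qed
qed

lemma cover_iso:
  assumes K: "is_hypermap K" and f: "is_phi a b c d f" and t: "{a, b, c, d} = (UNIV :: idx set)"
  shows "is_hypermap (cover (phi_table a b c d) K)"
    and "cover (phi_table a b c d) K \<cong>\<^sub>h coset_hypermap {g \<in> Delta0. f g \<in> hsub K}"
proof -
  show C: "is_hypermap (cover (phi_table a b c d) K)"
    by (rule is_hypermap_cover[OF K]) (use t in simp)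
  have "(base_flag K, False) \<in> flags (cover (phi_table a b c d) K)"
    using base_flag[OF K] by (simp add: cover_def)
  then show "cover (phi_table a b c d) K \<cong>\<^sub>h coset_hypermap {g \<in> Delta0. f g \<in> hsub K}"
    using coset_hypermap_iso[OF C] unfolding stab_cover[OF K f C, symmetric] by blast
qed

definition relabel :: "(idx \<Rightarrow> idx) \<Rightarrow> 'a hypermap \<Rightarrow> 'a hypermap" where
  "relabel \<sigma> K = \<lparr>flags = flags K, hperm = (\<lambda>i. hperm K (\<sigma> i))\<rparr>"

lemma walk_relabel: "walk (relabel \<sigma> K) w x = walk K (map \<sigma> w) x"
  by (induction w arbitrary: x) (auto simp: relabel_def)

lemma flags_relabel [simp]: "flags (relabel \<sigma> K) = flags K"
  by (simp add: relabel_def)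

lemma is_hypermap_relabel:
  assumes K: "is_hypermap K" and \<sigma>: "\<And>i. \<sigma> (\<sigma> i) = i"
  shows "is_hypermap (relabel \<sigma> K)"
proof (rule is_hypermapI)
  fix x y assume "x \<in> flags (relabel \<sigma> K)" "y \<in> flags (relabel \<sigma> K)"
  then obtain w where "walk K w x = y" using hypermap_connected[OF K] by (auto simp: relabel_def)
  then have "walk (relabel \<sigma> K) (map \<sigma> w) x = y"
    unfolding walk_relabel by (simp add: o_def \<sigma>)
  then show "\<exists>w. walk (relabel \<sigma> K) w x = y" by blast
qed (use K in \<open>auto simp: relabel_def is_hypermap_def hperm_closed[OF K]\<close>)

lemma deg_relabel:
  assumes \<sigma>: "\<And>i. \<sigma> (\<sigma> i) = i"
  shows "deg (relabel \<sigma> K) k x = deg K (\<sigma> k) x"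
proof -
  have "inj \<sigma>" by (rule injI) (metis \<sigma>)
  then have mem: "k \<in> set w \<longleftrightarrow> \<sigma> k \<in> set (map \<sigma> w)" for w
    by (simp add: inj_image_mem_iff)
  have "face (relabel \<sigma> K) k x = face K (\<sigma> k) x"
  proof (intro equalityI subsetI)
    fix y assume "y \<in> face (relabel \<sigma> K) k x"
    then obtain w where "k \<notin> set w" "y = walk K (map \<sigma> w) x"
      by (auto simp: face_def walk_relabel)
    then show "y \<in> face K (\<sigma> k) x"
      using mem[of w] faceI[of "\<sigma> k" "map \<sigma> w" K x] by blast
  next
    fix y assume "y \<in> face K (\<sigma> k) x"
    then obtain w where w: "\<sigma> k \<notin> set w" "y = walk K w x"
      by (auto simp: face_def)
    have ww: "map \<sigma> (map \<sigma> w) = w" by (simp add: o_def \<sigma>)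
    have "k \<notin> set (map \<sigma> w)" using w(1) mem[of "map \<sigma> w"] unfolding ww by blast
    then have "walk (relabel \<sigma> K) (map \<sigma> w) x \<in> face (relabel \<sigma> K) k x" by (rule faceI)
    then show "y \<in> face (relabel \<sigma> K) k x" unfolding walk_relabel ww w(2) .
  qed
  then show ?thesis by (simp add: deg_def)
qed

lemma dual_iso:
  assumes K: "is_hypermap K" and \<sigma>: "\<And>i. \<sigma> (\<sigma> i) = i"
  shows "relabel \<sigma> K \<cong>\<^sub>h dual \<sigma> K"
proof -
  let ?R = "relabel \<sigma> K" and ?b = "base_flag K"
  note R = is_hypermap_relabel[where \<sigma> = \<sigma>, OF K \<sigma>]
  have b: "?b \<in> flags K" "?b \<in> flags ?R" using base_flag[OF K] by auto
  have "stab ?R ?b = sigma_circ \<sigma> ` stab K ?b"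
  proof (intro equalityI subsetI)
    fix g assume g: "g \<in> stab ?R ?b"
    obtain w where w: "g = abs_delta w" using abs_delta_surj by blast
    have "abs_delta (map \<sigma> w) \<in> stab K ?b"
      using g w by (simp add: stab_words[OF R b(2)] stab_words[OF K b(1)] walk_relabel)
    moreover have "g = sigma_circ \<sigma> (abs_delta (map \<sigma> w))"
      by (simp add: w sigma_circ.abs_eq o_def \<sigma>)
    ultimately show "g \<in> sigma_circ \<sigma> ` stab K ?b" by blast
  next
    fix g assume "g \<in> sigma_circ \<sigma> ` stab K ?b"
    then obtain h where h: "h \<in> stab K ?b" "g = sigma_circ \<sigma> h" by blast
    obtain w where w: "h = abs_delta w" using abs_delta_surj by blast
    show "g \<in> stab ?R ?b"
      using h by (simp add: w sigma_circ.abs_eq stab_words[OF R b(2)] stab_words[OF K b(1)]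
          walk_relabel o_def \<sigma>)
  qed
  then show ?thesis
    using coset_hypermap_iso[OF R b(2)] by (simp add: dual_def hsub_eq)
qed

section \<open>Uniform spherical hypermaps\<close>

definition uniform_spherical :: "'a hypermap \<Rightarrow> nat \<Rightarrow> nat \<Rightarrow> nat \<Rightarrow> nat \<Rightarrow> bool" where
  "uniform_spherical K l m n N \<longleftrightarrow> is_hypermap K \<and> spherical K \<and> card (flags K) = N \<and>
     (\<forall>x\<in>flags K. deg K I0 x = l \<and> deg K I1 x = m \<and> deg K I2 x = n)"

lemma uniform_iff:
  "is_hypermap K \<Longrightarrow> uniform K l m n \<longleftrightarrow>
     (\<forall>x\<in>flags K. deg K I0 x = l \<and> deg K I1 x = m \<and> deg K I2 x = n)"
  by (auto simp: uniform_def faces_eq deg_def)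

lemma euler_uniform:
  assumes "is_hypermap K"
    and "\<forall>x\<in>flags K. deg K I0 x = l \<and> deg K I1 x = m \<and> deg K I2 x = n"
  shows "euler K = real (card (flags K)) * ((1 / real l + 1 / real m + 1 / real n - 1) / 2)"
proof -
  have "euler K = (\<Sum>x\<in>flags K. (1 / real l + 1 / real m + 1 / real n - 1) / 2)"
    unfolding euler_sum[OF assms(1)] by (rule sum.cong[OF refl]) (use assms(2) in \<open>simp add: curvature_def\<close>)
  then show ?thesis by simp
qed

lemma uniform_sphericalI:
  assumes "is_hypermap K" "card (flags K) = N"
    and "\<forall>x\<in>flags K. deg K I0 x = l \<and> deg K I1 x = m \<and> deg K I2 x = n"
    and "real N * (1 / real l + 1 / real m + 1 / real n - 1) = 4"
  shows "uniform_spherical K l m n N"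
  using assms euler_uniform[OF assms(1,3)] by (simp add: uniform_spherical_def spherical_iff)

lemma uniform_spherical_card:
  assumes "uniform_spherical K l m n N"
  shows "real N * (1 / real l + 1 / real m + 1 / real n - 1) = 4"
proof -
  have "euler K = real N * ((1 / real l + 1 / real m + 1 / real n - 1) / 2)"
    using assms euler_uniform[of K l m n] by (simp add: uniform_spherical_def)
  then show ?thesis using assms by (simp add: uniform_spherical_def spherical_iff)
qed

lemma uniform_spherical_iso:
  assumes P: "uniform_spherical K l m n N" and iso: "K \<cong>\<^sub>h L"
  shows "uniform_spherical L l m n N"
proof (rule uniform_sphericalI)
  have K: "is_hypermap K" using P by (simp add: uniform_spherical_def)
  show "is_hypermap L" by (rule is_hypermap_iso[OF K iso])
  obtain f where b: "bij_betw f (flags K) (flags L)"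
    and f: "\<forall>i. \<forall>x\<in>flags K. f (hperm K i x) = hperm L i (f x)"
    using iso unfolding hypermap_iso_def by blast
  show "card (flags L) = N" using P bij_betw_same_card[OF b] by (simp add: uniform_spherical_def)
  show "\<forall>x\<in>flags L. deg L I0 x = l \<and> deg L I1 x = m \<and> deg L I2 x = n"
    using P unfolding bij_betw_imp_surj_on[OF b, symmetric] by (simp add: uniform_spherical_def deg_iso[OF K b f])
qed (rule uniform_spherical_card[OF P])

text \<open>Rigidity with both hypermaps equal: a uniform spherical hypermap is regular.\<close>

lemma uniform_spherical_regular:
  assumes P: "uniform_spherical K l m n N" and x: "x \<in> flags K" "y \<in> flags K" and w: "walk K w x = x"
  shows "walk K w y = y"
proof (rule spherical_rigid[OF _ _ _ x _ w])
  show K: "is_hypermap K" "is_hypermap K" "spherical K" using P by (auto simp: uniform_spherical_def)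
  show "deg K k (walk K w x) = deg K k (walk K w y)" for w k
    using P x fold_hperm_in_flags[OF K(1)] by (cases k) (auto simp: uniform_spherical_def)
qed

lemma uniform_spherical_relabel:
  assumes P: "uniform_spherical K l m n N" and \<sigma>: "\<And>i. \<sigma> (\<sigma> i) = i"
    and d: "\<And>k. case_idx l' m' n' k = case_idx l m n (\<sigma> k)"
    and sum: "1 / real l' + 1 / real m' + 1 / real n' = 1 / real l + 1 / real m + 1 / real n"
  shows "uniform_spherical (dual \<sigma> K) l' m' n' N"
proof (rule uniform_spherical_iso)
  have K: "is_hypermap K" using P by (simp add: uniform_spherical_def)
  show "relabel \<sigma> K \<cong>\<^sub>h dual \<sigma> K" by (rule dual_iso[OF K \<sigma>])
  show "uniform_spherical (relabel \<sigma> K) l' m' n' N"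
  proof (rule uniform_sphericalI)
    show "is_hypermap (relabel \<sigma> K)" by (rule is_hypermap_relabel[OF K \<sigma>])
    show "card (flags (relabel \<sigma> K)) = N" using P by (simp add: uniform_spherical_def)
    have "deg K k x = case_idx l m n k" if "x \<in> flags K" for k x
      using P that by (cases k) (auto simp: uniform_spherical_def)
    then show "\<forall>x\<in>flags (relabel \<sigma> K). deg (relabel \<sigma> K) I0 x = l' \<and>
        deg (relabel \<sigma> K) I1 x = m' \<and> deg (relabel \<sigma> K) I2 x = n'"
      using d[of I0] d[of I1] d[of I2] by (simp add: deg_relabel[where \<sigma> = \<sigma>, OF \<sigma>])
    show "real N * (1 / real l' + 1 / real m' + 1 / real n' - 1) = 4"
      using uniform_spherical_card[OF P] sum by simp
  qed
qed

lemma uniform_spherical_dual01: "uniform_spherical K l m n N \<Longrightarrow> uniform_spherical (dual01 K) m l n N"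
proof (erule uniform_spherical_relabel)
  show "case_idx m l n k = case_idx l m n (Transposition.transpose I0 I1 k)" for k
    by (cases k) (simp_all add: transpose_def)
qed simp_all

lemma uniform_spherical_dual02: "uniform_spherical K l m n N \<Longrightarrow> uniform_spherical (dual02 K) n m l N"
proof (erule uniform_spherical_relabel)
  show "case_idx n m l k = case_idx l m n (Transposition.transpose I0 I2 k)" for k
    by (cases k) (simp_all add: transpose_def)
qed simp_all

lemma uniform_spherical_dual12: "uniform_spherical K l m n N \<Longrightarrow> uniform_spherical (dual12 K) l n m N"
proof (erule uniform_spherical_relabel)
  show "case_idx l n m k = case_idx l m n (Transposition.transpose I1 I2 k)" for k
    by (cases k) (simp_all add: transpose_def)
qed simp_all

text \<open>One example on flags of any type suffices: it is carried over to the natural numbers, and the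
  hypermap chosen by \<open>uniform_sphere\<close> has the same number of flags by Euler's formula.\<close>

lemma uniform_spherical_uniform_sphere:
  assumes P: "uniform_spherical (K :: 'b hypermap) l m n N"
  shows "uniform_spherical (uniform_sphere l m n) l m n N"
proof -
  have K: "is_hypermap K" using P by (simp add: uniform_spherical_def)
  obtain h where h: "bij_betw h (flags K) {0..<card (flags K)}"
    using ex_bij_betw_finite_nat[OF hypermap_finite[OF K]] by blast
  let ?g = "inv_into (flags K) h"
  let ?L = "\<lparr>flags = {0..<card (flags K)}, hperm = (\<lambda>i k. h (hperm K i (?g k)))\<rparr>"
  have "?g (h x) = x" if "x \<in> flags K" for x
    using that h by (simp add: bij_betw_inv_into_left)
  then have "K \<cong>\<^sub>h ?L" unfolding hypermap_iso_def using h by (intro exI[of _ h]) simp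
  then have "uniform_spherical ?L l m n N" by (rule uniform_spherical_iso[OF P])
  then have "is_hypermap ?L \<and> spherical ?L \<and> uniform ?L l m n"
    using uniform_iff[of ?L] unfolding uniform_spherical_def by blast
  then have U: "is_hypermap (uniform_sphere l m n) \<and> spherical (uniform_sphere l m n) \<and>
      uniform (uniform_sphere l m n) l m n"
    unfolding uniform_sphere_def by (rule someI)
  define N' where "N' = card (flags (uniform_sphere l m n))"
  have U': "uniform_spherical (uniform_sphere l m n) l m n N'"
    using U uniform_iff[of "uniform_sphere l m n"] unfolding uniform_spherical_def N'_def by blast
  define r where "r = 1 / real l + 1 / real m + 1 / real n - 1"
  have "real N' * r = 4" "real N * r = 4"
    using uniform_spherical_card[OF U'] uniform_spherical_card[OF P] by (simp_all add: r_def)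
  then have "real N' * r = real N * r" "r \<noteq> 0" by auto
  then have "N' = N" by simp
  then show ?thesis using U' by simp
qed

section \<open>Bipartite-regular spherical hypermaps\<close>

definition bip_data :: "'a hypermap \<Rightarrow> ('a \<Rightarrow> bool) \<Rightarrow> nat \<Rightarrow> nat \<Rightarrow> nat \<Rightarrow> nat \<Rightarrow> bool" where
  "bip_data K c l1 l2 m n \<longleftrightarrow> is_hypermap K \<and> colour_regular K c \<and>
     (\<forall>x\<in>flags K. deg K I0 x = (if c x then l2 else l1) \<and> deg K I1 x = m \<and> deg K I2 x = n)"

lemma colour_regular_Not:
  assumes "colour_regular K c" shows "colour_regular K (\<lambda>x. \<not> c x)"
proof -
  have "colouring K (\<lambda>x. \<not> c x)"
    using assms by (simp add: colour_regular_def colouring_def)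
  then show ?thesis using assms unfolding colour_regular_def Not_eq_iff by blast
qed

lemma bip_data_swap: "bip_data K c l1 l2 m n \<Longrightarrow> bip_data K (\<lambda>x. \<not> c x) l2 l1 m n"
  by (simp add: bip_data_def colour_regular_Not)

lemma colour_regular_iso:
  assumes K: "is_hypermap K" and c: "colour_regular K c"
    and b: "bij_betw f (flags K) (flags L)"
    and f: "\<forall>i. \<forall>x\<in>flags K. f (hperm K i x) = hperm L i (f x)"
  shows "colour_regular L (\<lambda>y. c (inv_into (flags K) f y))"
proof -
  let ?c = "\<lambda>y. c (inv_into (flags K) f y)"
  have g: "inv_into (flags K) f (f x) = x" if "x \<in> flags K" for x
    using b that by (rule bij_betw_inv_into_left)
  have FL: "flags L = f ` flags K" using b by (simp add: bij_betw_def)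
  have inj: "f x = f y \<longleftrightarrow> x = y" if "x \<in> flags K" "y \<in> flags K" for x y
    using b that by (auto simp: bij_betw_def inj_on_def)
  have h: "hperm L i (f x) = f (hperm K i x)" if "x \<in> flags K" for i x
    using f that by simp
  have st: "walk L w (f x) = f x \<longleftrightarrow> walk K w x = x" if "x \<in> flags K" for w x
    using iso_walk[OF K f that, of w] inj[OF fold_hperm_in_flags[OF K that, of w] that] by simp
  have "colouring L ?c"
    unfolding colouring_def FL
    using c by (simp add: g h hperm_closed[OF K] colour_regular_def colouring_def)
  moreover have "walk L w y = y \<longleftrightarrow> walk L w z = z"
    if yz: "y \<in> flags L" "z \<in> flags L" "?c y = ?c z" for w y z
  proof -
    obtain a b where ab: "a \<in> flags K" "y = f a" "b \<in> flags K" "z = f b"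
      using yz(1,2) FL by blast
    then have "c a = c b" using yz(3) g by simp
    then have "walk K w a = a \<longleftrightarrow> walk K w b = b"
      using c ab unfolding colour_regular_def by blast
    then show ?thesis by (simp only: ab st)
  qed
  ultimately show ?thesis unfolding colour_regular_def by blast
qed

lemma bip_data_iso:
  assumes B: "bip_data K c l1 l2 m n" and iso: "K \<cong>\<^sub>h L"
  shows "\<exists>c'. bip_data L c' l1 l2 m n" and "card (flags L) = card (flags K)"
proof -
  have K: "is_hypermap K" and c: "colour_regular K c" using B by (auto simp: bip_data_def)
  obtain f where b: "bij_betw f (flags K) (flags L)"
    and f: "\<forall>i. \<forall>x\<in>flags K. f (hperm K i x) = hperm L i (f x)"
    using iso unfolding hypermap_iso_def by blast
  show "card (flags L) = card (flags K)" using bij_betw_same_card[OF b] by simp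
  have g: "inv_into (flags K) f (f x) = x" if "x \<in> flags K" for x
    using b that by (rule bij_betw_inv_into_left)
  have FL: "flags L = f ` flags K" using b by (simp add: bij_betw_def)
  have "bip_data L (\<lambda>y. c (inv_into (flags K) f y)) l1 l2 m n"
    using B is_hypermap_iso[OF K iso] colour_regular_iso[OF K c b f]
    by (simp add: bip_data_def FL deg_iso[OF K b f] g)
  then show "\<exists>c'. bip_data L c' l1 l2 m n" by blast
qed

lemma colour_flags:
  assumes K: "is_hypermap K" and c: "colouring K c"
  shows "2 * card {x \<in> flags K. c x} = card (flags K)" "2 * card {x \<in> flags K. \<not> c x} = card (flags K)"
    and "\<exists>x\<in>flags K. c x" "\<exists>x\<in>flags K. \<not> c x"
proof -
  let ?A = "{x \<in> flags K. c x}" and ?B = "{x \<in> flags K. \<not> c x}"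
  have "bij_betw (hperm K I0) ?A ?B"
    by (rule bij_betwI[where g = "hperm K I0"])
      (use c hperm_closed[OF K] hperm_hperm[OF K] in \<open>auto simp: colouring_def\<close>)
  then have eq: "card ?A = card ?B" by (rule bij_betw_same_card)
  have "card (flags K) = card (?A \<union> ?B)" by (rule arg_cong[of _ _ card]) blast
  also have "\<dots> = card ?A + card ?B"
    by (rule card_Un_disjoint) (use hypermap_finite[OF K] in auto)
  finally show "2 * card ?A = card (flags K)" "2 * card ?B = card (flags K)" using eq by auto
  obtain x where x: "x \<in> flags K" using base_flag[OF K] by blast
  then have "hperm K I0 x \<in> flags K" "c (hperm K I0 x) = (\<not> c x)"
    using c hperm_closed[OF K] by (auto simp: colouring_def)
  then show "\<exists>x\<in>flags K. c x" "\<exists>x\<in>flags K. \<not> c x" using x by blast+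
qed

lemma euler_bip:
  assumes B: "bip_data K c l1 l2 m n"
  shows "euler K = real (card (flags K)) *
    (1 / real l1 + 1 / real l2 + 2 / real m + 2 / real n - 2) / 4"
proof -
  have K: "is_hypermap K" and c: "colouring K c"
    using B by (auto simp: bip_data_def colour_regular_def)
  let ?A = "{x \<in> flags K. c x}" and ?B = "{x \<in> flags K. \<not> c x}"
  define R where "R = (\<lambda>l. (1 / real l + 1 / real m + 1 / real n - 1) / 2)"
  have R: "curvature K x = R (if c x then l2 else l1)" if "x \<in> flags K" for x
    using B that by (simp add: bip_data_def curvature_def R_def)
  have "euler K = (\<Sum>x\<in>?A \<union> ?B. curvature K x)"
    unfolding euler_sum[OF K] by (rule sum.cong) auto
  also have "\<dots> = (\<Sum>x\<in>?A. curvature K x) + (\<Sum>x\<in>?B. curvature K x)"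
    by (rule sum.union_disjoint) (use hypermap_finite[OF K] in auto)
  also have "(\<Sum>x\<in>?A. curvature K x) = (\<Sum>x\<in>?A. R l2)" by (rule sum.cong[OF refl]) (simp add: R)
  also have "(\<Sum>x\<in>?B. curvature K x) = (\<Sum>x\<in>?B. R l1)" by (rule sum.cong[OF refl]) (simp add: R)
  also have "(\<Sum>x\<in>?A. R l2) + (\<Sum>x\<in>?B. R l1) = real (card ?A) * R l2 + real (card ?B) * R l1" by simp
  finally have "euler K = real (card ?A) * R l2 + real (card ?B) * R l1" .
  moreover have "real (card ?A) = real (card (flags K)) / 2" "real (card ?B) = real (card (flags K)) / 2"
    using colour_flags(1,2)[OF K c] by linarith+
  ultimately have e: "euler K = real (card (flags K)) / 2 * R l2 + real (card (flags K)) / 2 * R l1"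
    by simp
  have "R l2 + R l1 = (1 / real l1 + 1 / real l2 + 2 / real m + 2 / real n - 2) / 2"
    unfolding R_def by (simp add: field_simps)
  moreover have "euler K = real (card (flags K)) / 2 * (R l2 + R l1)"
    unfolding e by (simp only: distrib_left)
  ultimately have "euler K = real (card (flags K)) / 2 *
      ((1 / real l1 + 1 / real l2 + 2 / real m + 2 / real n - 2) / 2)"
    by (simp only:)
  then show ?thesis by simp
qed

text \<open>Start from flags of the same colour: then any word leads to flags of the same colour, and
  hence of the same degrees, in both hypermaps.\<close>

theorem bip_data_unique:
  assumes K: "bip_data K c l1 l2 m n" "spherical K" and L: "bip_data L c' l1 l2 m n" "spherical L"
  shows "K \<cong>\<^sub>h L"
proof -
  have hK: "is_hypermap K" "colouring K c" and hL: "is_hypermap L" "colouring L c'"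
    using K(1) L(1) by (auto simp: bip_data_def colour_regular_def)
  obtain x where x: "x \<in> flags K" "\<not> c x" using colour_flags(4)[OF hK] by blast
  obtain y where y: "y \<in> flags L" "\<not> c' y" using colour_flags(4)[OF hL] by blast
  show ?thesis
  proof (rule spherical_iso[OF hK(1) hL(1) K(2) L(2) x(1) y(1)])
    fix w k
    have "c (walk K w x) = c' (walk L w y)"
      using colouring_walk[OF hK x(1), of w] colouring_walk[OF hL y(1), of w] x y by simp
    then show "deg K k (walk K w x) = deg L k (walk L w y)"
      using K(1) L(1) fold_hperm_in_flags[OF hK(1) x(1), of w] fold_hperm_in_flags[OF hL(1) y(1), of w]
      by (cases k) (auto simp: bip_data_def)
  qed
qed

subsection \<open>Types and numbers of faces\<close>

lemma orbits_Delta0: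
  assumes K: "is_hypermap K" and c: "colouring K c"
  shows "orbits K Delta0 = {{x \<in> flags K. \<not> c x}, {x \<in> flags K. c x}}"
proof -
  have orb: "{walk K w x | w. w \<in> {w. \<not> parity_from False w}} = {y \<in> flags K. c y = c x}"
    if x: "x \<in> flags K" for x
  proof (intro equalityI subsetI)
    fix y assume "y \<in> {walk K w x | w. w \<in> {w. \<not> parity_from False w}}"
    then obtain w where w: "\<not> parity_from False w" "y = walk K w x" by blast
    then have "c y = parity_from (c x) w" using colouring_walk[OF K c x, of w] by simp
    then show "y \<in> {y \<in> flags K. c y = c x}"
      using w parity_from_xor[of "c x" w] fold_hperm_in_flags[OF K x, of w] by auto
  next
    fix y assume "y \<in> {y \<in> flags K. c y = c x}"
    then have y: "y \<in> flags K" "c y = c x" by auto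
    obtain w where w: "walk K w x = y" using hypermap_connected[OF K x y(1)] by blast
    then have "c y = parity_from (c x) w" using colouring_walk[OF K c x, of w] by simp
    then have "\<not> parity_from False w" using parity_from_xor[of "c x" w] y(2) by auto
    then show "y \<in> {walk K w x | w. w \<in> {w. \<not> parity_from False w}}" using w by blast
  qed
  have "orbits K Delta0 = (\<lambda>x. {y \<in> flags K. c y = c x}) ` flags K"
    unfolding Delta0_eq orbits_words[OF K] by (rule image_cong[OF refl orb])
  also have "\<dots> = {{x \<in> flags K. \<not> c x}, {x \<in> flags K. c x}}"
  proof (intro equalityI subsetI)
    fix S assume "S \<in> (\<lambda>x. {y \<in> flags K. c y = c x}) ` flags K"
    then show "S \<in> {{x \<in> flags K. \<not> c x}, {x \<in> flags K. c x}}" by (auto split: if_splits)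
  next
    fix S assume S: "S \<in> {{x \<in> flags K. \<not> c x}, {x \<in> flags K. c x}}"
    obtain x y where "x \<in> flags K" "c x" "y \<in> flags K" "\<not> c y"
      using colour_flags(3,4)[OF K c] by blast
    then show "S \<in> (\<lambda>x. {y \<in> flags K. c y = c x}) ` flags K"
      using S by (auto intro: rev_image_eqI[of x] rev_image_eqI[of y])
  qed
  finally show ?thesis .
qed

lemma hypervertex_colour:
  assumes K: "is_hypermap K" and c: "colouring K c" and x: "x \<in> flags K" and y: "y \<in> face K I0 x"
  shows "c y = c x"
proof -
  have "parity_from p w = p" if "I0 \<notin> set w" for p w
    using that by (induction w arbitrary: p) auto
  then show ?thesis using y colouring_walk[OF K c x] by (auto simp: face_def)
qed

lemma card_faces_in:
  assumes K: "is_hypermap K" and S: "S \<subseteq> flags K" "\<And>x. x \<in> S \<Longrightarrow> face K k x \<subseteq> S"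
    and d: "\<And>x. x \<in> S \<Longrightarrow> deg K k x = d"
  shows "2 * d * card {f \<in> faces K k. f \<subseteq> S} = card S"
proof -
  let ?C = "{f \<in> faces K k. f \<subseteq> S}"
  have in_S: "\<exists>x\<in>S. f = face K k x" if f: "f \<in> ?C" for f
  proof -
    obtain x where "x \<in> flags K" "f = face K k x" using f by (auto simp: faces_eq[OF K])
    then show ?thesis using f face_self[of x K k] by blast
  qed
  have U: "\<Union>?C = S"
  proof (intro equalityI subsetI)
    fix x assume "x \<in> S"
    then have "face K k x \<in> ?C" using S by (auto simp: faces_eq[OF K])
    then show "x \<in> \<Union>?C" using face_self[of x K k] by blast
  qed blast
  have "2 * d * card ?C = card (\<Union>?C)"
  proof (rule card_partition)
    show "finite ?C" using finite_faces[OF K] by simp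
    show "finite (\<Union>?C)" unfolding U using finite_subset[OF S(1) hypermap_finite[OF K]] .
    show "card f = 2 * d" if "f \<in> ?C" for f
      using in_S[OF that] card_face[OF K] S(1) d by auto
    show "f \<inter> g = {}" if "f \<in> ?C" "g \<in> ?C" "f \<noteq> g" for f g
      using faces_disjoint[OF K, of f k g] that by blast
  qed
  then show ?thesis unfolding U .
qed

lemma bip_data_type:
  assumes B: "bip_data K c l1 l2 m n"
  shows "bipartite_type_via K {x \<in> flags K. \<not> c x} {x \<in> flags K. c x} (l1, l2, m, n)"
proof -
  have K: "is_hypermap K" and c: "colouring K c"
    using B by (auto simp: bip_data_def colour_regular_def)
  have "{x \<in> flags K. \<not> c x} \<noteq> {x \<in> flags K. c x}" using colour_flags(3)[OF K c] by blast
  moreover have "valency v = l1" if v: "v \<in> hypervertices K" "v \<subseteq> {x \<in> flags K. \<not> c x}" for v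
  proof -
    obtain x where "x \<in> flags K" "v = face K I0 x" using v by (auto simp: faces_eq[OF K])
    then show ?thesis using v(2) face_self[of x K I0] B by (auto simp: bip_data_def deg_def)
  qed
  moreover have "valency v = l2" if v: "v \<in> hypervertices K" "v \<subseteq> {x \<in> flags K. c x}" for v
  proof -
    obtain x where "x \<in> flags K" "v = face K I0 x" using v by (auto simp: faces_eq[OF K])
    then show ?thesis using v(2) face_self[of x K I0] B by (auto simp: bip_data_def deg_def)
  qed
  moreover have "\<forall>e\<in>hyperedges K. valency e = m" "\<forall>f\<in>hyperfaces K. valency f = n"
    using B by (auto simp: faces_eq[OF K] bip_data_def deg_def)
  ultimately show ?thesis
    unfolding bipartite_type_via_def using orbits_Delta0[OF K c] by simp
qed

theorem bip_data_numbers: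
  assumes B: "bip_data K c l1 l2 m n" and N: "card (flags K) = N"
    and V: "4 * l1 * V1 = N" "4 * l2 * V2 = N" "2 * m * E = N" "2 * n * F = N"
    and eul: "2 * (V1 + V2 + E + F) = 4 + N"
  shows "is_hypermap K \<and> bipartite_regular K \<and> spherical K \<and>
    has_bipartite_type_and_numbers K (l1, l2, m, n) (V1, V2, E, F, N)"
proof -
  have K: "is_hypermap K" and reg: "colour_regular K c" using B by (simp_all add: bip_data_def)
  then have c: "colouring K c" by (simp add: colour_regular_def)
  have bip: "bipartite K" "bipartite_regular K"
    using bipartite_iff[OF K] bipartite_regular_iff[OF K] c reg by blast+
  let ?A = "{x \<in> flags K. \<not> c x}" and ?B = "{x \<in> flags K. c x}"
  have N0: "0 < N"
    using hypermap_finite[OF K] base_flag[OF K] N card_gt_0_iff by blast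
  have pos: "0 < l1" "0 < l2" "0 < m" "0 < n" using V N0 by (auto intro!: Nat.gr0I)
  have "2 * l1 * card {v \<in> hypervertices K. v \<subseteq> ?A} = card ?A"
    by (rule card_faces_in[OF K])
      (use B hypervertex_colour[OF K c] face_subset[OF K] in \<open>auto simp: bip_data_def subset_iff\<close>)
  then have "4 * l1 * card {v \<in> hypervertices K. v \<subseteq> ?A} = 4 * l1 * V1"
    using colour_flags(2)[OF K c] N V(1) by simp
  then have V1: "card {v \<in> hypervertices K. v \<subseteq> ?A} = V1" using pos by simp
  have "2 * l2 * card {v \<in> hypervertices K. v \<subseteq> ?B} = card ?B"
    by (rule card_faces_in[OF K])
      (use B hypervertex_colour[OF K c] face_subset[OF K] in \<open>auto simp: bip_data_def subset_iff\<close>)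
  then have "4 * l2 * card {v \<in> hypervertices K. v \<subseteq> ?B} = 4 * l2 * V2"
    using colour_flags(1)[OF K c] N V(2) by simp
  then have V2: "card {v \<in> hypervertices K. v \<subseteq> ?B} = V2" using pos by simp
  have all: "{f \<in> faces K k. f \<subseteq> flags K} = faces K k" for k
    using face_subset[OF K] by (auto simp: faces_eq[OF K])
  have "2 * m * card (hyperedges K) = card (flags K)"
    using card_faces_in[OF K order.refl, of I1 m] face_subset[OF K] B
    by (simp add: all bip_data_def)
  then have "2 * m * card (hyperedges K) = 2 * m * E" using N V(3) by simp
  then have E: "card (hyperedges K) = E" using pos by simp
  have "2 * n * card (hyperfaces K) = card (flags K)"
    using card_faces_in[OF K order.refl, of I2 n] face_subset[OF K] B
    by (simp add: all bip_data_def)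
  then have "2 * n * card (hyperfaces K) = 2 * n * F" using N V(4) by simp
  then have F: "card (hyperfaces K) = F" using pos by simp
  have "{v \<in> hypervertices K. v \<subseteq> ?A} \<union> {v \<in> hypervertices K. v \<subseteq> ?B} = hypervertices K"
  proof (intro equalityI subsetI)
    fix v assume v: "v \<in> hypervertices K"
    then obtain x where x: "x \<in> flags K" "v = face K I0 x" by (auto simp: faces_eq[OF K])
    then have "y \<in> flags K \<and> c y = c x" if "y \<in> v" for y
      using hypervertex_colour[OF K c x(1), of y] face_subset[OF K x(1)] that by blast
    then show "v \<in> {v \<in> hypervertices K. v \<subseteq> ?A} \<union> {v \<in> hypervertices K. v \<subseteq> ?B}"
      using v by (cases "c x") auto
  qed blast
  moreover have "{v \<in> hypervertices K. v \<subseteq> ?A} \<inter> {v \<in> hypervertices K. v \<subseteq> ?B} = {}"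
  proof -
    have "False" if v: "v \<in> hypervertices K" "v \<subseteq> ?A" "v \<subseteq> ?B" for v
    proof -
      obtain x where "v = face K I0 x" using v(1) by (auto simp: faces_eq[OF K])
      then have "x \<in> v" using face_self[of x K I0] by simp
      then show False using v(2,3) by blast
    qed
    then show ?thesis by blast
  qed
  ultimately have "card (hypervertices K) = V1 + V2"
    using card_Un_disjoint[of "{v \<in> hypervertices K. v \<subseteq> ?A}" "{v \<in> hypervertices K. v \<subseteq> ?B}"]
      finite_faces[OF K] V1 V2 by simp
  then have "spherical K"
    unfolding spherical_def E F N using arg_cong[OF eul, of real] by simp
  moreover have "has_bipartite_type_and_numbers K (l1, l2, m, n) (V1, V2, E, F, N)"
    unfolding has_bipartite_type_and_numbers_def prod.case
    using bip(1) bip_data_type[OF B] V1 V2 E F N by blast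
  ultimately show ?thesis using K bip(2) by blast
qed

text \<open>A bipartite-type lists its two valencies in either order, so the colouring obtained from
  regularity may have to be complemented.\<close>

lemma bip_data_of_type:
  assumes K: "is_hypermap K" and reg: "bipartite_regular K"
    and t: "has_bipartite_type K (l1, l2, m, n)"
  shows "\<exists>c. bip_data K c l1 l2 m n"
proof -
  obtain c where c: "colour_regular K c" using bipartite_regular_iff[OF K] reg by blast
  obtain O1 O2 where O: "bipartite_type_via K O1 O2 (l1, l2, m, n)"
    using t unfolding has_bipartite_type_def by blast
  have data: "bip_data K c l1 l2 m n"
    if c: "colour_regular K c" and O12: "O1 = {x \<in> flags K. \<not> c x}" "O2 = {x \<in> flags K. c x}" for c
  proof -
    have col: "colouring K c" using c by (simp add: colour_regular_def)
    have "deg K I0 x = (if c x then l2 else l1) \<and> deg K I1 x = m \<and> deg K I2 x = n"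
      if x: "x \<in> flags K" for x
    proof -
      have f: "face K k x \<in> faces K k" for k using x by (auto simp: faces_eq[OF K])
      have "y \<in> flags K \<and> c y = c x" if "y \<in> face K I0 x" for y
        using hypervertex_colour[OF K col x that] face_subset[OF K x] that by blast
      then have "if c x then face K I0 x \<subseteq> O2 else face K I0 x \<subseteq> O1" using O12 by auto
      then show ?thesis
        using O f unfolding bipartite_type_via_def deg_def by (auto split: if_splits)
    qed
    then show ?thesis using K c by (simp add: bip_data_def)
  qed
  have "{O1, O2} = {{x \<in> flags K. \<not> c x}, {x \<in> flags K. c x}}"
    using O orbits_Delta0[OF K, of c] c by (simp add: bipartite_type_via_def colour_regular_def)
  then have "O1 = {x \<in> flags K. \<not> c x} \<and> O2 = {x \<in> flags K. c x} \<or>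
      O1 = {x \<in> flags K. c x} \<and> O2 = {x \<in> flags K. \<not> c x}"
    by (simp add: doubleton_eq_iff)
  then show ?thesis
    using data[OF c] data[OF colour_regular_Not[OF c]] by auto
qed

section \<open>The listed hypermaps\<close>

lemma has_period_self: "has_period f x p \<Longrightarrow> (f ^^ p) x = x"
  by (simp add: has_period_def)

lemma has_period_rot_same:
  assumes "is_hypermap K" "x \<in> flags K" shows "has_period (rot K i i) x 1"
proof -
  have "(rot K i i ^^ n) x = x" for n
    by (induction n) (simp_all add: hperm_hperm[OF assms])
  then show ?thesis by (simp add: has_period_def)
qed

lemma cover_vertex_period:
  assumes "has_period (rot K (t p I1) (t p I2)) x q"
  shows "has_period (rot (cover t K) I1 I2) (x, p) q"
proof -
  have "(rot (cover t K) I1 I2 ^^ n) (x, p) = ((rot K (t p I1) (t p I2) ^^ n) x, p)" for n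
    by (induction n) (simp_all add: cover_def)
  then show ?thesis using assms by (simp add: has_period_def)
qed

text \<open>Starting on the first copy, two steps of \<open>R\<^sub>0 R\<^sub>j\<close> apply first the image of the conjugate of
  \<open>R\<^sub>j\<close> and then the image of \<open>R\<^sub>j\<close>; an odd number of steps ends on the second copy.\<close>

lemma cover_rot_period:
  assumes q: "has_period (rot K (t True j) (t False j)) x q" and j: "j \<noteq> I0"
  shows "has_period (rot (cover t K) I0 j) (x, False) (2 * q)"
proof -
  let ?f = "rot (cover t K) I0 j" and ?g = "rot K (t True j) (t False j)"
  have even: "(?f ^^ (2 * n)) (x, False) = ((?g ^^ n) x, False)" for n
  proof (induction n)
    case (Suc n)
    have "(?f ^^ (2 * Suc n)) (x, False) = ?f (?f ((?f ^^ (2 * n)) (x, False)))" by simp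
    then show ?case unfolding Suc using j by (simp add: cover_def)
  qed simp
  have odd: "snd ((?f ^^ Suc (2 * n)) (x, False))" for n
  proof -
    have "(?f ^^ Suc (2 * n)) (x, False) = ?f ((?f ^^ (2 * n)) (x, False))" by simp
    then show ?thesis unfolding even using j by (simp add: cover_def)
  qed
  have "(?f ^^ n) (x, False) = (x, False) \<longleftrightarrow> 2 * q dvd n" for n
  proof (cases "even n")
    case True
    then obtain k where k: "n = 2 * k" by blast
    show ?thesis using q unfolding k even by (simp add: has_period_def)
  next
    case False
    then obtain k where k: "n = Suc (2 * k)" by (metis oddE Suc_eq_plus1)
    have "\<not> 2 * q dvd n" using False by (metis dvd_mult_left)
    moreover have "(?f ^^ n) (x, False) \<noteq> (x, False)" using odd[of k] unfolding k by auto
    ultimately show ?thesis by blast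
  qed
  then show ?thesis using q by (simp add: has_period_def)
qed

text \<open>Here \<open>t True I2\<close> is \<open>I2\<close> for \<open>Wal\<close> and \<open>I0\<close> for \<open>Pin\<close>.  When the two labels in \<open>l'\<close> or \<open>e\<close>
  coincide the product of the involutions is the identity and the period is 1.\<close>

lemma cover_data:
  assumes P: "uniform_spherical K l m n N" and C: "is_hypermap (cover t K)"
    and t: "t False I1 = I1" "t False I2 = I2" "t True I1 = I0"
    and l': "\<And>x. x \<in> flags K \<Longrightarrow> has_period (rot K I0 (t True I2)) x l'"
    and e: "\<And>x. x \<in> flags K \<Longrightarrow> has_period (rot K (t True I2) I2) x e"
  shows "bip_data (cover t K) snd l l' (2 * e) (2 * n)" "card (flags (cover t K)) = 2 * N"
proof -
  let ?C = "cover t K"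
  have K: "is_hypermap K" using P by (simp add: uniform_spherical_def)
  have per: "has_period (rot K i j) x (case_idx l m n k)"
    if "x \<in> flags K" "i \<noteq> j" "k \<noteq> i" "k \<noteq> j" for x i j k
    using deg_period[OF K that] P that(1) by (cases k) (auto simp: uniform_spherical_def)
  have fl: "(x, p) \<in> flags ?C \<longleftrightarrow> x \<in> flags K" for x p by (simp add: cover_def)
  have vert: "deg ?C I0 (x, p) = (if p then l' else l)" if x: "x \<in> flags K" for x p
  proof (rule deg_eqI[OF C, of _ I1 I2])
    show "has_period (rot ?C I1 I2) (x, p) (if p then l' else l)"
      by (rule cover_vertex_period) (use l'[OF x] per[OF x, of I1 I2 I0] t in auto)
  qed (use x fl in auto)
  have "deg ?C I1 (x, False) = 2 * e" if x: "x \<in> flags K" for x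
    by (rule deg_eqI[OF C, of _ I0 I2]) (use x fl cover_rot_period[of K t I2 x e] e[OF x] t in auto)
  moreover have "deg ?C I2 (x, False) = 2 * n" if x: "x \<in> flags K" for x
    by (rule deg_eqI[OF C, of _ I0 I1])
      (use x fl cover_rot_period[of K t I1 x n] per[OF x, of I0 I1 I2] t in auto)
  moreover have "deg ?C k (x, True) = deg ?C k (x, False)" if "x \<in> flags K" "k \<noteq> I0" for x k
    using deg_hperm[OF C, of "(x, False)" I0 k] that fl by (simp add: cover_def)
  ultimately have edge_face: "deg ?C I1 (x, p) = 2 * e \<and> deg ?C I2 (x, p) = 2 * n" if "x \<in> flags K" for x p
    using that by (cases p) simp_all
  have degs: "deg ?C I0 z = (if snd z then l' else l) \<and> deg ?C I1 z = 2 * e \<and> deg ?C I2 z = 2 * n"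
    if "z \<in> flags ?C" for z
  proof -
    obtain x p where z: "z = (x, p)" by (cases z)
    then have "x \<in> flags K" using that fl by simp
    then show ?thesis using vert edge_face by (simp add: z)
  qed
  have "colouring ?C snd" by (auto simp: colouring_def cover_def)
  moreover have "walk ?C w z = z \<longleftrightarrow> walk ?C w z' = z'"
    if z: "z \<in> flags ?C" "z' \<in> flags ?C" "snd z = snd z'" for w z z'
  proof -
    obtain x x' p where x: "z = (x, p)" "z' = (x', p)" using z(3) by (cases z, cases z') auto
    then have "x \<in> flags K" "x' \<in> flags K" using z fl by auto
    then have "walk K v x = x \<longleftrightarrow> walk K v x' = x'" for v
      using uniform_spherical_regular[OF P] by blast
    then show ?thesis by (simp add: x walk_cover)
  qed
  ultimately have "colour_regular ?C snd" unfolding colour_regular_def by blast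
  then show "bip_data ?C snd l l' (2 * e) (2 * n)" using C degs by (simp add: bip_data_def)
  show "card (flags ?C) = 2 * N" using P by (simp add: cover_def uniform_spherical_def card_cartesian_product UNIV_bool)
qed

lemma Wal_data:
  assumes P: "uniform_spherical K l m n N"
  shows "\<exists>c. bip_data (Wal K) c l m 2 (2 * n)" "card (flags (Wal K)) = 2 * N"
proof -
  let ?t = "phi_table I1 I2 I0 I2"
  have K: "is_hypermap K" using P by (simp add: uniform_spherical_def)
  have U: "{I1, I2, I0, I2} = (UNIV :: idx set)" by (auto simp: UNIV_idx)
  note C = cover_iso[OF K phi_W U]
  have per: "has_period (rot K I0 I2) x m" if "x \<in> flags K" for x
    using deg_period[OF K that, of I0 I2 I1] P that by (simp add: uniform_spherical_def)
  have data: "bip_data (cover ?t K) snd l m (2 * 1) (2 * n)" "card (flags (cover ?t K)) = 2 * N"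
    by (rule cover_data[OF P C(1), where l' = m and e = 1];
        simp add: per has_period_rot_same[OF K, simplified])+
  show "\<exists>c. bip_data (Wal K) c l m 2 (2 * n)" "card (flags (Wal K)) = 2 * N"
    using bip_data_iso[OF data(1) C(2)] data(2) by (simp_all add: Wal_def)
qed

lemma Pin_data:
  assumes P: "uniform_spherical K l m n N"
  shows "\<exists>c. bip_data (Pin K) c l 1 (2 * m) (2 * n)" "card (flags (Pin K)) = 2 * N"
proof -
  let ?t = "phi_table I1 I2 I0 I0"
  have K: "is_hypermap K" using P by (simp add: uniform_spherical_def)
  have U: "{I1, I2, I0, I0} = (UNIV :: idx set)" by (auto simp: UNIV_idx)
  note C = cover_iso[OF K phi_P U]
  have per: "has_period (rot K I0 I2) x m" if "x \<in> flags K" for x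
    using deg_period[OF K that, of I0 I2 I1] P that by (simp add: uniform_spherical_def)
  have data: "bip_data (cover ?t K) snd l 1 (2 * m) (2 * n)" "card (flags (cover ?t K)) = 2 * N"
    by (rule cover_data[OF P C(1), where l' = 1 and e = m];
        simp add: per has_period_rot_same[OF K, simplified])+
  show "\<exists>c. bip_data (Pin K) c l 1 (2 * m) (2 * n)" "card (flags (Pin K)) = 2 * N"
    using bip_data_iso[OF data(1) C(2)] data(2) by (simp_all add: Pin_def)
qed

definition realises_row :: "nat \<times> nat \<times> nat \<times> nat \<Rightarrow> nat \<times> nat \<times> nat \<times> nat \<times> nat \<Rightarrow> 'a hypermap \<Rightarrow> bool" where
  "realises_row t v L \<longleftrightarrow> is_hypermap L \<and> bipartite_regular L \<and> spherical L \<and>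
     has_bipartite_type_and_numbers L t v"

lemma realises_rowI:
  assumes "\<exists>c. bip_data L c l1 l2 m n" "card (flags L) = N"
    and "4 * l1 * V1 = N" "4 * l2 * V2 = N" "2 * m * E = N" "2 * n * F = N" "2 * (V1 + V2 + E + F) = 4 + N"
  shows "realises_row (l1, l2, m, n) (V1, V2, E, F, N) L"
  using assms bip_data_numbers unfolding realises_row_def by blast

lemma Wal_row:
  assumes "uniform_spherical K l m n N" "(l1, l2) = (l, m) \<or> (l1, l2) = (m, l)" "k = 2 * n" "N' = 2 * N"
    and "4 * l1 * V1 = N'" "4 * l2 * V2 = N'" "4 * E = N'" "2 * k * F = N'" "2 * (V1 + V2 + E + F) = 4 + N'"
  shows "realises_row (l1, l2, 2, k) (V1, V2, E, F, N') (Wal K)"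
proof (rule realises_rowI)
  obtain c where "bip_data (Wal K) c l m 2 (2 * n)" using Wal_data(1)[OF assms(1)] by blast
  then show "\<exists>c. bip_data (Wal K) c l1 l2 2 k"
    using assms(2,3) bip_data_swap by blast
qed (use assms Wal_data(2)[OF assms(1)] in simp_all)

lemma Pin_row:
  assumes "uniform_spherical K l m n N" "j = 2 * m" "k = 2 * n" "N' = 2 * N"
    and "4 * V1 = N'" "4 * l * V2 = N'" "2 * j * E = N'" "2 * k * F = N'" "2 * (V1 + V2 + E + F) = 4 + N'"
  shows "realises_row (1, l, j, k) (V1, V2, E, F, N') (Pin K)"
proof (rule realises_rowI)
  obtain c where "bip_data (Pin K) c l 1 (2 * m) (2 * n)" using Pin_data(1)[OF assms(1)] by blast
  then show "\<exists>c. bip_data (Pin K) c 1 l j k"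
    using assms(2,3) bip_data_swap by blast
qed (use assms Pin_data(2)[OF assms(1)] in simp_all)

lemma row_type: "realises_row t v L \<Longrightarrow> has_bipartite_type L t"
  unfolding realises_row_def has_bipartite_type_and_numbers_def has_bipartite_type_def
  by (cases v) auto

lemma row_unique:
  assumes L: "realises_row t v L" and K: "is_hypermap K" "bipartite_regular K" "spherical K" "has_bipartite_type K t"
  shows "K \<cong>\<^sub>h L"
proof -
  obtain l1 l2 m n where t: "t = (l1, l2, m, n)" by (cases t) auto
  have "is_hypermap L" "bipartite_regular L" "spherical L" "has_bipartite_type L t"
    using L row_type[OF L] by (auto simp: realises_row_def)
  then show ?thesis
    using bip_data_of_type[of K l1 l2 m n] bip_data_of_type[of L l1 l2 m n] K bip_data_unique
    unfolding t by blast
qed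

section \<open>The possible types\<close>

lemma dual12_data:
  assumes B: "bip_data K c l1 l2 m n"
  shows "\<exists>c'. bip_data (dual12 K) c' l1 l2 n m" "card (flags (dual12 K)) = card (flags K)"
proof -
  let ?s = "Transposition.transpose I1 I2" and ?R = "relabel (Transposition.transpose I1 I2) K"
  have K: "is_hypermap K" and reg: "colour_regular K c" using B by (simp_all add: bip_data_def)
  have s: "?s (?s i) = i" for i by simp
  have s0: "?s i = I0 \<longleftrightarrow> i = I0" for i by (cases i) (simp_all add: transpose_def)
  have "colouring K c" using reg by (simp add: colour_regular_def)
  then have "colouring ?R c" by (simp add: colouring_def relabel_def s0)
  moreover have "walk ?R w x = x \<longleftrightarrow> walk ?R w y = y"
    if "x \<in> flags ?R" "y \<in> flags ?R" "c x = c y" for w x y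
    using reg that unfolding walk_relabel flags_relabel colour_regular_def by blast
  ultimately have "colour_regular ?R c" unfolding colour_regular_def by blast
  then have "bip_data ?R c l1 l2 n m"
    using B is_hypermap_relabel[where \<sigma> = ?s, OF K s]
    by (simp add: bip_data_def deg_relabel[where \<sigma> = ?s, OF s])
  from bip_data_iso[OF this dual_iso[where \<sigma> = ?s, OF K s]]
  show "\<exists>c'. bip_data (dual12 K) c' l1 l2 n m" "card (flags (dual12 K)) = card (flags K)"
    by simp_all
qed

text \<open>The period of \<open>R\<^sub>i R\<^sub>j\<close> at a flag can be read off from the stabiliser.\<close>

lemma deg_same_colour:
  assumes K: "is_hypermap K" and c: "colour_regular K c"
    and x: "x \<in> flags K" "y \<in> flags K" "c x = c y"
  shows "deg K k y = deg K k x"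
proof -
  obtain i j where ij: "i \<noteq> j" "k \<noteq> i" "k \<noteq> j" using exists_other_idx by blast
  have "walk K w x = x \<longleftrightarrow> walk K w y = y" for w
    using c x unfolding colour_regular_def by blast
  then have "has_period (rot K i j) y (deg K k x)"
    using deg_period[OF K x(1) ij] unfolding has_period_def rot_words by blast
  then show ?thesis by (rule deg_eqI[OF K x(2) ij])
qed

lemma even_deg:
  assumes K: "is_hypermap K" and c: "colouring K c" and x: "x \<in> flags K" and k: "k \<noteq> I0"
  shows "even (deg K k x)"
proof -
  obtain j where j: "j \<noteq> I0" "j \<noteq> k" using k by (cases k) (auto intro: that)
  have "c ((rot K I0 j ^^ q) x) = (c x \<noteq> odd q)" for q
  proof (induction q)
    case (Suc q)
    have "(rot K I0 j ^^ q) x \<in> flags K" by (rule rot_closed[OF K x])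
    then show ?case using Suc c j hperm_closed[OF K] by (auto simp: colouring_def)
  qed simp
  moreover have "(rot K I0 j ^^ deg K k x) x = x"
    using deg_period[OF K x, of I0 j k] j k by (simp add: has_period_def)
  ultimately show ?thesis by metis
qed

lemma exists_bip_data:
  assumes K: "is_hypermap K" and c: "colour_regular K c"
  shows "\<exists>l1 l2 a b. bip_data K c l1 l2 (2 * a) (2 * b)"
proof -
  have col: "colouring K c" using c by (simp add: colour_regular_def)
  obtain x where x: "x \<in> flags K" "\<not> c x" using colour_flags(4)[OF K col] by blast
  let ?y = "hperm K I0 x"
  have y: "?y \<in> flags K" "c ?y" using x col hperm_closed[OF K] by (auto simp: colouring_def)
  have d: "deg K k z = (if c z then deg K k ?y else deg K k x)" if z: "z \<in> flags K" for k z
    using deg_same_colour[OF K c x(1) z] deg_same_colour[OF K c y(1) z] x y by auto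
  have "deg K k ?y = deg K k x" if "k \<noteq> I0" for k using deg_hperm[OF K x(1), of I0 k] that by auto
  then have "bip_data K c (deg K I0 x) (deg K I0 ?y) (deg K I1 x) (deg K I2 x)"
    using K c d unfolding bip_data_def by auto
  moreover obtain a b where "deg K I1 x = 2 * a" "deg K I2 x = 2 * b"
    using even_deg[OF K col x(1), of I1] even_deg[OF K col x(1), of I2] by (auto elim!: evenE)
  ultimately show ?thesis by metis
qed

lemma deg_1_eq:
  assumes K: "is_hypermap K" and x: "x \<in> flags K" and d: "deg K I0 x = 1"
  shows "hperm K I1 x = hperm K I2 x"
proof -
  have "has_period (rot K I1 I2) x 1" using deg_period[OF K x, of I1 I2 I0] d by simp
  then have "(rot K I1 I2 ^^ 1) x = x" by (rule has_period_self)
  then have "hperm K I2 (hperm K I1 x) = x" by simp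
  then show ?thesis using hperm_hperm[OF K hperm_closed[OF K x, of I1], of I2] by simp
qed

lemma deg_2_commute:
  assumes K: "is_hypermap K" and x: "x \<in> flags K" and d: "deg K k x = 2"
    and j: "j \<noteq> I0" "j \<noteq> k" "k \<noteq> I0"
  shows "hperm K j (hperm K I0 x) = hperm K I0 (hperm K j x)"
proof -
  have "has_period (rot K I0 j) x 2" using deg_period[OF K x, of I0 j k] j d by simp
  then have "(rot K I0 j ^^ 2) x = x" by (rule has_period_self)
  then have e: "hperm K j (hperm K I0 (hperm K j (hperm K I0 x))) = x" by (simp add: numeral_2_eq_2)
  let ?z = "hperm K j (hperm K I0 x)"
  have z: "?z \<in> flags K" using hperm_closed[OF K] x by blast
  have "hperm K I0 ?z = hperm K j x"
    using e hperm_hperm[OF K hperm_closed[OF K z], of j I0] by simp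
  then show ?thesis using hperm_hperm[OF K z, of I0] by simp
qed

lemma bip_data_deg:
  assumes B: "bip_data K c l1 l2 m n" and x: "x \<in> flags K"
  shows "deg K I0 x = (if c x then l2 else l1)" "deg K I1 x = m" "deg K I2 x = n"
  using assms by (simp_all add: bip_data_def)

text \<open>The following three lemmas treat the types in which two of \<open>l\<^sub>1\<close>, \<open>l\<^sub>2\<close>, \<open>m/2\<close>, \<open>n'/2\<close> are 1.
  Here \<open>R\<^sub>1\<close> and \<open>R\<^sub>2\<close> act alike on all flags.\<close>

lemma vertices_1_1:
  assumes B: "bip_data K c 1 1 m n" shows "m = n"
proof -
  have K: "is_hypermap K" using B by (simp add: bip_data_def)
  obtain x where x: "x \<in> flags K" using base_flag[OF K] by blast
  have e: "hperm K I1 z = hperm K I2 z" if "z \<in> flags K" for z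
    by (rule deg_1_eq[OF K that]) (simp add: bip_data_deg(1)[OF B that])
  have "(rot K I0 I2 ^^ q) x = (rot K I0 I1 ^^ q) x" for q
    by (induction q) (simp_all add: e hperm_closed[OF K] rot_closed[OF K x])
  moreover have "has_period (rot K I0 I2) x m" "has_period (rot K I0 I1) x n"
    using deg_period[OF K x, of I0 I2 I1] deg_period[OF K x, of I0 I1 I2] bip_data_deg[OF B x] by simp_all
  ultimately have "has_period (rot K I0 I1) x m" "has_period (rot K I0 I1) x n"
    unfolding has_period_def by auto
  then show ?thesis by (rule has_period_unique)
qed

text \<open>Here \<open>R\<^sub>0\<close> commutes with \<open>R\<^sub>1\<close> and \<open>R\<^sub>2\<close> and so carries the hypervertices of one colour
  to those of the other.\<close>

lemma edges_2_faces_2: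
  assumes B: "bip_data K c l1 l2 2 2" shows "l1 = l2"
proof -
  have K: "is_hypermap K" and "colour_regular K c" using B by (simp_all add: bip_data_def)
  then have col: "colouring K c" by (simp add: colour_regular_def)
  obtain x where x: "x \<in> flags K" "\<not> c x" using colour_flags(4)[OF K col] by blast
  let ?y = "hperm K I0 x"
  have y: "?y \<in> flags K" "c ?y" using x col hperm_closed[OF K] by (auto simp: colouring_def)
  have comm: "hperm K j (hperm K I0 z) = hperm K I0 (hperm K j z)" if z: "z \<in> flags K" and j: "j \<noteq> I0" for j z
  proof (cases j)
    case I0 then show ?thesis using j by simp
  next
    case I1 then show ?thesis using deg_2_commute[OF K z, of I2 I1] bip_data_deg[OF B z] by simp
  next
    case I2 then show ?thesis using deg_2_commute[OF K z, of I1 I2] bip_data_deg[OF B z] by simp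
  qed
  have "(rot K I1 I2 ^^ q) ?y = hperm K I0 ((rot K I1 I2 ^^ q) x)" for q
    by (induction q) (simp_all add: comm hperm_closed[OF K] rot_closed[OF K x(1)])
  then have "(rot K I1 I2 ^^ q) ?y = ?y \<longleftrightarrow> (rot K I1 I2 ^^ q) x = x" for q
    using hperm_inj[OF K rot_closed[OF K x(1)] x(1)] by simp
  moreover have "has_period (rot K I1 I2) x l1" "has_period (rot K I1 I2) ?y l2"
    using deg_period[OF K x(1), of I1 I2 I0] deg_period[OF K y(1), of I1 I2 I0]
      bip_data_deg[OF B x(1)] bip_data_deg[OF B y(1)] x y by simp_all
  ultimately have "has_period (rot K I1 I2) x l1" "has_period (rot K I1 I2) x l2"
    unfolding has_period_def by auto
  then show ?thesis by (rule has_period_unique)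
qed

text \<open>On the flags \<open>y\<close> of the second colour, \<open>(R\<^sub>0 R\<^sub>j)\<^sup>2\<close> acts as \<open>R\<^sub>i R\<^sub>j\<close>: the flag
  \<open>y R\<^sub>0\<close> has the first colour, so \<open>R\<^sub>j\<close> acts on it as \<open>R\<^sub>i\<close>, which commutes with \<open>R\<^sub>0\<close>.\<close>

lemma vertex_1_commute:
  assumes B: "bip_data K c 1 l2 m n" and ij: "i \<noteq> I0" "j \<noteq> I0" "i \<noteq> j"
    and di: "\<And>x. x \<in> flags K \<Longrightarrow> deg K j x = 2" and dj: "\<And>x. x \<in> flags K \<Longrightarrow> deg K i x = 2 * b"
  shows "b = l2"
proof -
  have K: "is_hypermap K" and "colour_regular K c" using B by (simp_all add: bip_data_def)
  then have col: "colouring K c" by (simp add: colour_regular_def)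
  obtain y where y: "y \<in> flags K" "c y" using colour_flags(3)[OF K col] by blast
  have e: "hperm K i z = hperm K j z" if z: "z \<in> flags K" "\<not> c z" for z
  proof -
    have "hperm K I1 z = hperm K I2 z"
      by (rule deg_1_eq[OF K z(1)]) (simp add: bip_data_deg(1)[OF B z(1)] z(2))
    then show ?thesis using ij by (cases i; cases j) simp_all
  qed
  have step: "rot K I0 j (rot K I0 j z) = rot K i j z" if z: "z \<in> flags K" "c z" for z
  proof -
    have z0: "hperm K I0 z \<in> flags K" "\<not> c (hperm K I0 z)"
      using z col hperm_closed[OF K] by (auto simp: colouring_def)
    have "hperm K j (hperm K I0 z) = hperm K i (hperm K I0 z)" using e[OF z0] by simp
    also have "\<dots> = hperm K I0 (hperm K i z)"
      using deg_2_commute[OF K z(1) di[OF z(1)], of i] ij by simp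
    finally show ?thesis by (simp add: hperm_hperm[OF K] hperm_closed[OF K] z(1))
  qed
  have cl: "c ((rot K i j ^^ q) y)" for q
  proof (induction q)
    case (Suc q)
    have "(rot K i j ^^ q) y \<in> flags K" by (rule rot_closed[OF K y(1)])
    then show ?case using Suc col ij hperm_closed[OF K] by (simp add: colouring_def)
  qed (simp add: y)
  have pow: "(rot K I0 j ^^ (2 * q)) y = (rot K i j ^^ q) y" for q
  proof (induction q)
    case (Suc q)
    have "(rot K I0 j ^^ (2 * Suc q)) y = rot K I0 j (rot K I0 j ((rot K I0 j ^^ (2 * q)) y))" by simp
    also have "\<dots> = rot K i j ((rot K i j ^^ q) y)"
      unfolding Suc by (rule step[OF rot_closed[OF K y(1)] cl])
    finally show ?case by simp
  qed simp
  have p: "has_period (rot K I0 j) y (2 * b)"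
    using deg_period[OF K y(1), of I0 j i] ij dj[OF y(1)] by simp
  have "has_period (rot K i j) y b"
    unfolding has_period_def
  proof (intro conjI allI)
    show "0 < b" using p by (simp add: has_period_def)
    fix q
    have "(rot K i j ^^ q) y = y \<longleftrightarrow> 2 * b dvd 2 * q"
      using p unfolding pow[symmetric] has_period_def by blast
    then show "(rot K i j ^^ q) y = y \<longleftrightarrow> b dvd q" by simp
  qed
  moreover have "has_period (rot K i j) y l2"
    using deg_period[OF K y(1), of i j I0] ij bip_data_deg(1)[OF B y(1)] y(2) by simp
  ultimately show ?thesis by (rule has_period_unique)
qed

definition listed :: "nat \<times> nat \<times> nat \<times> nat \<Rightarrow> bool" where
  "listed t \<longleftrightarrow> (\<exists>n\<ge>1. t \<in> fst ` set (classification n))"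

lemma listed_rows:
  assumes "1 \<le> n"
  shows "listed (1, 1, 2 * n, 2 * n)" "listed (1, 2, 4, 2 * n)" "listed (1, 2, 6, 6)" "listed (1, 2, 6, 8)"
    "listed (1, 2, 6, 10)" "listed (1, 3, 4, 6)" "listed (1, 3, 4, 8)" "listed (1, 3, 4, 10)"
    "listed (1, 4, 4, 6)" "listed (1, 5, 4, 6)" "listed (1, n, 2, 2 * n)" "listed (1, n, 4, 4)"
    "listed (2, 2, 2, 2 * n)" "listed (2, 3, 2, 6)" "listed (2, 3, 2, 8)" "listed (2, 3, 2, 10)"
    "listed (2, 4, 2, 6)" "listed (2, 5, 2, 6)" "listed (2, n, 2, 4)" "listed (3, 3, 2, 4)"
    "listed (3, 4, 2, 4)" "listed (3, 5, 2, 4)" "listed (n, n, 2, 2)"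
  unfolding listed_def using assms
  by (intro exI[of _ n]; simp add: classification_def)+

text \<open>Exchanging the two colours and duality with respect to \<open>(1 2)\<close> act on the types, with \<open>a\<close> and
  \<open>b\<close> half the valencies of the hyperedges and hyperfaces.\<close>

definition sym_listed :: "nat \<Rightarrow> nat \<Rightarrow> nat \<Rightarrow> nat \<Rightarrow> bool" where
  "sym_listed l1 l2 a b \<longleftrightarrow> listed (l1, l2, 2 * a, 2 * b) \<or> listed (l2, l1, 2 * a, 2 * b) \<or>
     listed (l1, l2, 2 * b, 2 * a) \<or> listed (l2, l1, 2 * b, 2 * a)"

lemma sym_listed_sym: "sym_listed l1 l2 a b \<longleftrightarrow> sym_listed l2 l1 a b" "sym_listed l1 l2 a b \<longleftrightarrow> sym_listed l1 l2 b a"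
  unfolding sym_listed_def by blast+

text \<open>The inequality says \<open>(u - 2) (v - 2) < 4\<close>.\<close>

lemma pair_bound:
  fixes u v :: nat
  assumes "3 \<le> u" "3 \<le> v" "u * v < 2 * u + 2 * v"
  shows "(u, v) \<in> {(3, 3), (3, 4), (4, 3), (3, 5), (5, 3)}"
proof -
  obtain p q where pq: "u = p + 3" "v = q + 3" using assms by (metis add.commute le_Suc_ex)
  have lt: "p * q + p + q < 3" using assms(3) by (simp add: pq algebra_simps)
  then have "p < 3" "q < 3" by linarith+
  then have "p \<in> {0, 1, 2}" "q \<in> {0, 1, 2}" by auto
  then show ?thesis using lt by (auto simp: pq)
qed

text \<open>The periods of the spherical triangle groups: three numbers that are at least 3 have
  reciprocals of sum at most 1, and if one number is 2 then \<open>pair_bound\<close> applies to the others.\<close>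

lemma spherical_triple:
  fixes x y z :: nat
  assumes pos: "2 \<le> x" "2 \<le> y" "2 \<le> z" and gt: "1 / real x + 1 / real y + 1 / real z > 1"
  shows "x = 2 \<and> y = 2 \<or> x = 2 \<and> z = 2 \<or> y = 2 \<and> z = 2 \<or>
    x = 2 \<and> (y, z) \<in> {(3, 3), (3, 4), (4, 3), (3, 5), (5, 3)} \<or>
    y = 2 \<and> (x, z) \<in> {(3, 3), (3, 4), (4, 3), (3, 5), (5, 3)} \<or>
    z = 2 \<and> (x, y) \<in> {(3, 3), (3, 4), (4, 3), (3, 5), (5, 3)}"
proof -
  have "real x * real y * real z < real x * real y * real z * (1 / real x + 1 / real y + 1 / real z)"
    using gt pos by simp
  also have "\<dots> = real y * real z + real x * real z + real x * real y"
    using pos by (simp add: field_simps)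
  finally have "real (x * y * z) < real (y * z + x * z + x * y)" by simp
  then have lt: "x * y * z < y * z + x * z + x * y" by (simp only: of_nat_less_iff)
  consider "x = 2" | "y = 2" | "z = 2" | "3 \<le> x" "3 \<le> y" "3 \<le> z" using pos by linarith
  then show ?thesis
  proof cases
    case 1
    then have "y * z < 2 * y + 2 * z" using lt by simp
    then show ?thesis using 1 pair_bound[of y z] pos by linarith
  next
    case 2
    then have "x * z < 2 * x + 2 * z" using lt by simp
    then show ?thesis using 2 pair_bound[of x z] pos by linarith
  next
    case 3
    then have "x * y < 2 * x + 2 * y" using lt by simp
    then show ?thesis using 3 pair_bound[of x y] pos by linarith
  next
    case 4
    have "3 * (y * z) \<le> x * y * z" using mult_le_mono1[OF 4(1), of "y * z"] by (simp only: mult.assoc)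
    moreover have "3 * (x * z) \<le> x * y * z"
      using mult_le_mono1[OF 4(2), of "x * z"] by (simp only: mult.assoc mult.left_commute)
    moreover have "3 * (x * y) \<le> x * y * z"
      using mult_le_mono2[OF 4(3), of "x * y"] by (simp only: mult.commute)
    ultimately show ?thesis using lt by linarith
  qed
qed

lemma sym_listed_edge_2:
  assumes pos: "0 < l1" "0 < l2" "0 < b" and gt: "1 / real l1 + 1 / real l2 + 1 / real b > 1"
    and one: "l1 = 1 \<Longrightarrow> b = l2" "l2 = 1 \<Longrightarrow> b = l1" "b = 1 \<Longrightarrow> l1 = l2"
  shows "sym_listed l1 l2 1 b"
proof (cases "l1 = 1 \<or> l2 = 1 \<or> b = 1")
  case True
  then show ?thesis
    using one listed_rows(11)[of l1] listed_rows(11)[of l2] listed_rows(23)[of l1] pos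
    by (auto simp: sym_listed_def Suc_le_eq)
next
  case False
  then have "2 \<le> l1" "2 \<le> l2" "2 \<le> b" using pos by linarith+
  from spherical_triple[OF this gt] show ?thesis
    unfolding sym_listed_def
    by (elim disjE insertE emptyE conjE)
      (use pos listed_rows(13)[of b] listed_rows(19)[of l1] listed_rows(19)[of l2]
        listed_rows(14-18,20-22)[OF order.refl] in simp_all)
qed

lemma sym_listed_vertex_1:
  assumes pos: "0 < l2" "2 \<le> a" "2 \<le> b" and gt: "1 / real l2 + 1 / real a + 1 / real b > 1"
    and one: "l2 = 1 \<Longrightarrow> a = b"
  shows "sym_listed 1 l2 a b"
proof (cases "l2 = 1")
  case True
  then show ?thesis using one listed_rows(1)[of a] pos by (simp add: sym_listed_def)
next
  case False
  then have "2 \<le> l2" using pos by linarith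
  from spherical_triple[OF this pos(2,3) gt] show ?thesis
    unfolding sym_listed_def
    by (elim disjE insertE emptyE conjE)
      (use pos listed_rows(2)[of a] listed_rows(2)[of b] listed_rows(12)[of l2]
        listed_rows(3-10)[OF order.refl] in simp_all)
qed

lemma sym_listed_types:
  assumes pos: "0 < l1" "0 < l2" "0 < a" "0 < b"
    and gt: "1 / real l1 + 1 / real l2 + 1 / real a + 1 / real b > 2"
    and one: "l1 = 1 \<Longrightarrow> l2 = 1 \<Longrightarrow> a = b" "a = 1 \<Longrightarrow> b = 1 \<Longrightarrow> l1 = l2"
      "l1 = 1 \<Longrightarrow> a = 1 \<Longrightarrow> b = l2" "l1 = 1 \<Longrightarrow> b = 1 \<Longrightarrow> a = l2"
      "l2 = 1 \<Longrightarrow> a = 1 \<Longrightarrow> b = l1" "l2 = 1 \<Longrightarrow> b = 1 \<Longrightarrow> a = l1"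
  shows "sym_listed l1 l2 a b"
proof -
  consider "a = 1" | "b = 1" | "l1 = 1" "2 \<le> a" "2 \<le> b" | "l2 = 1" "2 \<le> a" "2 \<le> b"
    | "2 \<le> l1" "2 \<le> l2" "2 \<le> a" "2 \<le> b"
  proof -
    have "k = 1 \<or> 2 \<le> k" if "0 < k" for k :: nat using that by linarith
    from this[OF pos(1)] this[OF pos(2)] this[OF pos(3)] this[OF pos(4)] show ?thesis
      using that by blast
  qed
  then show ?thesis
  proof cases
    case 1
    have "sym_listed l1 l2 1 b"
      by (rule sym_listed_edge_2) (fact pos | rule one; (fact | simp add: 1) | use gt 1 in simp)+
    then show ?thesis using 1 by simp
  next
    case 2
    have "sym_listed l1 l2 1 a"
      by (rule sym_listed_edge_2) (fact pos | rule one; (fact | simp add: 2) | use gt 2 in simp)+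
    then show ?thesis using 2 sym_listed_sym(2) by blast
  next
    case 3
    have "sym_listed 1 l2 a b"
      by (rule sym_listed_vertex_1) (fact pos 3 | rule one; (fact | simp add: 3) | use gt 3 in simp)+
    then show ?thesis using 3 by simp
  next
    case 4
    have "sym_listed 1 l1 a b"
      by (rule sym_listed_vertex_1) (fact pos 4 | rule one; (fact | simp add: 4) | use gt 4 in simp)+
    then show ?thesis using 4 sym_listed_sym(1) by blast
  next
    case 5
    have "1 / real k \<le> 1 / 2" if "2 \<le> k" for k :: nat
      using that by (intro divide_left_mono) auto
    then have "1 / real l1 \<le> 1 / 2" "1 / real l2 \<le> 1 / 2" "1 / real a \<le> 1 / 2" "1 / real b \<le> 1 / 2"
      using 5 by blast+
    then have "1 / real l1 + 1 / real l2 + 1 / real a + 1 / real b \<le> 1 / 2 + 1 / 2 + 1 / 2 + 1 / 2"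
      by (intro add_mono)
    then show ?thesis using gt by simp
  qed
qed

lemma bip_data_listed:
  assumes B: "bip_data K c l1 l2 (2 * a) (2 * b)" and sph: "spherical K"
  shows "sym_listed l1 l2 a b"
proof (rule sym_listed_types)
  have K: "is_hypermap K" and "colour_regular K c" using B by (simp_all add: bip_data_def)
  then have col: "colouring K c" by (simp add: colour_regular_def)
  note B' = bip_data_swap[OF B]
  obtain x where x: "x \<in> flags K" "\<not> c x" using colour_flags(4)[OF K col] by blast
  obtain y where y: "y \<in> flags K" "c y" using colour_flags(3)[OF K col] by blast
  show "0 < l1" "0 < l2" "0 < a" "0 < b"
    using deg_pos[OF K x(1), of I0] deg_pos[OF K y(1), of I0] deg_pos[OF K x(1), of I1]
      deg_pos[OF K x(1), of I2] bip_data_deg[OF B x(1)] bip_data_deg[OF B y(1)] x(2) y(2) by simp_all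
  define r where "r = 1 / real l1 + 1 / real l2 + 1 / real a + 1 / real b - 2"
  have "real (card (flags K)) * r / 4 = 2"
    using euler_bip[OF B] sph unfolding spherical_iff r_def by simp
  then have "0 < real (card (flags K)) * r" by simp
  then have "0 < r" by (simp add: zero_less_mult_iff)
  then show "1 / real l1 + 1 / real l2 + 1 / real a + 1 / real b > 2" by (simp add: r_def)
  show "a = b" if "l1 = 1" "l2 = 1" using vertices_1_1[of K c "2 * a" "2 * b"] B that by simp
  show "l1 = l2" if "a = 1" "b = 1" using edges_2_faces_2[of K c l1 l2] B that by simp
  show "b = l2" if "l1 = 1" "a = 1"
    using vertex_1_commute[of K c l2 "2 * a" "2 * b" I2 I1 b] B that bip_data_deg[OF B] by simp
  show "a = l2" if "l1 = 1" "b = 1"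
    using vertex_1_commute[of K c l2 "2 * a" "2 * b" I1 I2 a] B that bip_data_deg[OF B] by simp
  show "b = l1" if "l2 = 1" "a = 1"
    using vertex_1_commute[of K "\<lambda>x. \<not> c x" l1 "2 * a" "2 * b" I2 I1 b] B' that bip_data_deg[OF B] by simp
  show "a = l1" if "l2 = 1" "b = 1"
    using vertex_1_commute[of K "\<lambda>x. \<not> c x" l1 "2 * a" "2 * b" I1 I2 a] B' that bip_data_deg[OF B] by simp
qed

section \<open>Existence of the uniform spherical hypermaps\<close>

text \<open>Oriented maps: \<open>X\<close> is the set of darts, \<open>r\<close> turns a dart around its hyperface and \<open>a\<close> around
  its hyperedge, with inverses \<open>r'\<close> and \<open>a'\<close>.  Every dart carries a flag on either side.\<close>

definition oriented :: "'d set \<Rightarrow> ('d \<Rightarrow> 'd) \<Rightarrow> ('d \<Rightarrow> 'd) \<Rightarrow> ('d \<Rightarrow> 'd) \<Rightarrow> ('d \<Rightarrow> 'd) \<Rightarrow> ('d \<times> bool) hypermap" where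
  "oriented X r r' a a' = \<lparr>flags = X \<times> UNIV, hperm = (\<lambda>i (d, p).
     (case i of I0 \<Rightarrow> d | I1 \<Rightarrow> if p then r' d else r d | I2 \<Rightarrow> if p then a' d else a d, \<not> p))\<rparr>"

locale oriented_data =
  fixes X :: "'d set" and r r' a a' :: "'d \<Rightarrow> 'd" and d0 :: 'd and l m n :: nat
  assumes fin: "finite X" and d0: "d0 \<in> X"
    and closed: "\<And>d. d \<in> X \<Longrightarrow> r d \<in> X \<and> r' d \<in> X \<and> a d \<in> X \<and> a' d \<in> X"
    and inverse: "\<And>d. d \<in> X \<Longrightarrow> r' (r d) = d \<and> r (r' d) = d \<and> a' (a d) = d \<and> a (a' d) = d"
    and reach: "\<And>S. d0 \<in> S \<Longrightarrow> (\<And>d. d \<in> X \<Longrightarrow> d \<in> S \<Longrightarrow> r d \<in> S \<and> a d \<in> S) \<Longrightarrow> X \<subseteq> S"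
    and vertex: "\<And>d. d \<in> X \<Longrightarrow> has_period (\<lambda>d. a' (r d)) d l"
    and edge: "\<And>d. d \<in> X \<Longrightarrow> has_period a d m"
    and face: "\<And>d. d \<in> X \<Longrightarrow> has_period r d n"
begin

abbreviation M where "M \<equiv> oriented X r r' a a'"

lemma flags_M: "(d, p) \<in> flags M \<longleftrightarrow> d \<in> X"
  by (simp add: oriented_def)

lemma hperm_M: "hperm M I0 (d, p) = (d, \<not> p)" "hperm M I1 (d, p) = (if p then r' d else r d, \<not> p)"
  "hperm M I2 (d, p) = (if p then a' d else a d, \<not> p)"
  by (simp_all add: oriented_def)

lemma hperm_M_closed: "z \<in> flags M \<Longrightarrow> hperm M i z \<in> flags M \<and> hperm M i (hperm M i z) = z \<and> hperm M i z \<noteq> z"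
  by (cases z; cases i) (simp_all add: flags_M hperm_M closed inverse)

lemma is_hypermap_M: "is_hypermap M"
proof (rule is_hypermapI)
  show "finite (flags M)" "flags M \<noteq> {}" using fin d0 by (auto simp: oriented_def)
  show "hperm M i z \<in> flags M" "hperm M i z \<noteq> z" "hperm M i (hperm M i z) = z" if "z \<in> flags M" for i z
    using hperm_M_closed that by blast+
  have walk: "walk M w z \<in> flags M \<and> walk M (rev w) (walk M w z) = z" if "z \<in> flags M" for w z
    using that by (induction w arbitrary: z) (simp_all add: hperm_M_closed)
  let ?b = "(d0, False)"
  let ?S = "{d. \<exists>w. walk M w ?b = (d, False)}"
  have "X \<subseteq> ?S"
  proof (rule reach)
    have "walk M [] ?b = ?b" by simp
    then show "d0 \<in> ?S" by blast
    fix d assume "d \<in> ?S"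
    then obtain w where w: "walk M w ?b = (d, False)" by blast
    have "walk M (w @ [I1, I0]) ?b = (r d, False)" "walk M (w @ [I2, I0]) ?b = (a d, False)"
      by (simp_all add: w hperm_M)
    then show "r d \<in> ?S \<and> a d \<in> ?S" by blast
  qed
  then have base: "\<exists>w. walk M w ?b = (d, p)" if "d \<in> X" for d p
  proof -
    from that \<open>X \<subseteq> ?S\<close> obtain w where "walk M w ?b = (d, False)" by blast
    then have "walk M (w @ (if p then [I0] else [])) ?b = (d, p)" by (simp add: hperm_M)
    then show ?thesis by blast
  qed
  fix z z' assume "z \<in> flags M" "z' \<in> flags M"
  then obtain w w' where w: "walk M w ?b = z" "walk M w' ?b = z'"
    using base flags_M by (metis surj_pair)
  have "walk M (rev w @ w') z = z'"
    using walk[of ?b w] d0 flags_M w by simp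
  then show "\<exists>w. walk M w z = z'" by blast
qed

lemma deg_M:
  assumes z: "z \<in> flags M"
  shows "deg M I0 z = l \<and> deg M I1 z = m \<and> deg M I2 z = n"
proof -
  have F: "deg M I0 (d, False) = l \<and> deg M I1 (d, False) = m \<and> deg M I2 (d, False) = n" if d: "d \<in> X" for d
  proof (intro conjI)
    have fl: "(d, False) \<in> flags M" using d by (simp add: flags_M)
    have "(rot M I1 I2 ^^ q) (d, False) = (((\<lambda>d. a' (r d)) ^^ q) d, False)" for q
      by (induction q) (simp_all add: hperm_M)
    then have "has_period (rot M I1 I2) (d, False) l"
      using vertex[OF d] by (simp add: has_period_def)
    then show "deg M I0 (d, False) = l" by (rule deg_eqI[OF is_hypermap_M fl, rotated 3]) simp_all
    have "(rot M I2 I0 ^^ q) (d, False) = ((a ^^ q) d, False)" for q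
      by (induction q) (simp_all add: hperm_M)
    then have "has_period (rot M I2 I0) (d, False) m"
      using edge[OF d] by (simp add: has_period_def)
    then show "deg M I1 (d, False) = m" by (rule deg_eqI[OF is_hypermap_M fl, rotated 3]) simp_all
    have "(rot M I1 I0 ^^ q) (d, False) = ((r ^^ q) d, False)" for q
      by (induction q) (simp_all add: hperm_M)
    then have "has_period (rot M I1 I0) (d, False) n"
      using face[OF d] by (simp add: has_period_def)
    then show "deg M I2 (d, False) = n" by (rule deg_eqI[OF is_hypermap_M fl, rotated 3]) simp_all
  qed
  obtain d p where dp: "z = (d, p)" by (cases z)
  then have d: "d \<in> X" using z flags_M by simp
  show ?thesis
  proof (cases p)
    case False
    then show ?thesis using F[OF d] dp by simp
  next
    case True
    have "deg M k (d, True) = deg M k (d, False)" if "k \<noteq> I0" for k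
      using deg_hperm[OF is_hypermap_M, of "(d, False)" I0 k] that d by (simp add: flags_M hperm_M)
    moreover have "deg M I0 (d, True) = deg M I0 (r' d, False)"
      using deg_hperm[OF is_hypermap_M, of "(d, True)" I1 I0] d by (simp add: flags_M hperm_M)
    moreover have "r' d \<in> X" using closed[OF d] by blast
    ultimately show ?thesis using F[OF d] F[of "r' d"] dp True by simp
  qed
qed

lemma card_M: "card (flags M) = 2 * card X"
  by (simp add: oriented_def card_cartesian_product UNIV_bool)

lemma uniform_spherical_M:
  assumes "real (card X) * (1 / real l + 1 / real m + 1 / real n - 1) = 2"
  shows "uniform_spherical M l m n (2 * card X)"
  by (rule uniform_sphericalI[OF is_hypermap_M card_M]) (use deg_M assms in auto)

text \<open>It suffices to bound the number of darts from below, because Euler's inequality bounds it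
  from above.\<close>

lemma uniform_spherical_M_bound:
  assumes "real N * (1 / real l + 1 / real m + 1 / real n - 1) = 2" and N: "N \<le> card X"
  shows "uniform_spherical M l m n (2 * N)"
proof -
  define s where "s = 1 / real l + 1 / real m + 1 / real n - 1"
  have s: "real N * s = 2" using assms(1) by (simp add: s_def)
  have "0 < real N * s" using s by simp
  then have s0: "0 < s" by (simp add: zero_less_mult_iff)
  have "euler M = real (card (flags M)) * (s / 2)"
    unfolding s_def by (rule euler_uniform[OF is_hypermap_M]) (use deg_M in blast)
  then have "real (card X) * s \<le> real N * s"
    using euler_le_2[OF is_hypermap_M] s by (simp add: card_M)
  then have "card X = N" using s0 N by simp
  then show ?thesis using uniform_spherical_M s by (simp add: s_def)
qed

end

subsection \<open>The families\<close>

lemma shift_funpow: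
  assumes "k \<in> {0..<int n}"
  shows "((\<lambda>k. (k + s) mod int n) ^^ q) k = (k + s * int q) mod int n"
proof (induction q)
  case (Suc q)
  then have "((\<lambda>k. (k + s) mod int n) ^^ Suc q) k = ((k + s * int q) mod int n + s) mod int n" by simp
  also have "\<dots> = (k + s * int q + s) mod int n" by (rule mod_add_left_eq)
  also have "k + s * int q + s = k + s * int (Suc q)" by (simp add: algebra_simps)
  finally show ?case .
qed (use assms in simp)

lemma shift_period:
  assumes k: "k \<in> {0..<int n}" and s: "s = 1 \<or> s = - 1"
  shows "has_period (\<lambda>k. (k + s) mod int n) k n"
proof -
  have "(k + s * int q) mod int n = k \<longleftrightarrow> n dvd q" for q
  proof -
    have "(k + s * int q) mod int n = k \<longleftrightarrow> (k + s * int q) mod int n = k mod int n" using k by simp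
    also have "\<dots> \<longleftrightarrow> int n dvd s * int q" by (simp add: mod_eq_dvd_iff)
    also have "\<dots> \<longleftrightarrow> n dvd q" using s by auto
    finally show ?thesis .
  qed
  then show ?thesis using k by (simp add: has_period_def shift_funpow[OF k])
qed

lemma shift_induct:
  assumes "0 \<in> S" "\<And>k. k \<in> {0..<int n} \<Longrightarrow> k \<in> S \<Longrightarrow> (k + 1) mod int n \<in> S"
  shows "{0..<int n} \<subseteq> S"
proof -
  have "int j < int n \<longrightarrow> int j \<in> S" for j
  proof (induction j)
    case (Suc j)
    show ?case
    proof
      assume lt: "int (Suc j) < int n"
      then have "(int j + 1) mod int n \<in> S" using Suc assms(2)[of "int j"] by simp
      then show "int (Suc j) \<in> S" using lt by (simp add: add.commute)
    qed
  qed (use assms in simp)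
  then show ?thesis by (metis atLeastLessThan_iff nonneg_int_cases subsetI)
qed

lemma uniform_spherical_dihedral:
  assumes n: "1 \<le> n" shows "uniform_spherical (dihedral_D n) n n 1 (2 * n)"
proof -
  let ?X = "{0..<int n}" and ?a = "\<lambda>k. (k + 1) mod int n" and ?a' = "\<lambda>k. (k + - 1) mod int n"
  interpret oriented_data ?X "\<lambda>k. k" "\<lambda>k. k" ?a ?a' 0 n n 1
  proof
    show "finite ?X" "0 \<in> ?X" using n by auto
    show "d \<in> ?X \<and> d \<in> ?X \<and> ?a d \<in> ?X \<and> ?a' d \<in> ?X" if "d \<in> ?X" for d
      using that n by simp
    show "d = d \<and> d = d \<and> ?a' (?a d) = d \<and> ?a (?a' d) = d" if "d \<in> ?X" for d
      using that by (simp add: mod_simps)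
    show "?X \<subseteq> S" if "0 \<in> S" "\<And>d. d \<in> ?X \<Longrightarrow> d \<in> S \<Longrightarrow> d \<in> S \<and> ?a d \<in> S" for S
      using shift_induct[of S n] that by blast
    show "has_period ?a' d n" "has_period ?a d n" if "d \<in> ?X" for d
      using shift_period[OF that, of "- 1"] shift_period[OF that, of 1] by simp_all
    show "has_period (\<lambda>k. k) d 1" for d :: int
    proof -
      have "((\<lambda>k. k) ^^ q) d = d" for q by (induction q) simp_all
      then show ?thesis by (simp add: has_period_def)
    qed
  qed
  have "uniform_spherical M n n 1 (2 * card ?X)"
    by (rule uniform_spherical_M) (use n in \<open>simp add: field_simps\<close>)
  then show ?thesis using uniform_spherical_uniform_sphere by simp
qed

lemma uniform_spherical_prism:
  assumes n: "1 \<le> n" shows "uniform_spherical (prism_P n) 2 2 n (4 * n)"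
proof -
  let ?X = "{0..<int n} \<times> (UNIV :: bool set)" and ?a = "\<lambda>(k, b). (k, \<not> b)"
  let ?s = "\<lambda>s k. (k + s) mod int n"
  let ?r = "\<lambda>(k, b). (?s (if b then 1 else - 1) k, b)" and ?r' = "\<lambda>(k, b). (?s (if b then - 1 else 1) k, b)"
  interpret oriented_data ?X ?r ?r' ?a ?a "(0, True)" 2 2 n
  proof
    show "finite ?X" "(0, True) \<in> ?X" using n by auto
    fix z assume z: "z \<in> ?X"
    then obtain k b where kb: "z = (k, b)" "k \<in> {0..<int n}" by auto
    show "?r z \<in> ?X \<and> ?r' z \<in> ?X \<and> ?a z \<in> ?X \<and> ?a z \<in> ?X"
      using kb n by simp
    show "?r' (?r z) = z \<and> ?r (?r' z) = z \<and> ?a (?a z) = z \<and> ?a (?a z) = z"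
      using kb by (simp add: mod_simps)
    show "has_period (\<lambda>z. ?a (?r z)) z 2"
      by (rule has_periodI) (use kb in \<open>auto simp: numeral_2_eq_2 less_Suc_eq mod_simps\<close>)
    show "has_period ?a z 2"
      by (rule has_periodI) (use kb in \<open>auto simp: numeral_2_eq_2 less_Suc_eq\<close>)
    show "has_period ?r z n"
    proof -
      have "(?r ^^ q) (k, b) = ((?s (if b then 1 else - 1) ^^ q) k, b)" for q
        by (induction q) simp_all
      moreover have "has_period (?s (if b then 1 else - 1)) k n"
        by (rule shift_period[OF kb(2)]) simp
      ultimately show ?thesis by (simp add: has_period_def kb(1))
    qed
  next
    fix S assume S: "(0 :: int, True) \<in> S" and cl: "\<And>z. z \<in> ?X \<Longrightarrow> z \<in> S \<Longrightarrow> ?r z \<in> S \<and> ?a z \<in> S"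
    have "{0..<int n} \<subseteq> {k. (k, True) \<in> S}"
      by (rule shift_induct) (use S cl in force)+
    then show "?X \<subseteq> S"
    proof (intro subsetI)
      fix z assume "z \<in> ?X"
      then obtain k b where kb: "z = (k, b)" "k \<in> {0..<int n}" by auto
      then have T: "(k, True) \<in> S" using \<open>{0..<int n} \<subseteq> {k. (k, True) \<in> S}\<close> by blast
      then have "(k, False) \<in> S" using cl[of "(k, True)"] kb by simp
      then show "z \<in> S" using T kb by (cases b) simp_all
    qed
  qed
  have "uniform_spherical M 2 2 n (2 * card ?X)"
    by (rule uniform_spherical_M) (use n in \<open>simp add: card_cartesian_product UNIV_bool field_simps\<close>)
  moreover have "2 * card ?X = 4 * n" by (simp add: card_cartesian_product UNIV_bool)
  ultimately show ?thesis using uniform_spherical_uniform_sphere by simp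
qed

subsection \<open>Tetrahedron, cube and dodecahedron\<close>

inductive_set orbit2 :: "('d \<Rightarrow> 'd) \<Rightarrow> ('d \<Rightarrow> 'd) \<Rightarrow> 'd \<Rightarrow> 'd set" for r a d0 where
  base: "d0 \<in> orbit2 r a d0"
| rI: "d \<in> orbit2 r a d0 \<Longrightarrow> r d \<in> orbit2 r a d0"
| aI: "d \<in> orbit2 r a d0 \<Longrightarrow> a d \<in> orbit2 r a d0"

lemma orbit2_funpow: "d \<in> orbit2 r a d0 \<Longrightarrow> (r ^^ i) d \<in> orbit2 r a d0"
  by (induction i) (auto intro: orbit2.rI)

text \<open>In the applications the darts are tuples with distinct entries, on which \<open>r\<close> and \<open>a\<close> permute
  the places.  Such permutations other than the identity move every tuple, so the periods are the
  orders of the permutations, and \<open>r\<close> and \<open>a\<close> only have to generate a group of the right size.  That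
  it is not too small follows from a list \<open>ds\<close> of representatives of the \<open>r\<close>-orbits.\<close>

lemma uniform_spherical_orbit2:
  fixes b :: 'd
  assumes P: "P b" "\<And>d. P d \<Longrightarrow> P (r d) \<and> P (a d)" and fin: "finite {d. P d}"
    and per: "\<And>d. P d \<Longrightarrow> has_period (\<lambda>d. a (r d)) d l \<and> has_period a d 2 \<and> has_period r d n"
    and faces: "list_all (\<lambda>d. d \<in> orbit2 r a b) ds"
    and dist: "distinct (concat (map (\<lambda>d. map (\<lambda>i. (r ^^ i) d) [0..<n]) ds))"
    and N: "real (length ds * n) * (1 / real l + 1 / 2 + 1 / real n - 1) = 2"
  shows "uniform_spherical (uniform_sphere l 2 n) l 2 n (2 * (length ds * n))"
proof -
  let ?X = "orbit2 r a b" and ?r' = "r ^^ (n - 1)"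
  have X: "P d" if "d \<in> ?X" for d
    using that by induction (use P in auto)
  have finX: "finite ?X" by (rule finite_subset[OF _ fin]) (use X in blast)
  interpret oriented_data ?X r ?r' a a b l 2 n
  proof
    fix d assume d: "d \<in> ?X"
    note p = per[OF X[OF d]]
    show "r d \<in> ?X \<and> ?r' d \<in> ?X \<and> a d \<in> ?X \<and> a d \<in> ?X"
      using orbit2_funpow[OF d, of "n - 1"] orbit2.rI[OF d] orbit2.aI[OF d] by simp
    have n: "0 < n" using p by (simp add: has_period_def)
    have rn: "(r ^^ n) d = d" and a2: "(a ^^ 2) d = d"
      using p has_period_self[of r d n] has_period_self[of a d 2] by simp_all
    have "r (?r' d) = (r ^^ Suc (n - 1)) d" by simp
    then have "r (?r' d) = d" using n rn by simp
    moreover have "?r' (r d) = r (?r' d)" by (rule funpow_swap1[symmetric])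
    moreover have "a (a d) = d" using a2 by (simp add: numeral_2_eq_2)
    ultimately show "?r' (r d) = d \<and> r (?r' d) = d \<and> a (a d) = d \<and> a (a d) = d" by simp
    show "has_period (\<lambda>d. a (r d)) d l" "has_period a d 2" "has_period r d n" using p by blast+
  next
    fix S assume S: "b \<in> S" "\<And>d. d \<in> ?X \<Longrightarrow> d \<in> S \<Longrightarrow> r d \<in> S \<and> a d \<in> S"
    show "?X \<subseteq> S"
    proof
      fix d assume "d \<in> ?X" then show "d \<in> S" by induction (use S in auto)
    qed
  qed (use finX orbit2.base in auto)
  let ?L = "concat (map (\<lambda>d. map (\<lambda>i. (r ^^ i) d) [0..<n]) ds)"
  have "set ?L \<subseteq> ?X" using faces by (auto simp: list_all_iff intro: orbit2_funpow)
  then have "card (set ?L) \<le> card ?X" by (rule card_mono[OF finX])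
  moreover have "card (set ?L) = length ds * n"
    unfolding distinct_card[OF dist] by (simp add: length_concat o_def sum_list_triv)
  ultimately have "uniform_spherical M l 2 n (2 * (length ds * n))"
    using N by (intro uniform_spherical_M_bound) simp_all
  then show ?thesis by (rule uniform_spherical_uniform_sphere)
qed

lemma small_exponents: "0 < (q::nat) \<Longrightarrow> q < 2 \<Longrightarrow> q = 1" "0 < q \<Longrightarrow> q < 3 \<Longrightarrow> q = 1 \<or> q = 2"
  "0 < q \<Longrightarrow> q < 4 \<Longrightarrow> q = 1 \<or> q = 2 \<or> q = 3" "0 < q \<Longrightarrow> q < 5 \<Longrightarrow> q = 1 \<or> q = 2 \<or> q = 3 \<or> q = 4"
  by linarith+

text \<open>The 3-cycle \<open>r\<close> and the double transposition \<open>a\<close> generate \<open>A\<^sub>4\<close>, and their product is a 3-cycle.\<close>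

lemma uniform_spherical_tetrahedron: "uniform_spherical tetrahedron 3 2 3 24"
proof -
  define r :: "nat \<times> nat \<times> nat \<times> nat \<Rightarrow> nat \<times> nat \<times> nat \<times> nat"
    where "r = (\<lambda>(x1, x2, x3, x4). (x2, x3, x1, x4))"
  define a :: "nat \<times> nat \<times> nat \<times> nat \<Rightarrow> nat \<times> nat \<times> nat \<times> nat"
    where "a = (\<lambda>(x1, x2, x3, x4). (x2, x1, x4, x3))"
  define P :: "nat \<times> nat \<times> nat \<times> nat \<Rightarrow> bool"
    where "P = (\<lambda>(x1, x2, x3, x4). distinct [x1, x2, x3, x4] \<and> set [x1, x2, x3, x4] \<subseteq> {..<4})"
  let ?ds = "[(0, 1, 2, 3), (0, 3, 1, 2), (1, 3, 2, 0), (0, 2, 3, 1)]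
      :: (nat \<times> nat \<times> nat \<times> nat) list"
  have step: "(r ^^ j) (a ((r ^^ i) d)) \<in> orbit2 r a d0" if "d \<in> orbit2 r a d0" for i j d d0
    using that by (intro orbit2_funpow orbit2.aI)
  have d0: "(0, 1, 2, 3) \<in> orbit2 r a (0, 1, 2, 3)" by (rule orbit2.base)
  have d1: "(0, 3, 1, 2) \<in> orbit2 r a (0, 1, 2, 3)"
    using step[OF d0, of 1 0] by (simp add: r_def a_def numeral_eq_Suc)
  have d2: "(1, 3, 2, 0) \<in> orbit2 r a (0, 1, 2, 3)"
    using step[OF d0, of 1 1] by (simp add: r_def a_def numeral_eq_Suc)
  have d3: "(0, 2, 3, 1) \<in> orbit2 r a (0, 1, 2, 3)"
    using step[OF d0, of 0 2] by (simp add: r_def a_def numeral_eq_Suc)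
  have "uniform_spherical (uniform_sphere 3 2 3) 3 2 3 (2 * (length ?ds * 3))"
  proof (rule uniform_spherical_orbit2[where P = P and r = r and a = a and b = "(0, 1, 2, 3)"])
    show "P (0, 1, 2, 3)" by (simp add: P_def)
    show "P (r d) \<and> P (a d)" if "P d" for d
      using that by (auto simp: P_def r_def a_def)
    show "finite {d. P d}"
      by (rule finite_subset[of _ "{..<4} \<times> {..<4} \<times> {..<4} \<times> {..<4}"]) (auto simp: P_def)
    show "has_period (\<lambda>d. a (r d)) d 3 \<and> has_period a d 2 \<and> has_period r d 3" if "P d" for d
      using that unfolding P_def
      by (intro conjI has_periodI) (auto dest!: small_exponents simp: r_def a_def numeral_eq_Suc)
    show "list_all (\<lambda>d. d \<in> orbit2 r a (0, 1, 2, 3)) ?ds" by (simp only: list.pred_inject simp_thms d0 d1 d2 d3)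
    show "distinct (concat (map (\<lambda>d. map (\<lambda>i. (r ^^ i) d) [0..<3]) ?ds))"
      by (simp add: r_def upt_rec numeral_eq_Suc)
  qed simp
  then show ?thesis by simp
qed

text \<open>The 4-cycle \<open>r\<close> and the transposition \<open>a\<close> generate \<open>S\<^sub>4\<close>, and their product is a 3-cycle.\<close>

lemma uniform_spherical_cube: "uniform_spherical cube 3 2 4 48"
proof -
  define r :: "nat \<times> nat \<times> nat \<times> nat \<Rightarrow> nat \<times> nat \<times> nat \<times> nat"
    where "r = (\<lambda>(x1, x2, x3, x4). (x2, x3, x4, x1))"
  define a :: "nat \<times> nat \<times> nat \<times> nat \<Rightarrow> nat \<times> nat \<times> nat \<times> nat"
    where "a = (\<lambda>(x1, x2, x3, x4). (x2, x1, x3, x4))"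
  define P :: "nat \<times> nat \<times> nat \<times> nat \<Rightarrow> bool"
    where "P = (\<lambda>(x1, x2, x3, x4). distinct [x1, x2, x3, x4] \<and> set [x1, x2, x3, x4] \<subseteq> {..<4})"
  let ?ds = "[(0, 1, 2, 3), (0, 2, 3, 1), (0, 2, 1, 3), (0, 1, 3, 2), (0, 3, 1, 2), (0, 3, 2, 1)]
      :: (nat \<times> nat \<times> nat \<times> nat) list"
  have step: "(r ^^ j) (a ((r ^^ i) d)) \<in> orbit2 r a d0" if "d \<in> orbit2 r a d0" for i j d d0
    using that by (intro orbit2_funpow orbit2.aI)
  have d0: "(0, 1, 2, 3) \<in> orbit2 r a (0, 1, 2, 3)" by (rule orbit2.base)
  have d1: "(0, 2, 3, 1) \<in> orbit2 r a (0, 1, 2, 3)"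
    using step[OF d0, of 1 0] by (simp add: r_def a_def numeral_eq_Suc)
  have d2: "(0, 2, 1, 3) \<in> orbit2 r a (0, 1, 2, 3)"
    using step[OF d0, of 3 1] by (simp add: r_def a_def numeral_eq_Suc)
  have d3: "(0, 1, 3, 2) \<in> orbit2 r a (0, 1, 2, 3)"
    using step[OF d0, of 2 2] by (simp add: r_def a_def numeral_eq_Suc)
  have d4: "(0, 3, 1, 2) \<in> orbit2 r a (0, 1, 2, 3)"
    using step[OF d0, of 0 3] by (simp add: r_def a_def numeral_eq_Suc)
  have d5: "(0, 3, 2, 1) \<in> orbit2 r a (0, 1, 2, 3)"
    using step[OF d1, of 3 1] by (simp add: r_def a_def numeral_eq_Suc)
  have "uniform_spherical (uniform_sphere 3 2 4) 3 2 4 (2 * (length ?ds * 4))"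
  proof (rule uniform_spherical_orbit2[where P = P and r = r and a = a and b = "(0, 1, 2, 3)"])
    show "P (0, 1, 2, 3)" by (simp add: P_def)
    show "P (r d) \<and> P (a d)" if "P d" for d
      using that by (auto simp: P_def r_def a_def)
    show "finite {d. P d}"
      by (rule finite_subset[of _ "{..<4} \<times> {..<4} \<times> {..<4} \<times> {..<4}"]) (auto simp: P_def)
    show "has_period (\<lambda>d. a (r d)) d 3 \<and> has_period a d 2 \<and> has_period r d 4" if "P d" for d
      using that unfolding P_def
      by (intro conjI has_periodI) (auto dest!: small_exponents simp: r_def a_def numeral_eq_Suc)
    show "list_all (\<lambda>d. d \<in> orbit2 r a (0, 1, 2, 3)) ?ds" by (simp only: list.pred_inject simp_thms d0 d1 d2 d3 d4 d5)
    show "distinct (concat (map (\<lambda>d. map (\<lambda>i. (r ^^ i) d) [0..<4]) ?ds))"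
      by (simp add: r_def upt_rec numeral_eq_Suc)
  qed simp
  then show ?thesis by simp
qed

text \<open>The 5-cycle \<open>r\<close> and the double transposition \<open>a\<close> generate \<open>A\<^sub>5\<close>, and their product is a 3-cycle.\<close>

lemma uniform_spherical_dodecahedron: "uniform_spherical dodecahedron 3 2 5 120"
proof -
  define r :: "nat \<times> nat \<times> nat \<times> nat \<times> nat \<Rightarrow> nat \<times> nat \<times> nat \<times> nat \<times> nat"
    where "r = (\<lambda>(x1, x2, x3, x4, x5). (x2, x3, x4, x5, x1))"
  define a :: "nat \<times> nat \<times> nat \<times> nat \<times> nat \<Rightarrow> nat \<times> nat \<times> nat \<times> nat \<times> nat"
    where "a = (\<lambda>(x1, x2, x3, x4, x5). (x2, x1, x4, x3, x5))"
  define P :: "nat \<times> nat \<times> nat \<times> nat \<times> nat \<Rightarrow> bool"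
    where "P = (\<lambda>(x1, x2, x3, x4, x5).
    distinct [x1, x2, x3, x4, x5] \<and> set [x1, x2, x3, x4, x5] \<subseteq> {..<5})"
  let ?ds = "[(0, 1, 2, 3, 4), (0, 3, 2, 4, 1), (0, 2, 1, 4, 3), (0, 4, 1, 3, 2), (0, 2, 4, 3, 1),
    (0, 4, 2, 1, 3), (0, 2, 3, 1, 4), (0, 1, 3, 4, 2), (0, 3, 1, 2, 4), (0, 1, 4, 2, 3),
    (0, 3, 4, 1, 2), (0, 4, 3, 2, 1)] :: (nat \<times> nat \<times> nat \<times> nat \<times> nat) list"
  let ?X = "orbit2 r a (0, 1, 2, 3, 4)"
  have step: "(r ^^ j) (a ((r ^^ i) d)) \<in> orbit2 r a d0" if "d \<in> orbit2 r a d0" for i j d d0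
    using that by (intro orbit2_funpow orbit2.aI)
  note [simp] = r_def a_def numeral_eq_Suc
  have d0: "(0, 1, 2, 3, 4) \<in> ?X" by (rule orbit2.base)
  have d1: "(0, 3, 2, 4, 1) \<in> ?X" using step[OF d0, of 1 0] by simp
  have d2: "(0, 2, 1, 4, 3) \<in> ?X" using step[OF d0, of 4 1] by simp
  have d3: "(0, 4, 1, 3, 2) \<in> ?X" using step[OF d0, of 2 2] by simp
  have d4: "(0, 2, 4, 3, 1) \<in> ?X" using step[OF d0, of 3 3] by simp
  have d5: "(0, 4, 2, 1, 3) \<in> ?X" using step[OF d0, of 0 4] by simp
  have d6: "(0, 2, 3, 1, 4) \<in> ?X" using step[OF d1, of 4 1] by simp
  have d7: "(0, 1, 3, 4, 2) \<in> ?X" using step[OF d1, of 2 2] by simp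
  have d8: "(0, 3, 1, 2, 4) \<in> ?X" using step[OF d2, of 0 4] by simp
  have d9: "(0, 1, 4, 2, 3) \<in> ?X" using step[OF d3, of 4 1] by simp
  have d10: "(0, 3, 4, 1, 2) \<in> ?X" using step[OF d4, of 1 0] by simp
  have d11: "(0, 4, 3, 2, 1) \<in> ?X" using step[OF d6, of 0 4] by simp
  have "uniform_spherical (uniform_sphere 3 2 5) 3 2 5 (2 * (length ?ds * 5))"
  proof (rule uniform_spherical_orbit2[where P = P and r = r and a = a and b = "(0, 1, 2, 3, 4)"])
    show "P (0, 1, 2, 3, 4)" by (simp add: P_def)
    show "P (r d) \<and> P (a d)" if "P d" for d
      using that by (auto simp: P_def)
    show "finite {d. P d}"
      by (rule finite_subset[of _ "{..<5} \<times> {..<5} \<times> {..<5} \<times> {..<5} \<times> {..<5}"]) (auto simp: P_def)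
    show "has_period (\<lambda>d. a (r d)) d 3 \<and> has_period a d 2 \<and> has_period r d 5" if "P d" for d
      using that unfolding P_def
      by (intro conjI has_periodI) (auto dest!: small_exponents)
    show "list_all (\<lambda>d. d \<in> ?X) ?ds"
      by (simp only: list.pred_inject simp_thms d0 d1 d2 d3 d4 d5 d6 d7 d8 d9 d10 d11)
    show "distinct (concat (map (\<lambda>d. map (\<lambda>i. (r ^^ i) d) [0..<5]) ?ds))"
      by (simp add: upt_rec)
  qed simp
  then show ?thesis by simp
qed

section \<open>The classification\<close>

lemma classification_rows:
  assumes n: "1 \<le> n"
  shows "\<forall>(t, v, L) \<in> set (classification n). realises_row t v L"
proof -
  note D = uniform_spherical_dihedral[OF n] and P = uniform_spherical_prism[OF n]
  note T = uniform_spherical_tetrahedron and C = uniform_spherical_cube and I = uniform_spherical_dodecahedron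
  have 1: "realises_row (1, 1, 2*n, 2*n) (n, n, 1, 1, 4*n) (Pin (dual02 (dihedral_D n)))"
    by (rule Pin_row[OF uniform_spherical_dual02[OF D]]) simp_all
  have 2: "realises_row (1, 2, 4, 2*n) (2*n, n, n, 2, 8*n) (Pin (prism_P n))"
    by (rule Pin_row[OF P]) simp_all
  have 3: "realises_row (1, 2, 6, 6) (12, 6, 4, 4, 48) (Pin (dual01 tetrahedron))"
    by (rule Pin_row[OF uniform_spherical_dual01[OF T]]) simp_all
  have 4: "realises_row (1, 2, 6, 8) (24, 12, 8, 6, 96) (Pin (dual01 cube))"
    by (rule Pin_row[OF uniform_spherical_dual01[OF C]]) simp_all
  have 5: "realises_row (1, 2, 6, 10) (60, 30, 20, 12, 240) (Pin (dual01 dodecahedron))"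
    by (rule Pin_row[OF uniform_spherical_dual01[OF I]]) simp_all
  have 6: "realises_row (1, 3, 4, 6) (12, 4, 6, 4, 48) (Pin tetrahedron)"
    by (rule Pin_row[OF T]) simp_all
  have 7: "realises_row (1, 3, 4, 8) (24, 8, 12, 6, 96) (Pin cube)"
    by (rule Pin_row[OF C]) simp_all
  have 8: "realises_row (1, 3, 4, 10) (60, 20, 30, 12, 240) (Pin dodecahedron)"
    by (rule Pin_row[OF I]) simp_all
  have 9: "realises_row (1, 4, 4, 6) (24, 6, 12, 8, 96) (Pin (dual02 cube))"
    by (rule Pin_row[OF uniform_spherical_dual02[OF C]]) simp_all
  have 10: "realises_row (1, 5, 4, 6) (60, 12, 30, 20, 240) (Pin (dual02 dodecahedron))"
    by (rule Pin_row[OF uniform_spherical_dual02[OF I]]) simp_all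
  have 11: "realises_row (1, n, 2, 2*n) (n, 1, n, 1, 4*n) (Pin (dual12 (dihedral_D n)))"
    by (rule Pin_row[OF uniform_spherical_dual12[OF D]]) simp_all
  have 12: "realises_row (1, n, 4, 4) (2*n, 2, n, n, 8*n) (Pin (dual02 (prism_P n)))"
    by (rule Pin_row[OF uniform_spherical_dual02[OF P]]) simp_all
  have 13: "realises_row (2, 2, 2, 2*n) (n, n, 2*n, 2, 8*n) (Wal (prism_P n))"
    by (rule Wal_row[OF P]) simp_all
  have 14: "realises_row (2, 3, 2, 6) (6, 4, 12, 4, 48) (Wal tetrahedron)"
    by (rule Wal_row[OF T]) simp_all
  have 15: "realises_row (2, 3, 2, 8) (12, 8, 24, 6, 96) (Wal cube)"
    by (rule Wal_row[OF C]) simp_all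
  have 16: "realises_row (2, 3, 2, 10) (30, 20, 60, 12, 240) (Wal dodecahedron)"
    by (rule Wal_row[OF I]) simp_all
  have 17: "realises_row (2, 4, 2, 6) (12, 6, 24, 8, 96) (Wal (dual02 cube))"
    by (rule Wal_row[OF uniform_spherical_dual02[OF C]]) simp_all
  have 18: "realises_row (2, 5, 2, 6) (30, 12, 60, 20, 240) (Wal (dual02 dodecahedron))"
    by (rule Wal_row[OF uniform_spherical_dual02[OF I]]) simp_all
  have 19: "realises_row (2, n, 2, 4) (n, 2, 2*n, n, 8*n) (Wal (dual02 (prism_P n)))"
    by (rule Wal_row[OF uniform_spherical_dual02[OF P]]) simp_all
  have 20: "realises_row (3, 3, 2, 4) (4, 4, 12, 6, 48) (Wal (dual12 tetrahedron))"
    by (rule Wal_row[OF uniform_spherical_dual12[OF T]]) simp_all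
  have 21: "realises_row (3, 4, 2, 4) (8, 6, 24, 12, 96) (Wal (dual12 cube))"
    by (rule Wal_row[OF uniform_spherical_dual12[OF C]]) simp_all
  have 22: "realises_row (3, 5, 2, 4) (20, 12, 60, 30, 240) (Wal (dual12 dodecahedron))"
    by (rule Wal_row[OF uniform_spherical_dual12[OF I]]) simp_all
  have 23: "realises_row (n, n, 2, 2) (1, 1, n, n, 4*n) (Wal (dihedral_D n))"
    by (rule Wal_row[OF D]) simp_all
  show ?thesis
    unfolding classification_def list.set ball_simps prod.case
    by (intro conjI TrueI 1 2 3 4 5 6 7 8 9 10 11 12 13 14 15 16 17 18 19 20 21 22 23)
qed

lemma listed_iso:
  assumes B: "bip_data K c l1 l2 m n" and sph: "spherical K"
    and t: "listed (l1, l2, m, n) \<or> listed (l2, l1, m, n)"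
  shows "\<exists>k\<ge>1. \<exists>(t, v, L) \<in> set (classification k). K \<cong>\<^sub>h L"
proof -
  obtain l1' l2' c' where B': "bip_data K c' l1' l2' m n" and "listed (l1', l2', m, n)"
    using t B bip_data_swap[OF B] by blast
  then obtain k v L where k: "1 \<le> k" and mem: "((l1', l2', m, n), v, L) \<in> set (classification k)"
    unfolding listed_def by force
  have r: "realises_row (l1', l2', m, n) v L" using classification_rows[OF k] mem by blast
  have K: "is_hypermap K" "colour_regular K c'" "colouring K c'"
    using B' by (simp_all add: bip_data_def) (simp add: colour_regular_def)
  have "bipartite_regular K" "bipartite K"
    using bipartite_regular_iff[OF K(1)] bipartite_iff[OF K(1)] K(2,3) by blast+
  moreover then have "has_bipartite_type K (l1', l2', m, n)"
    unfolding has_bipartite_type_def using bip_data_type[OF B'] by blast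
  ultimately have "K \<cong>\<^sub>h L" using row_unique[OF r K(1)] sph by blast
  then show ?thesis using k mem by blast
qed

theorem mainTheorem2:
  shows
    "(\<forall>K :: 'a hypermap.
        is_hypermap K \<and> bipartite_regular K \<and> spherical K \<longrightarrow>
        (\<exists>n\<ge>1. \<exists>(t, c, L) \<in> set (classification n). K \<cong>\<^sub>h L \<or> dual12 K \<cong>\<^sub>h L)) \<and>
     (\<forall>n\<ge>1. \<forall>(t, c, L) \<in> set (classification n).
        is_hypermap L \<and> bipartite_regular L \<and> spherical L \<and>
        has_bipartite_type_and_numbers L t c \<and>
        (\<forall>K :: 'a hypermap.
           is_hypermap K \<and> bipartite_regular K \<and> spherical K \<and> has_bipartite_type K t \<longrightarrow>
           K \<cong>\<^sub>h L))"
proof (intro conjI allI impI)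
  fix K :: "'a hypermap"
  assume K: "is_hypermap K \<and> bipartite_regular K \<and> spherical K"
  then obtain c where "colour_regular K c" using bipartite_regular_iff by blast
  then obtain l1 l2 a b where B: "bip_data K c l1 l2 (2 * a) (2 * b)"
    using exists_bip_data K by blast
  have sph: "spherical K" using K by blast
  obtain c' where D: "bip_data (dual12 K) c' l1 l2 (2 * b) (2 * a)" using dual12_data(1)[OF B] by blast
  have "euler (dual12 K) = euler K"
    unfolding euler_bip[OF B] euler_bip[OF D] dual12_data(2)[OF B] by (simp add: add_ac)
  then have sphD: "spherical (dual12 K)" using sph by (simp add: spherical_iff)
  have "(\<exists>k\<ge>1. \<exists>(t, v, L) \<in> set (classification k). K \<cong>\<^sub>h L) \<or>
      (\<exists>k\<ge>1. \<exists>(t, v, L) \<in> set (classification k). dual12 K \<cong>\<^sub>h L)"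
    using bip_data_listed[OF B sph] listed_iso[OF B sph] listed_iso[OF D sphD]
    unfolding sym_listed_def by argo
  then show "\<exists>n\<ge>1. \<exists>(t, c, L) \<in> set (classification n). K \<cong>\<^sub>h L \<or> dual12 K \<cong>\<^sub>h L"
    by blast
next
  fix n :: nat assume n: "1 \<le> n"
  have "is_hypermap L \<and> bipartite_regular L \<and> spherical L \<and> has_bipartite_type_and_numbers L t v \<and>
      (\<forall>K :: 'a hypermap.
         is_hypermap K \<and> bipartite_regular K \<and> spherical K \<and> has_bipartite_type K t \<longrightarrow> K \<cong>\<^sub>h L)"
    if "(t, v, L) \<in> set (classification n)" for t v L
  proof -
    have r: "realises_row t v L" using classification_rows[OF n] that by blast
    then show ?thesis using row_unique[OF r] unfolding realises_row_def by blast
  qed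
  then show "\<forall>(t, c, L) \<in> set (classification n).
      is_hypermap L \<and> bipartite_regular L \<and> spherical L \<and> has_bipartite_type_and_numbers L t c \<and>
      (\<forall>K :: 'a hypermap.
         is_hypermap K \<and> bipartite_regular K \<and> spherical K \<and> has_bipartite_type K t \<longrightarrow> K \<cong>\<^sub>h L)"
    by blast
qed

end
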